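(* Let $E$ be a Banach space, let $\alpha\in(0,\frac12]$ and let $p\in[1,2)$ be such that $\alpha=\frac1p-\frac12$. If every function in $C^\alpha([0,1];E)$ is stochastically integrable with respect to a real-valued Brownian motion $W$, then $E$ has stable type $p$.
   Context: $C^\alpha([0,1];E)$ is the space of $\alpha$-Hölder continuous functions $\phi:[0,1]\to E$ with norm $\sup_t\|\phi(t)\|+\sup_{s<t}\|\phi(t)-\phi(s)\|/(t-s)^\alpha$. A (deterministic) strongly measurable function $\phi:[0,1]\to E$ is stochastically integrable with respect to $W$ if $\langle\phi,x^*\rangle\in L^2(0,1)$ for all $x^*\in E^*$ and there exists a strongly measurable random variable $Y:\Omega\to E$ with $\langle Y,x^*\rangle=\int_0^1\langle\phi(t),x^*\rangle\,dW(t)$ almost surely for all $x^*\in E^*$ (Wiener integral). $E$ has stable type $p$ if, for a sequence $(\theta_n)$ of i.i.d. standard symmetric $p$-stable random variables (i.e. $\mathbb{E}e^{i\xi\theta_n}=e^{-|\xi|^p}$) and some (equivalently all) $r\in(0,p)$, there is $C$ with $(\mathbb{E}\|\sum_n\theta_nx_n\|^r)^{1/r}\le C(\sum_n\|x_n\|^p)^{1/p}$ for all finite sequences $(x_n)$ in $E$. *)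

theory Defs
  imports "HOL-Probability.Probability"
begin

definition strongly_measurable :: "'m measure \<Rightarrow> ('m \<Rightarrow> 'e::real_normed_vector) \<Rightarrow> bool" where
  "strongly_measurable N f \<longleftrightarrow>
     (\<exists>s::nat \<Rightarrow> 'm \<Rightarrow> 'e. (\<forall>n. s n \<in> borel_measurable N \<and> finite (range (s n))) \<and>
        (\<forall>x\<in>space N. (\<lambda>n. s n x) \<longlonglongrightarrow> f x))"

definition brownian_motion :: "'a measure \<Rightarrow> (real \<Rightarrow> 'a \<Rightarrow> real) \<Rightarrow> bool" where
  "brownian_motion M W \<longleftrightarrow> prob_space M \<and>
     (\<forall>t. W t \<in> borel_measurable M) \<and>
     (AE \<omega> in M. W 0 \<omega> = 0) \<and>
     (\<forall>s t. 0 \<le> s \<and> s < t \<longrightarrow>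
        distributed M lborel (\<lambda>\<omega>. W t \<omega> - W s \<omega>) (normal_density 0 (sqrt (t - s)))) \<and>
     (\<forall>n (\<tau>::nat \<Rightarrow> real). (\<forall>i<n. 0 \<le> \<tau> i \<and> \<tau> i \<le> \<tau> (Suc i)) \<longrightarrow>
        prob_space.indep_vars M (\<lambda>_. borel) (\<lambda>i \<omega>. W (\<tau> (Suc i)) \<omega> - W (\<tau> i) \<omega>) {..<n}) \<and>
     (AE \<omega> in M. continuous_on {0..} (\<lambda>t. W t \<omega>))"

definition L2_01 :: "(real \<Rightarrow> real) \<Rightarrow> bool" where
  "L2_01 g \<longleftrightarrow> g \<in> borel_measurable (restrict_space lborel {0..1}) \<and>
     (\<integral>\<^sup>+ t\<in>{0..1}. ennreal ((g t)\<^sup>2) \<partial>lborel) < \<infinity>"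

definition wiener_integral :: "'a measure \<Rightarrow> (real \<Rightarrow> 'a \<Rightarrow> real) \<Rightarrow> (real \<Rightarrow> real) \<Rightarrow> ('a \<Rightarrow> real) \<Rightarrow> bool" where
  "wiener_integral M W g Z \<longleftrightarrow> Z \<in> borel_measurable M \<and>
     (\<exists>(k::nat \<Rightarrow> nat) (c::nat \<Rightarrow> nat \<Rightarrow> real) (a::nat \<Rightarrow> nat \<Rightarrow> real) (b::nat \<Rightarrow> nat \<Rightarrow> real).
        (\<forall>n i. 0 \<le> a n i \<and> a n i \<le> b n i \<and> b n i \<le> 1) \<and>
        (\<lambda>n. \<integral>\<^sup>+ t\<in>{0..1}. ennreal ((g t - (\<Sum>i<k n. c n i * indicator {a n i<..b n i} t))\<^sup>2) \<partial>lborel)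
          \<longlonglongrightarrow> 0 \<and>
        (\<lambda>n. \<integral>\<^sup>+ \<omega>. ennreal ((Z \<omega> - (\<Sum>i<k n. c n i * (W (b n i) \<omega> - W (a n i) \<omega>)))\<^sup>2) \<partial>M)
          \<longlonglongrightarrow> 0)"

definition stoch_integrable :: "'a measure \<Rightarrow> (real \<Rightarrow> 'a \<Rightarrow> real) \<Rightarrow> (real \<Rightarrow> 'e::banach) \<Rightarrow> bool" where
  "stoch_integrable M W \<phi> \<longleftrightarrow>
     strongly_measurable (restrict_space lborel {0..1}) \<phi> \<and>
     (\<forall>x'::'e \<Rightarrow>\<^sub>L real. L2_01 (\<lambda>t. blinfun_apply x' (\<phi> t))) \<and>
     (\<exists>Y::'a \<Rightarrow> 'e. strongly_measurable M Y \<and>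
        (\<forall>x'::'e \<Rightarrow>\<^sub>L real. wiener_integral M W (\<lambda>t. blinfun_apply x' (\<phi> t)) (\<lambda>\<omega>. blinfun_apply x' (Y \<omega>))))"

definition holder_space :: "real \<Rightarrow> (real \<Rightarrow> 'e::real_normed_vector) set" where
  "holder_space \<alpha> = {\<phi>. (\<exists>B. \<forall>t\<in>{0..1}. norm (\<phi> t) \<le> B) \<and>
     (\<exists>C. \<forall>s\<in>{0..1}. \<forall>t\<in>{0..1}. s < t \<longrightarrow> norm (\<phi> t - \<phi> s) \<le> C * (t - s) powr \<alpha>)}"

definition std_sym_stable :: "real \<Rightarrow> real measure \<Rightarrow> bool" where
  "std_sym_stable p \<mu> \<longleftrightarrow> real_distribution \<mu> \<and>
     (\<forall>\<xi>. char \<mu> \<xi> = complex_of_real (exp (- (\<bar>\<xi>\<bar> powr p))))"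

text \<open>Stable type p. The i.i.d. sequence theta_0..theta_{n-1} is realised canonically on the
  product space PiM {..<n} (\<lambda>_. mu); the inequality (E||.||^r)^(1/r) \<le> C(...)^(1/p) is
  stated in the equivalent form E||.||^r \<le> (C(...)^(1/p))^r.\<close>
definition stable_type :: "'e::banach itself \<Rightarrow> real \<Rightarrow> bool" where
  "stable_type _ p \<longleftrightarrow>
     (\<exists>r C. 0 < r \<and> r < p \<and> 0 \<le> C \<and>
        (\<forall>\<mu>. std_sym_stable p \<mu> \<longrightarrow>
          (\<forall>(n::nat) (x::nat \<Rightarrow> 'e).
             (\<integral>\<^sup>+ \<theta>. ennreal (norm (\<Sum>i<n. \<theta> i *\<^sub>R x i) powr r) \<partial>(PiM {..<n} (\<lambda>_. \<mu>)))
               \<le> ennreal ((C * (\<Sum>i<n. norm (x i) powr p) powr (1 / p)) powr r))))"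

end

theory Submission
  imports Defs
begin

text \<open>
  Let \<open>\<psi>\<close> be a second difference of hat functions. For vectors \<open>x j k\<close> of the unit ball the series
  \<open>f = \<Sum>\<^sub>j 4 powr (- j \<alpha>) \<Sum>\<^sub>k \<psi> (4 ^ j t - k) x j k\<close> is Hoelder of exponent \<open>\<alpha>\<close>, and by orthogonality its stochastic
  integral is the Gaussian sum of the vectors \<open>4 powr (- j / p) x j k\<close>, \<open>k < 4 ^ j\<close>, up to constants. A gliding hump,
  together with finitely many norming functionals for the finitely many sign patterns involved, turns
  integrability of all such \<open>f\<close> into a bound in probability for the corresponding Rademacher sums that is uniform
  over all families with at most \<open>4 ^ j\<close> vectors of norm \<open>4 powr (- j / p)\<close> on each level \<open>j\<close>. Since \<open>4 ^ l\<close> independent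
  copies of such a family, scaled by \<open>4 powr (- l / p)\<close>, are again of this form, the bound improves itself to a power
  tail. Conditionally on their moduli, the terms \<open>\<theta>\<^sub>i x\<^sub>i\<close> of a stable sum form, with overwhelming probability and up
  to scaling, a family of this kind: this is the weak \<open>\<ell>\<^sup>p\<close> estimate that follows from the tail of the stable law.
\<close>

section \<open>Rademacher averages\<close>

text \<open>The random vector \<open>Y\<close> is tied to the Brownian motion only through one
  scalar Wiener integral per functional, so a priori the Riemann sums of \<open>f\<close> approach
  it only weakly, without uniformity over functionals. Hence the norm of one fixed Rademacher sum is
  replaced by a maximum of finitely many functionals, chosen before the mesh is refined; this is why
  the Rademacher estimates are stated for abstract seminorms. Haar functions would be orthogonal but
  not Hoelder continuous; a piecewise affine \<open>\<psi>\<close> orthogonal to affine functions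
  allows both, and its four affine pieces are why scales are powers of four. The L2 norm of a dilate
  of level \<open>j\<close> carries a factor \<open>(1/2) ^ j\<close>, which turns
  \<open>4 powr (- j \<alpha>)\<close> into \<open>4 powr (- j / p)\<close>. With
  \<open>b = 4 powr (- (1/p))\<close>, the final tail estimate loses \<open>b ^ l\<close> twice:
  once when the moduli of the stable variables are cut off, once in the self-improved tail. Since
  \<open>b \<ge> 1/4\<close>, probabilities of order \<open>4 powr (- l)\<close> then belong to
  thresholds of order at most \<open>16 ^ l\<close>. This decay of order 1/2 is enough for a moment
  of order 1/4, and one order \<open>r < p\<close> suffices.\<close>

definition real_seminorm :: "('e::real_vector \<Rightarrow> real) \<Rightarrow> bool" where
  "real_seminorm q \<longleftrightarrow> (\<forall>u v. q (u + v) \<le> q u + q v) \<and> (\<forall>c v. q (c *\<^sub>R v) = \<bar>c\<bar> * q v)"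

lemma real_seminorm_add: "real_seminorm q \<Longrightarrow> q (u + v) \<le> q u + q v"
  and real_seminorm_scaleR: "real_seminorm q \<Longrightarrow> q (c *\<^sub>R v) = \<bar>c\<bar> * q v"
  by (auto simp: real_seminorm_def)

lemma real_seminorm_zero: "real_seminorm q \<Longrightarrow> q 0 = 0"
  using real_seminorm_scaleR[of q 0 0] by simp

lemma real_seminorm_minus: "real_seminorm q \<Longrightarrow> q (- v) = q v"
  using real_seminorm_scaleR[of q "-1" v] by simp

lemma real_seminorm_norm: "real_seminorm (norm :: 'e::real_normed_vector \<Rightarrow> real)"
  by (simp add: real_seminorm_def norm_triangle_ineq)

text \<open>The expectation of \<open>F\<close> at the Rademacher sum with coefficients
  \<open>z\<close>; \<open>A\<close> is the set of plus signs. As a finite average it needs no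
  probability space.\<close>

definition rsum :: "'i set \<Rightarrow> ('i \<Rightarrow> 'e::real_vector) \<Rightarrow> ('e \<Rightarrow> real) \<Rightarrow> real" where
  "rsum S z F = (\<Sum>A\<in>Pow S. F (\<Sum>i\<in>S. if i \<in> A then z i else - z i)) / 2 ^ card S"

lemma rsum_empty [simp]: "rsum {} z F = F 0"
  by (simp add: rsum_def)

text \<open>Conditioning on the sign at \<open>x\<close>. Through this recursion unions, reindexing
  and contraction become inductions over \<open>S\<close>.\<close>

lemma rsum_insert:
  assumes "finite S" "x \<notin> S"
  shows "rsum (insert x S) z F = (rsum S z (\<lambda>v. F (v + z x)) + rsum S z (\<lambda>v. F (v - z x))) / 2"
proof -
  have inj: "inj_on (insert x) (Pow S)"
    using assms by (auto simp: inj_on_def)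
  have disj: "Pow S \<inter> insert x ` Pow S = {}"
    using assms by auto
  have 1: "(\<Sum>i\<in>insert x S. if i \<in> A then z i else - z i) = (\<Sum>i\<in>S. if i \<in> A then z i else - z i) - z x"
    if "A \<in> Pow S" for A
    using that assms by auto
  have 2: "(\<Sum>i\<in>insert x S. if i \<in> insert x A then z i else - z i)
      = (\<Sum>i\<in>S. if i \<in> A then z i else - z i) + z x" for A
  proof -
    have "(\<Sum>i\<in>S. if i \<in> insert x A then z i else - z i) = (\<Sum>i\<in>S. if i \<in> A then z i else - z i)"
      using assms by (intro sum.cong) auto
    then show ?thesis using assms by simp
  qed
  let ?f = "\<lambda>A. F (\<Sum>i\<in>insert x S. if i \<in> A then z i else - z i)"
  have 3: "sum ?f (Pow S) = (\<Sum>A\<in>Pow S. F ((\<Sum>i\<in>S. if i \<in> A then z i else - z i) - z x))"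
    using 1 by (intro sum.cong refl arg_cong[where f=F])
  have 4: "sum ?f (insert x ` Pow S) = (\<Sum>A\<in>Pow S. F ((\<Sum>i\<in>S. if i \<in> A then z i else - z i) + z x))"
    unfolding sum.reindex[OF inj] o_def 2 ..
  have "sum ?f (Pow (insert x S))
     = (\<Sum>A\<in>Pow S. F ((\<Sum>i\<in>S. if i \<in> A then z i else - z i) - z x))
     + (\<Sum>A\<in>Pow S. F ((\<Sum>i\<in>S. if i \<in> A then z i else - z i) + z x))"
    unfolding Pow_insert using assms
    by (subst sum.union_disjoint[OF _ _ disj], unfold 3 4) auto
  then show ?thesis
    using assms unfolding rsum_def by (simp add: field_simps)
qed

lemma rsum_mono: "(\<And>v. F v \<le> G v) \<Longrightarrow> rsum S z F \<le> rsum S z G"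
  unfolding rsum_def by (intro divide_right_mono sum_mono) auto

lemma rsum_add: "rsum S z (\<lambda>v. F v + G v) = rsum S z F + rsum S z G"
  unfolding rsum_def by (simp add: sum.distrib add_divide_distrib)

lemma rsum_cmult: "rsum S z (\<lambda>v. c * F v) = c * rsum S z F"
  unfolding rsum_def by (simp add: sum_distrib_left)

lemma rsum_const: "finite S \<Longrightarrow> rsum S z (\<lambda>_. c) = c"
  unfolding rsum_def by (simp add: card_Pow)

lemma rsum_cong: "(\<And>i. i \<in> S \<Longrightarrow> z i = z' i) \<Longrightarrow> rsum S z F = rsum S z' F"
  unfolding rsum_def by (auto intro!: sum.cong arg_cong[where f=F] arg_cong2[where f="(/)"])

text \<open>Fubini for two independent blocks of signs.\<close>

lemma rsum_union:
  assumes "finite S" "finite T" "S \<inter> T = {}"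
  shows "rsum (S \<union> T) z F = rsum S z (\<lambda>v. rsum T z (\<lambda>w. F (v + w)))"
  using assms
proof (induction S arbitrary: F rule: finite_induct)
  case (insert x S)
  have "rsum (insert x (S \<union> T)) z F
    = (rsum (S \<union> T) z (\<lambda>v. F (v + z x)) + rsum (S \<union> T) z (\<lambda>v. F (v - z x))) / 2"
    using insert by (intro rsum_insert) auto
  also have "\<dots> = rsum (insert x S) z (\<lambda>v. rsum T z (\<lambda>w. F (v + w)))"
    using insert by (simp add: rsum_insert algebra_simps)
  finally show ?case by simp
qed simp

lemma rsum_image:
  assumes "finite S" "inj_on h S"
  shows "rsum (h ` S) z F = rsum S (\<lambda>i. z (h i)) F"
  using assms
proof (induction S arbitrary: F rule: finite_induct)
  case (insert x S)
  then have "h x \<notin> h ` S" by auto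
  with insert show ?case by (simp add: rsum_insert)
qed simp

lemma rsum_zero:
  assumes "finite S" "\<And>i. i \<in> S \<Longrightarrow> z i = 0"
  shows "rsum S z F = F 0"
  using assms by (induction S arbitrary: F rule: finite_induct) (auto simp: rsum_insert)

lemma rsum_superset:
  assumes "finite T" "S \<subseteq> T" "\<And>i. i \<in> T - S \<Longrightarrow> z i = 0"
  shows "rsum T z F = rsum S z F"
proof -
  have "rsum (S \<union> (T - S)) z F = rsum S z F"
    using finite_subset[of S T] rsum_zero[of "T - S" z, OF _ assms(3)] assms(1,2) by (subst rsum_union) auto
  then show ?thesis using assms by (simp add: Un_absorb1)
qed

lemma rsum_sign:
  assumes "finite S" "\<And>i. i \<in> S \<Longrightarrow> s i = 1 \<or> s i = (-1::real)"
  shows "rsum S (\<lambda>i. s i *\<^sub>R z i) F = rsum S z F"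
  using assms
proof (induction S arbitrary: F rule: finite_induct)
  case (insert x S)
  then have "s x = 1 \<or> s x = -1" by auto
  then show ?case
    using insert.hyps insert.IH insert.prems by (elim disjE) (simp_all add: rsum_insert)
qed simp

lemma rsum_scaleR: "rsum S (\<lambda>i. c *\<^sub>R z i) F = rsum S z (\<lambda>v. F (c *\<^sub>R v))"
proof -
  have "(\<Sum>i\<in>S. if i \<in> A then c *\<^sub>R z i else - (c *\<^sub>R z i)) = c *\<^sub>R (\<Sum>i\<in>S. if i \<in> A then z i else - z i)" for A
    by (auto simp: scaleR_sum_right intro!: sum.cong)
  then show ?thesis unfolding rsum_def by simp
qed

lemma rsum_uminus: "finite S \<Longrightarrow> rsum S z (\<lambda>v. F (- v)) = rsum S z F"
  using rsum_scaleR[of S "-1" z F] rsum_sign[of S "\<lambda>_. -1" z F] by simp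

text \<open>Symmetry: \<open>v\<close> is the midpoint of \<open>v + w\<close> and
  \<open>v - w\<close>, so at least one of them lies outside the ball of radius \<open>t\<close>,
  and both are equally distributed.\<close>

lemma rsum_half:
  assumes q: "real_seminorm q" and S: "finite S" and v: "q v > t"
  shows "1/2 \<le> rsum S z (\<lambda>w. of_bool (q (v + w) > t))"
proof -
  have *: "1 \<le> of_bool (q (v + w) > t) + (of_bool (q (v + - w) > t) :: real)" for w
  proof -
    have "2 * q v \<le> q (v + w) + q (v + - w)"
      using real_seminorm_add[OF q, of "v + w" "v + - w"] real_seminorm_scaleR[OF q, of 2 v]
      by (simp add: scaleR_2)
    then show ?thesis using v by (auto simp: of_bool_def)
  qed
  have "1 = rsum S z (\<lambda>_. 1)" using S by (simp add: rsum_const)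
  also have "\<dots> \<le> rsum S z (\<lambda>w. of_bool (q (v + w) > t) + of_bool (q (v + - w) > t))"
    by (rule rsum_mono) (rule *)
  also have "\<dots> = 2 * rsum S z (\<lambda>w. of_bool (q (v + w) > t))"
    using rsum_uminus[OF S, of z "\<lambda>w. of_bool (q (v + w) > t)"] by (simp add: rsum_add)
  finally show ?thesis by simp
qed

lemma rsum_le_1:
  assumes "finite S" "\<And>v. F v \<le> 1"
  shows "rsum S z F \<le> 1"
  using rsum_mono[of F "\<lambda>_. 1" S z] assms by (simp add: rsum_const)

lemma rsum_nonneg:
  assumes "\<And>v. 0 \<le> F v"
  shows "0 \<le> rsum S z F"
  unfolding rsum_def using assms by (intro divide_nonneg_nonneg sum_nonneg) auto

text \<open>The invariant \<open>q (w - l v) \<le> (1 - l) t\<close> is Abel summation: it persists, with coefficients taken in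
  decreasing order, as long as no partial sum \<open>v\<close> leaves the ball of radius \<open>t\<close>.\<close>

lemma rsum_contraction_aux:
  fixes z :: "'i \<Rightarrow> 'e::real_vector"
  assumes q: "real_seminorm q" and S: "finite S"
  shows "(\<And>i. i \<in> S \<Longrightarrow> 0 \<le> c i \<and> c i \<le> l) \<Longrightarrow> 0 \<le> l \<Longrightarrow> q (w - l *\<^sub>R v) \<le> (1 - l) * t \<Longrightarrow>
    rsum S (\<lambda>i. c i *\<^sub>R z i) (\<lambda>u. of_bool (q (w + u) > t)) \<le> 2 * rsum S z (\<lambda>u. of_bool (q (v + u) > t))"
  using S
proof (induction S arbitrary: l v w rule: finite_ranking_induct[where f=c])
  case empty
  have "q w \<le> q (w - l *\<^sub>R v) + l * q v"
    using real_seminorm_add[OF q, of "w - l *\<^sub>R v" "l *\<^sub>R v"] real_seminorm_scaleR[OF q, of l v] empty by simp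
  moreover have "l * q v \<le> l * t" if "q v \<le> t" using that empty by (simp add: mult_left_mono)
  ultimately have "q v \<le> t \<Longrightarrow> q w \<le> t" using empty by (simp add: algebra_simps)
  then show ?case by (auto simp: of_bool_def)
next
  case (insert x S)
  show ?case
  proof (cases "x \<in> S")
    \<comment> \<open>The ranking induction adds an element of maximal coefficient, which may
      already belong to \<open>S\<close>.\<close>
    case True
    then have "insert x S = S" by auto
    then show ?thesis using insert.IH[of l w v] insert.prems by auto
  next
    case x: False
    show ?thesis
    proof (cases "q v > t")
      \<comment> \<open>Once \<open>v\<close> has left the ball, symmetry alone makes the average on
        the right at least one half; this is the source of the factor 2.\<close>
      case True
      have "rsum (insert x S) (\<lambda>i. c i *\<^sub>R z i) (\<lambda>u. of_bool (q (w + u) > t)) \<le> 1"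
        using insert.hyps by (intro rsum_le_1) auto
      moreover have "1/2 \<le> rsum (insert x S) z (\<lambda>u. of_bool (q (v + u) > t))"
        using insert.hyps True by (intro rsum_half[OF q]) auto
      ultimately show ?thesis by simp
    next
      case False
      have cx: "0 \<le> c x" "c x \<le> l" using insert.prems by auto
      \<comment> \<open>Lowering \<open>l\<close> to \<open>c x\<close> keeps the invariant because
        \<open>q v \<le> t\<close>. Moving \<open>v\<close> by plus or minus \<open>z x\<close> and
        \<open>w\<close> by \<open>c x\<close> times the same vector then leaves
        \<open>w - c x *\<^sub>R v\<close> unchanged.\<close>
      have "q (w - c x *\<^sub>R v) \<le> q (w - l *\<^sub>R v) + (l - c x) * q v"
        using real_seminorm_add[OF q, of "w - l *\<^sub>R v" "(l - c x) *\<^sub>R v"] real_seminorm_scaleR[OF q, of "l - c x" v] cx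
        by (simp add: algebra_simps)
      also have "\<dots> \<le> (1 - l) * t + (l - c x) * t"
        using insert.prems False cx by (intro add_mono mult_left_mono) auto
      finally have key: "q (w - c x *\<^sub>R v) \<le> (1 - c x) * t" by (simp add: algebra_simps)
      have A: "rsum S (\<lambda>i. c i *\<^sub>R z i) (\<lambda>u. of_bool (q ((w + c x *\<^sub>R z x) + u) > t))
         \<le> 2 * rsum S z (\<lambda>u. of_bool (q ((v + z x) + u) > t))"
        using insert.hyps insert.prems cx key by (intro insert.IH[of "c x"]) (auto simp: algebra_simps)
      have B: "rsum S (\<lambda>i. c i *\<^sub>R z i) (\<lambda>u. of_bool (q ((w - c x *\<^sub>R z x) + u) > t))
         \<le> 2 * rsum S z (\<lambda>u. of_bool (q ((v - z x) + u) > t))"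
        using insert.hyps insert.prems cx key by (intro insert.IH[of "c x"]) (auto simp: algebra_simps)
      have eq: "a + (u + y) = (a + y) + u" "a + (u - y) = (a - y) + u" for a u y :: 'e
        by (simp_all add: algebra_simps)
      show ?thesis
        unfolding rsum_insert[OF \<open>finite S\<close> x] eq using A B by simp
    qed
  qed
qed

text \<open>Kahane's contraction principle for tails: the invariant starts at \<open>l = 1\<close>
  and \<open>w = v = 0\<close>.\<close>

lemma rsum_contraction:
  assumes "real_seminorm q" "finite S" "0 \<le> t" "\<And>i. i \<in> S \<Longrightarrow> 0 \<le> c i \<and> c i \<le> 1"
  shows "rsum S (\<lambda>i. c i *\<^sub>R z i) (\<lambda>u. of_bool (q u > t)) \<le> 2 * rsum S z (\<lambda>u. of_bool (q u > t))"
  using rsum_contraction_aux[OF assms(1,2), of c 1 0 0 t z] assms by (simp add: real_seminorm_zero)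

lemma rsum_subset:
  assumes "real_seminorm q" "finite T" "S \<subseteq> T" "0 \<le> t"
  shows "rsum S z (\<lambda>u. of_bool (q u > t)) \<le> 2 * rsum T z (\<lambda>u. of_bool (q u > t))"
proof -
  have "rsum S z (\<lambda>u. of_bool (q u > t)) = rsum S (\<lambda>i. of_bool (i \<in> S) *\<^sub>R z i) (\<lambda>u. of_bool (q u > t))"
    by (intro rsum_cong) auto
  also have "\<dots> = rsum T (\<lambda>i. of_bool (i \<in> S) *\<^sub>R z i) (\<lambda>u. of_bool (q u > t))"
    using assms by (intro rsum_superset[symmetric]) auto
  also have "\<dots> \<le> 2 * rsum T z (\<lambda>u. of_bool (q u > t))"
    using assms by (intro rsum_contraction) auto
  finally show ?thesis .
qed

lemma rsum_split:
  assumes q: "real_seminorm q" and T: "finite T" and "S \<subseteq> T"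
  shows "rsum T z (\<lambda>u. of_bool (q u > 2 * t))
    \<le> rsum S z (\<lambda>u. of_bool (q u > t)) + rsum (T - S) z (\<lambda>u. of_bool (q u > t))"
proof -
  have fin: "finite S" "finite (T - S)" using assms finite_subset by auto
  have le: "of_bool (q (v + w) > 2 * t) \<le> of_bool (q v > t) + (of_bool (q w > t) :: real)" for v w
    using real_seminorm_add[OF q, of v w] by (auto simp: of_bool_def)
  have "rsum T z (\<lambda>u. of_bool (q u > 2 * t)) = rsum (S \<union> (T - S)) z (\<lambda>u. of_bool (q u > 2 * t))"
    using assms by (simp add: Un_absorb1)
  also have "\<dots> = rsum S z (\<lambda>v. rsum (T - S) z (\<lambda>w. of_bool (q (v + w) > 2 * t)))"
    using fin by (intro rsum_union) auto
  also have "\<dots> \<le> rsum S z (\<lambda>v. rsum (T - S) z (\<lambda>w. of_bool (q v > t) + of_bool (q w > t)))"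
    by (intro rsum_mono le)
  also have "\<dots> = rsum S z (\<lambda>u. of_bool (q u > t)) + rsum (T - S) z (\<lambda>u. of_bool (q u > t))"
    using fin by (simp add: rsum_add rsum_const)
  finally show ?thesis .
qed

text \<open>A Levy type inequality for \<open>m\<close> independent copies, from an arbitrary start
  \<open>v\<close>. While the running sum stays in the ball of radius \<open>t\<close>, a copy of
  size above \<open>2 * t\<close> throws it out, and from outside the final sum is outside with
  probability at least one half.\<close>

lemma rsum_copies:
  fixes z :: "'i \<Rightarrow> 'e::real_vector" and t :: real
  assumes q: "real_seminorm q" and S: "finite S"
  defines "a \<equiv> rsum S z (\<lambda>u. of_bool (q u > 2 * t))"
  shows "(1 - (1 - a) ^ m) / 2 \<le> rsum ({..<m} \<times> S) (\<lambda>(j, i). z i) (\<lambda>u. of_bool (q (v + u) > t))"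
proof (induction m arbitrary: v)
  case 0
  show ?case by simp
next
  case (Suc m)
  have a: "0 \<le> a" "a \<le> 1"
    unfolding a_def using S by (auto intro!: rsum_nonneg rsum_le_1)
  show ?case
  proof (cases "q v > t")
    case True
    have "1 / 2 \<le> rsum ({..<Suc m} \<times> S) (\<lambda>(j, i). z i) (\<lambda>u. of_bool (q (v + u) > t))"
      using S True by (intro rsum_half[OF q]) auto
    moreover have "(1 - (1 - a) ^ Suc m) / 2 \<le> 1 / 2" using a by simp
    ultimately show ?thesis by (rule order_trans[rotated])
  next
    case False
    let ?b = "(1 - (1 - a) ^ m) / 2"
    let ?Z = "\<lambda>(j::nat, i). z i"
    \<comment> \<open>The induction hypothesis serves every start, so the inner average is at least
      \<open>?b\<close>, and at least one half when the new copy is large.\<close>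
    have le: "?b + (1/2 - ?b) * of_bool (q u > 2 * t) \<le> rsum ({..<m} \<times> S) ?Z (\<lambda>w. of_bool (q ((v + u) + w) > t))" for u
    proof (cases "q u > 2 * t")
      case True
      then have "q (v + u) > t"
        using False real_seminorm_add[OF q, of "v + u" "- v"] real_seminorm_minus[OF q, of v] by simp
      then have "1/2 \<le> rsum ({..<m} \<times> S) ?Z (\<lambda>w. of_bool (q ((v + u) + w) > t))"
        using S by (intro rsum_half[OF q]) auto
      then show ?thesis using True by simp
    next
      case False
      then show ?thesis using Suc.IH[of "v + u"] by simp
    qed
    have "(1 - (1 - a) ^ Suc m) / 2 = ?b + (1/2 - ?b) * a"
      by (simp add: field_simps)
    also have "\<dots> = rsum S z (\<lambda>u. ?b + (1/2 - ?b) * of_bool (q u > 2 * t))"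
      using S unfolding a_def by (simp add: rsum_add rsum_const rsum_cmult)
    also have "\<dots> \<le> rsum S z (\<lambda>u. rsum ({..<m} \<times> S) ?Z (\<lambda>w. of_bool (q ((v + u) + w) > t)))"
      by (intro rsum_mono le)
    also have "\<dots> = rsum (Pair m ` S) ?Z (\<lambda>u. rsum ({..<m} \<times> S) ?Z (\<lambda>w. of_bool (q (v + (u + w)) > t)))"
      using S by (subst rsum_image) (auto simp: inj_on_def add.assoc)
    also have "\<dots> = rsum (Pair m ` S \<union> {..<m} \<times> S) ?Z (\<lambda>w. of_bool (q (v + w) > t))"
      using S by (intro rsum_union[symmetric]) auto
    also have "Pair m ` S \<union> {..<m} \<times> S = {..<Suc m} \<times> S"
      by (auto simp: less_Suc_eq)
    finally show ?thesis .
  qed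
qed

section \<open>Norming functionals\<close>

text \<open>Hahn-Banach by Zorn's lemma on graphs, taken as subspaces of the product with the reals
  that lie below the norm.\<close>

lemma norming_functional:
  fixes v :: "'e::real_normed_vector"
  obtains \<phi> :: "'e \<Rightarrow>\<^sub>L real" where "\<And>u. \<bar>\<phi> u\<bar> \<le> norm u" "\<phi> v = norm v"
proof -
  \<comment> \<open>Such a subspace is automatically the graph of a function: its elements over
    \<open>0\<close> are bounded by 0 from both sides.\<close>
  define \<A> where "\<A> = {G :: ('e \<times> real) set. subspace G \<and> (v, norm v) \<in> G \<and> (\<forall>(u, t)\<in>G. t \<le> norm u)}"
  have ne: "\<A> \<noteq> {}"
  proof -
    have "t \<le> norm u" if "(u, t) \<in> span {(v, norm v)}" for u t
    proof -
      from that obtain k where "u = k *\<^sub>R v" "t = k * norm v"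
        by (auto simp: span_singleton)
      then show ?thesis by (simp add: mult_right_mono)
    qed
    then have "span {(v, norm v)} \<in> \<A>"
      unfolding \<A>_def by (auto simp: subspace_span span_base)
    then show ?thesis by auto
  qed
  have "\<exists>G\<in>\<A>. \<forall>X\<in>\<A>. G \<subseteq> X \<longrightarrow> X = G"
  proof (rule subset_Zorn_nonempty[OF ne])
    fix \<C> assume C: "\<C> \<noteq> {}" "subset.chain \<A> \<C>"
    then have sub: "\<C> \<subseteq> \<A>" and ch: "\<And>X Y. X \<in> \<C> \<Longrightarrow> Y \<in> \<C> \<Longrightarrow> X \<subseteq> Y \<or> Y \<subseteq> X"
      by (auto simp: subset_chain_def)
    have "subspace (\<Union>\<C>)"
    proof (rule subspaceI)
      show "0 \<in> \<Union>\<C>" using C(1) sub by (auto simp: \<A>_def dest: subspace_0)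
      show "c *\<^sub>R x \<in> \<Union>\<C>" if "x \<in> \<Union>\<C>" for c x
      proof -
        from that obtain X where "x \<in> X" "X \<in> \<C>" by blast
        moreover from this have "subspace X" using sub by (auto simp: \<A>_def)
        ultimately show ?thesis using subspace_scale[of X x c] by blast
      qed
      show "x + y \<in> \<Union>\<C>" if xy: "x \<in> \<Union>\<C>" "y \<in> \<Union>\<C>" for x y
      proof -
        from xy obtain X Y where XY: "x \<in> X" "X \<in> \<C>" "y \<in> Y" "Y \<in> \<C>" by auto
        with ch[of X Y] obtain Z where "Z \<in> \<C>" "x \<in> Z" "y \<in> Z" by blast
        moreover from this have "subspace Z" using sub by (auto simp: \<A>_def)
        ultimately show ?thesis using subspace_add[of Z x y] by blast
      qed
    qed
    then show "\<Union>\<C> \<in> \<A>"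
      using C(1) sub unfolding \<A>_def by auto
  qed
  then obtain G where G: "G \<in> \<A>" and max: "\<And>X. X \<in> \<A> \<Longrightarrow> G \<subseteq> X \<Longrightarrow> X = G" by blast
  have sG: "subspace G" and vG: "(v, norm v) \<in> G" and le: "\<And>u t. (u, t) \<in> G \<Longrightarrow> t \<le> norm u"
    using G by (auto simp: \<A>_def)
  have total: "\<exists>t. (u, t) \<in> G" for u
  proof -
    let ?A = "(\<lambda>(a, s). s - norm (a - u)) ` G"
    have G0: "(0, 0) \<in> G" using subspace_0[OF sG] by (simp add: zero_prod_def)
    have bd: "s - norm (a - u) \<le> norm (b + u) - t" if "(a, s) \<in> G" "(b, t) \<in> G" for a s b t
    proof -
      have "(a + b, s + t) \<in> G" using subspace_add[OF sG that] by simp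
      then have "s + t \<le> norm (a + b)" by (rule le)
      also have "\<dots> \<le> norm (a - u) + norm (b + u)"
        using norm_triangle_ineq[of "a - u" "b + u"] by simp
      finally show ?thesis by simp
    qed
    \<comment> \<open>The value at \<open>u\<close> is to be \<open>- c\<close>, which must separate
      all lower bounds \<open>s - norm (a - u)\<close> from all upper bounds
      \<open>norm (b + u) - t\<close>; by \<open>bd\<close> the supremum of the former does.\<close>
    define c where "c = - Sup ?A"
    have bdd: "bdd_above ?A" using bd[OF _ G0] by (intro bdd_aboveI[where M="norm (0 + u) - 0"]) auto
    have up: "s - norm (a - u) \<le> - c" if "(a, s) \<in> G" for a s
      unfolding c_def using that bdd by (auto intro!: cSup_upper simp: image_iff)
    have lo: "- c \<le> norm (b + u) - t" if "(b, t) \<in> G" for b t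
      unfolding c_def using G0 bd[OF _ that] by (simp, intro cSup_least) auto
    let ?H = "span (insert (u, - c) G)"
    have "t \<le> norm w" if H: "(w, t) \<in> ?H" for w t
    proof -
      from H obtain k where "(w, t) - k *\<^sub>R (u, - c) \<in> span G"
        unfolding span_breakdown_eq by auto
      then have k: "(w - k *\<^sub>R u, t + k * c) \<in> G"
        using span_eq_iff[THEN iffD2, OF sG] by simp
      show ?thesis
      proof (cases k "0::real" rule: linorder_cases)
        case equal
        with k show ?thesis using le by simp
      next
        case less
        have "(1 / (- k)) *\<^sub>R (w - k *\<^sub>R u, t + k * c) \<in> G" using sG k by (rule subspace_scale)
        then have "((1 / (- k)) *\<^sub>R w + u, - c - t / k) \<in> G" using less by (simp add: algebra_simps add_divide_distrib)
        from up[OF this] have "- c - t / k - norm ((1 / (- k)) *\<^sub>R w) \<le> - c"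
          by simp
        then have "t / (- k) \<le> norm w / (- k)" using less by simp
        then show ?thesis using less by (simp add: divide_simps)
      next
        case greater
        have "(1 / k) *\<^sub>R (w - k *\<^sub>R u, t + k * c) \<in> G" using sG k by (rule subspace_scale)
        then have "((1 / k) *\<^sub>R w - u, t / k + c) \<in> G" using greater by (simp add: algebra_simps add_divide_distrib)
        from lo[OF this] have "- c \<le> norm ((1 / k) *\<^sub>R w) - (t / k + c)"
          by simp
        then have "t / k \<le> norm w / k" using greater by simp
        then show ?thesis using greater by (simp add: divide_simps)
      qed
    qed
    moreover have "G \<subseteq> ?H" by (auto intro: span_base)
    ultimately have "?H \<in> \<A>" using vG unfolding \<A>_def by (auto simp: subspace_span)
    then have "?H = G" using max \<open>G \<subseteq> ?H\<close> by blast
    then show ?thesis by (metis insertI1 span_base)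
  qed
  have unique: "t = t'" if "(u, t) \<in> G" "(u, t') \<in> G" for u t t'
  proof -
    have "(0, t - t') \<in> G" "(0, t' - t) \<in> G"
      using subspace_diff[OF sG that] subspace_diff[OF sG that(2,1)] by simp_all
    then show ?thesis using le[of 0 "t - t'"] le[of 0 "t' - t"] by simp
  qed
  obtain f where f: "\<And>u. (u, f u) \<in> G" using total by metis
  have "linear f"
  proof (rule linearI)
    show "f (a + b) = f a + f b" for a b using unique[OF f] subspace_add[OF sG f[of a] f[of b]] by simp
    show "f (k *\<^sub>R a) = k *\<^sub>R f a" for k a using unique[OF f] subspace_scale[OF sG f[of a], of k] by simp
  qed
  moreover have fle: "\<bar>f u\<bar> \<le> norm u" for u
    using le[OF f[of u]] le[OF f[of "- u"]] linear_neg[OF \<open>linear f\<close>, of u] by auto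
  ultimately have "bounded_linear f"
    by (intro bounded_linear_intro[of f 1]) (auto simp: linear_add linear_scale)
  then have ap: "blinfun_apply (Blinfun f) = f" by (rule bounded_linear_Blinfun_apply)
  show thesis
    using fle unique[OF f vG] by (intro that[of "Blinfun f"]) (auto simp: ap)
qed

section \<open>Products of symmetric laws\<close>

text \<open>In a nonseparable space a sum of Borel functions need not be Borel. Here the randomness
  is in scalar coefficients, which are limits of simple functions, and sums of simple functions are
  simple.\<close>

lemma borel_measurable_sum_scaleR_const:
  fixes y :: "'i \<Rightarrow> 'e::real_normed_vector"
  assumes "\<And>i. i \<in> I \<Longrightarrow> f i \<in> borel_measurable N"
  shows "(\<lambda>w. \<Sum>i\<in>I. f i w *\<^sub>R y i) \<in> borel_measurable N"
proof -
  have "\<exists>F. (\<forall>n. simple_function N (F n)) \<and> (\<forall>x\<in>space N. (\<lambda>n. F n x) \<longlonglongrightarrow> f i x)" if "i \<in> I" for i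
    using borel_measurable_implies_sequence_metric[OF assms[OF that], of 0] by blast
  then obtain F where F: "\<And>i n. i \<in> I \<Longrightarrow> simple_function N (F i n)"
    "\<And>i x. i \<in> I \<Longrightarrow> x \<in> space N \<Longrightarrow> (\<lambda>n. F i n x) \<longlonglongrightarrow> f i x"
    by metis
  show ?thesis
  proof (rule borel_measurable_LIMSEQ_metric)
    show "(\<lambda>w. \<Sum>i\<in>I. F i n w *\<^sub>R y i) \<in> borel_measurable N" for n
      using F(1) by (intro borel_measurable_simple_function simple_function_sum
          simple_function_compose1[where g="\<lambda>r. r *\<^sub>R _"])
    show "(\<lambda>n. \<Sum>i\<in>I. F i n w *\<^sub>R y i) \<longlonglongrightarrow> (\<Sum>i\<in>I. f i w *\<^sub>R y i)" if "w \<in> space N" for w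
      using F(2) that by (intro tendsto_intros)
  qed
qed

lemma borel_measurable_real_seminorm:
  fixes q :: "'e::real_normed_vector \<Rightarrow> real"
  assumes q: "real_seminorm q" and le: "\<And>v. q v \<le> norm v"
  shows "q \<in> borel_measurable borel"
proof -
  have "\<bar>q u - q v\<bar> \<le> norm (u - v)" for u v
    using real_seminorm_add[OF q, of v "u - v"] real_seminorm_add[OF q, of u "v - u"] le[of "u - v"] le[of "v - u"]
    by (simp add: norm_minus_commute)
  then have "continuous_on UNIV q"
    unfolding continuous_on_iff dist_norm real_norm_def by (metis le_less_trans)
  then show ?thesis by (rule borel_measurable_continuous_onI)
qed

text \<open>The laws may differ from coordinate to coordinate: this serves Gaussians of different
  variances as well as copies of one stable law.\<close>

locale sym_laws = finite_product_prob_space \<nu> I for \<nu> :: "'i \<Rightarrow> real measure" and I :: "'i set" +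
  assumes sets_\<nu> [simp, measurable_cong]: "sets (\<nu> i) = sets borel"
    and sym_\<nu>: "distr (\<nu> i) borel uminus = \<nu> i"
begin

lemma space_\<nu> [simp]: "space (\<nu> i) = UNIV"
  using sets_eq_imp_space_eq[OF sets_\<nu>] by simp

lemma emeasure_uminus_image:
  assumes "A \<in> sets borel"
  shows "emeasure (\<nu> i) {x. - x \<in> A} = emeasure (\<nu> i) A"
proof -
  have "emeasure (\<nu> i) A = emeasure (distr (\<nu> i) borel uminus) A" by (simp only: sym_\<nu>)
  also have "\<dots> = emeasure (\<nu> i) {x. - x \<in> A}"
    using assms by (subst emeasure_distr) (auto simp: vimage_def)
  finally show ?thesis ..
qed

lemma distr_sign_flip:
  assumes s: "\<And>i. i \<in> I \<Longrightarrow> s i = 1 \<or> s i = (-1::real)"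
  shows "distr (PiM I \<nu>) (PiM I \<nu>) (\<lambda>x. \<lambda>i\<in>I. s i * x i) = PiM I \<nu>"
proof (rule PiM_eqI)
  fix A assume A: "\<And>i. i \<in> I \<Longrightarrow> A i \<in> sets (\<nu> i)"
  have m: "(\<lambda>x. \<lambda>i\<in>I. s i * x i) \<in> PiM I \<nu> \<rightarrow>\<^sub>M PiM I \<nu>" by measurable
  have B: "{x. s i * x \<in> A i} \<in> sets (\<nu> i)" if "i \<in> I" for i
    using A[OF that] by (auto intro!: measurable_sets_borel[of "\<lambda>x. s i * x", unfolded vimage_def] borel_measurable_times)
  have "emeasure (distr (PiM I \<nu>) (PiM I \<nu>) (\<lambda>x. \<lambda>i\<in>I. s i * x i)) (Pi\<^sub>E I A)
    = emeasure (PiM I \<nu>) ((\<lambda>x. \<lambda>i\<in>I. s i * x i) -` Pi\<^sub>E I A \<inter> space (PiM I \<nu>))"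
    using A by (intro emeasure_distr m sets_PiM_I_finite finite_index) auto
  also have "(\<lambda>x. \<lambda>i\<in>I. s i * x i) -` Pi\<^sub>E I A \<inter> space (PiM I \<nu>) = Pi\<^sub>E I (\<lambda>i. {x. s i * x \<in> A i})"
    by (auto simp: space_PiM PiE_iff)
  also have "emeasure (PiM I \<nu>) \<dots> = (\<Prod>i\<in>I. emeasure (\<nu> i) {x. s i * x \<in> A i})"
    using B by (intro emeasure_PiM finite_index)
  also have "\<dots> = (\<Prod>i\<in>I. emeasure (\<nu> i) (A i))"
  proof (intro prod.cong refl)
    fix i assume "i \<in> I"
    then show "emeasure (\<nu> i) {x. s i * x \<in> A i} = emeasure (\<nu> i) (A i)"
      using s[of i] A[of i] emeasure_uminus_image[of "A i" i] by auto
  qed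
  finally show "emeasure (distr (PiM I \<nu>) (PiM I \<nu>) (\<lambda>x. \<lambda>i\<in>I. s i * x i)) (Pi\<^sub>E I A) = (\<Prod>i\<in>I. emeasure (\<nu> i) (A i))" .
qed (simp_all add: finite_index)

text \<open>The product law is invariant under every pattern of sign flips, so the integral equals
  its average over all patterns. This is conditioning on the moduli
  \<open>\<bar>x i\<bar>\<close>.\<close>

lemma integral_eq_rsum:
  fixes y :: "'i \<Rightarrow> 'e::real_normed_vector"
  assumes F[measurable]: "F \<in> borel_measurable borel" and bd: "\<And>v. \<bar>F v\<bar> \<le> B"
  shows "integrable (PiM I \<nu>) (\<lambda>x. rsum I (\<lambda>i. x i *\<^sub>R y i) F)"
    and "(\<integral>x. F (\<Sum>i\<in>I. x i *\<^sub>R y i) \<partial>PiM I \<nu>) = (\<integral>x. rsum I (\<lambda>i. x i *\<^sub>R y i) F \<partial>PiM I \<nu>)"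
proof -
  define s :: "'i set \<Rightarrow> 'i \<Rightarrow> real" where "s A i = (if i \<in> A then 1 else -1)" for A i
  have meas: "(\<lambda>x. F (\<Sum>i\<in>I. x i *\<^sub>R s A i *\<^sub>R y i)) \<in> borel_measurable (PiM I \<nu>)" for A
    by (intro measurable_compose[OF _ F] borel_measurable_sum_scaleR_const) measurable
  have int: "integrable (PiM I \<nu>) (\<lambda>x. F (\<Sum>i\<in>I. x i *\<^sub>R s A i *\<^sub>R y i))" for A
    using meas bd by (intro integrable_const_bound[where B=B]) auto
  have eq: "(\<integral>x. F (\<Sum>i\<in>I. x i *\<^sub>R s A i *\<^sub>R y i) \<partial>PiM I \<nu>) = (\<integral>x. F (\<Sum>i\<in>I. x i *\<^sub>R y i) \<partial>PiM I \<nu>)" for A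
  proof -
    have m: "(\<lambda>x. F (\<Sum>i\<in>I. x i *\<^sub>R y i)) \<in> borel_measurable (PiM I \<nu>)"
      by (intro measurable_compose[OF _ F] borel_measurable_sum_scaleR_const) measurable
    have "(\<integral>x. F (\<Sum>i\<in>I. x i *\<^sub>R y i) \<partial>PiM I \<nu>)
      = (\<integral>x. F (\<Sum>i\<in>I. x i *\<^sub>R y i) \<partial>distr (PiM I \<nu>) (PiM I \<nu>) (\<lambda>x. \<lambda>i\<in>I. s A i * x i))"
      by (subst distr_sign_flip) (auto simp: s_def)
    also have "\<dots> = (\<integral>x. F (\<Sum>i\<in>I. (s A i * x i) *\<^sub>R y i) \<partial>PiM I \<nu>)"
      by (subst integral_distr) (auto intro!: m)
    finally show ?thesis by (simp add: mult.commute)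
  qed
  have expand: "rsum I (\<lambda>i. x i *\<^sub>R y i) F = (\<Sum>A\<in>Pow I. F (\<Sum>i\<in>I. x i *\<^sub>R s A i *\<^sub>R y i)) / 2 ^ card I" for x
    unfolding rsum_def s_def by (auto intro!: arg_cong2[where f="(/)"] sum.cong arg_cong[where f=F])
  show "integrable (PiM I \<nu>) (\<lambda>x. rsum I (\<lambda>i. x i *\<^sub>R y i) F)"
    unfolding expand using int by (intro integrable_divide Bochner_Integration.integrable_sum) auto
  show "(\<integral>x. F (\<Sum>i\<in>I. x i *\<^sub>R y i) \<partial>PiM I \<nu>) = (\<integral>x. rsum I (\<lambda>i. x i *\<^sub>R y i) F \<partial>PiM I \<nu>)"
    unfolding expand using int
    by (simp add: Bochner_Integration.integral_sum eq card_Pow finite_index del: scaleR_scaleR)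
qed

text \<open>Every coordinate exceeds its median with probability one half, so the set of the coordinates that do is
  uniformly distributed; a random subset and its complement then have the same law.\<close>

lemma integral_median_set:
  assumes c: "\<And>i. i \<in> I \<Longrightarrow> measure (\<nu> i) {x. c i \<le> \<bar>x\<bar>} = 1/2"
  shows "integrable (PiM I \<nu>) (\<lambda>x. G {i\<in>I. c i \<le> \<bar>x i\<bar>} :: real)"
    and "(\<integral>x. G {i\<in>I. c i \<le> \<bar>x i\<bar>} \<partial>PiM I \<nu>) = (\<Sum>D\<in>Pow I. G D) / 2 ^ card I"
proof -
  define E where "E D = Pi\<^sub>E I (\<lambda>i. if i \<in> D then {x. c i \<le> \<bar>x\<bar>} else - {x. c i \<le> \<bar>x\<bar>})" for D
  have mE: "E D \<in> sets (PiM I \<nu>)" for D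
    unfolding E_def by (intro sets_PiM_I_finite finite_index) auto
  have half: "measure (\<nu> i) (- {x. c i \<le> \<bar>x\<bar>}) = 1/2" if "i \<in> I" for i
    using M.prob_compl[of "{x. c i \<le> \<bar>x\<bar>}" i] c[OF that] by (simp add: Compl_eq_Diff_UNIV)
  have "measure (PiM I \<nu>) (E D) = (\<Prod>i\<in>I. 1/2)" for D
    unfolding E_def by (subst prob_times) (auto intro!: prod.cong simp del: prod_constant simp: c half)
  then have pE: "measure (PiM I \<nu>) (E D) = 1 / 2 ^ card I" for D
    by (simp add: power_one_over)
  have expand: "G {i\<in>I. c i \<le> \<bar>x i\<bar>} = (\<Sum>D\<in>Pow I. G D * indicator (E D) x)" if "x \<in> space (PiM I \<nu>)" for x
  proof -
    have "x \<in> E D \<longleftrightarrow> D = {i\<in>I. c i \<le> \<bar>x i\<bar>}" if "D \<in> Pow I" for D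
      using that \<open>x \<in> space (PiM I \<nu>)\<close> unfolding E_def space_PiM PiE_iff by (auto split: if_splits)
    then have "(\<Sum>D\<in>Pow I. G D * indicator (E D) x) = (\<Sum>D\<in>Pow I. if D = {i\<in>I. c i \<le> \<bar>x i\<bar>} then G D else 0)"
      by (intro sum.cong) (auto simp: indicator_def)
    then show ?thesis using finite_index by simp
  qed
  have int: "integrable (PiM I \<nu>) (\<lambda>x. G D * indicator (E D) x)" for D
    using mE by (intro integrable_mult_right integrable_real_indicator) (auto simp: less_top[symmetric])
  show "integrable (PiM I \<nu>) (\<lambda>x. G {i\<in>I. c i \<le> \<bar>x i\<bar>} :: real)"
    using int by (subst Bochner_Integration.integrable_cong[OF refl expand]) auto
  show "(\<integral>x. G {i\<in>I. c i \<le> \<bar>x i\<bar>} \<partial>PiM I \<nu>) = (\<Sum>D\<in>Pow I. G D) / 2 ^ card I"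
    using int mE by (subst Bochner_Integration.integral_cong[OF refl expand])
      (auto simp: Bochner_Integration.integral_sum pE sum_divide_distrib Int_absorb2 sets.sets_into_space)
qed

text \<open>On the set \<open>D\<close> of coordinates above their median, contraction replaces
  \<open>x i\<close> by the smaller \<open>k i\<close>. Since \<open>D\<close> and
  \<open>I - D\<close> are equally likely and together carry the whole sum, nothing is lost but the
  factor 2 in the threshold. Contraction and recombination cost a factor 2 each in the
  probability.\<close>

lemma rsum_le_integral:
  fixes y :: "'i \<Rightarrow> 'e::real_normed_vector"
  assumes q: "real_seminorm q" and qn: "\<And>v. q v \<le> norm v" and t: "0 \<le> t"
    and c: "\<And>i. i \<in> I \<Longrightarrow> measure (\<nu> i) {x. c i \<le> \<bar>x\<bar>} = 1/2"
    and k: "\<And>i. i \<in> I \<Longrightarrow> 0 < k i \<and> k i \<le> c i"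
  shows "rsum I (\<lambda>i. k i *\<^sub>R y i) (\<lambda>u. of_bool (q u > 2 * t))
    \<le> 4 * measure (PiM I \<nu>) {x \<in> space (PiM I \<nu>). q (\<Sum>i\<in>I. x i *\<^sub>R y i) > t}"
proof -
  let ?F = "\<lambda>u. of_bool (q u > t) :: real"
  let ?z = "\<lambda>i. k i *\<^sub>R y i"
  define G where "G D = rsum D ?z ?F" for D
  note [measurable] = borel_measurable_real_seminorm[OF q qn]
  have F: "?F \<in> borel_measurable borel" by measurable
  note int = integral_eq_rsum[OF F, of 1 y]
  have contr: "G {i\<in>I. c i \<le> \<bar>x i\<bar>} \<le> 2 * rsum I (\<lambda>i. x i *\<^sub>R y i) ?F" for x
  proof -
    define D where "D = {i\<in>I. c i \<le> \<bar>x i\<bar>}"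
    \<comment> \<open>On \<open>D\<close> one has \<open>k i \<le> \<bar>x i\<bar>\<close>, so the
      quotient is at most 1; the sign of \<open>x i\<close> is absorbed by the Rademacher
      sign.\<close>
    let ?l = "\<lambda>i. if i \<in> D then k i / \<bar>x i\<bar> else 0"
    have l: "0 \<le> ?l i \<and> ?l i \<le> 1" if "i \<in> I" for i
      using k[OF that] by (auto simp: D_def divide_simps)
    have "G D = rsum D (\<lambda>i. (if i \<in> D then sgn (x i) else 1) *\<^sub>R (?l i *\<^sub>R (x i *\<^sub>R y i))) ?F"
      unfolding G_def
    proof (intro rsum_cong)
      fix i assume "i \<in> D"
      moreover from this have "x i \<noteq> 0" using k[of i] unfolding D_def by force
      ultimately show "k i *\<^sub>R y i = (if i \<in> D then sgn (x i) else 1) *\<^sub>R ?l i *\<^sub>R x i *\<^sub>R y i"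
        by (simp add: sgn_if)
    qed
    also have "\<dots> = rsum D (\<lambda>i. ?l i *\<^sub>R (x i *\<^sub>R y i)) ?F"
    proof (intro rsum_sign)
      show "finite D" using finite_index unfolding D_def by auto
      fix i assume "i \<in> D"
      moreover from this have "x i \<noteq> 0" using k[of i] unfolding D_def by force
      ultimately show "(if i \<in> D then sgn (x i) else 1) = 1 \<or> (if i \<in> D then sgn (x i) else 1) = - 1"
        by (auto simp: sgn_if)
    qed
    also have "\<dots> = rsum I (\<lambda>i. ?l i *\<^sub>R (x i *\<^sub>R y i)) ?F"
      using finite_index by (intro rsum_superset[symmetric]) (auto simp: D_def)
    also have "\<dots> \<le> 2 * rsum I (\<lambda>i. x i *\<^sub>R y i) ?F"
      using l t by (intro rsum_contraction[OF q finite_index]) auto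
    finally show ?thesis unfolding D_def .
  qed
  have "2 * (\<Sum>D\<in>Pow I. G D) = (\<Sum>D\<in>Pow I. G D + G (I - D))"
  proof -
    have "(\<Sum>D\<in>Pow I. G (I - D)) = (\<Sum>D\<in>Pow I. G D)"
      by (rule sum.reindex_bij_witness[of _ "\<lambda>D. I - D" "\<lambda>D. I - D"]) (auto simp: double_diff)
    then show ?thesis by (simp add: sum.distrib)
  qed
  also have "\<dots> \<ge> (\<Sum>D\<in>Pow I. rsum I ?z (\<lambda>u. of_bool (q u > 2 * t)))"
    unfolding G_def by (intro sum_mono rsum_split[OF q finite_index]) auto
  finally have "rsum I ?z (\<lambda>u. of_bool (q u > 2 * t)) \<le> 2 * ((\<Sum>D\<in>Pow I. G D) / 2 ^ card I)"
    by (simp add: card_Pow finite_index field_simps)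
  also have "(\<Sum>D\<in>Pow I. G D) / 2 ^ card I = (\<integral>x. G {i\<in>I. c i \<le> \<bar>x i\<bar>} \<partial>PiM I \<nu>)"
    using integral_median_set(2)[OF c, of G] by simp
  also have "\<dots> \<le> (\<integral>x. 2 * rsum I (\<lambda>i. x i *\<^sub>R y i) ?F \<partial>PiM I \<nu>)"
    using integral_median_set(1)[OF c, of G] int(1) contr by (intro integral_mono) auto
  also have "\<dots> = 2 * (\<integral>x. ?F (\<Sum>i\<in>I. x i *\<^sub>R y i) \<partial>PiM I \<nu>)"
    using int(2) by simp
  also have "(\<integral>x. ?F (\<Sum>i\<in>I. x i *\<^sub>R y i) \<partial>PiM I \<nu>)
     = measure (PiM I \<nu>) {x \<in> space (PiM I \<nu>). q (\<Sum>i\<in>I. x i *\<^sub>R y i) > t}"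
  proof -
    have "(\<lambda>x. q (\<Sum>i\<in>I. x i *\<^sub>R y i)) \<in> borel_measurable (PiM I \<nu>)"
      by (intro measurable_compose[OF borel_measurable_sum_scaleR_const]) measurable
    then have "{x \<in> space (PiM I \<nu>). q (\<Sum>i\<in>I. x i *\<^sub>R y i) > t} \<in> sets (PiM I \<nu>)"
      by measurable
    then have "measure (PiM I \<nu>) {x \<in> space (PiM I \<nu>). q (\<Sum>i\<in>I. x i *\<^sub>R y i) > t}
      = (\<integral>x. indicator {x \<in> space (PiM I \<nu>). q (\<Sum>i\<in>I. x i *\<^sub>R y i) > t} x \<partial>PiM I \<nu>)"
      by (simp add: Int_absorb2 sets.sets_into_space)
    also have "\<dots> = (\<integral>x. ?F (\<Sum>i\<in>I. x i *\<^sub>R y i) \<partial>PiM I \<nu>)"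
      by (intro Bochner_Integration.integral_cong) (auto simp: indicator_def)
    finally show ?thesis ..
  qed
  finally show ?thesis by simp
qed

end

section \<open>Joint characteristic functions\<close>

text \<open>The density \<open>(2 + h) / m\<close> defines a probability under which
  \<open>X\<close> still has law \<open>\<nu>\<close>, by uniqueness of characteristic functions.
  Comparing the mass of \<open>X \<in> A\<close> under both probabilities gives the factorisation;
  the shift by 2 keeps the density positive.\<close>

lemma (in prob_space) integral_weight_indicator_real:
  fixes h :: "'a \<Rightarrow> real"
  assumes \<nu>: "real_distribution \<nu>" and X[measurable]: "X \<in> borel_measurable M" and h[measurable]: "h \<in> borel_measurable M"
    and h1: "\<And>w. \<bar>h w\<bar> \<le> 1"
    and cX: "\<And>s. (\<integral>w. iexp (s * X w) \<partial>M) = char \<nu> s"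
    and ch: "\<And>s. (\<integral>w. h w * iexp (s * X w) \<partial>M) = (\<integral>w. h w \<partial>M) * char \<nu> s"
    and A[measurable]: "A \<in> sets borel"
  shows "(\<integral>w. h w * indicator A (X w) \<partial>M) = (\<integral>w. h w \<partial>M) * measure \<nu> A"
proof -
  interpret \<nu>: real_distribution \<nu> by fact
  have inth: "integrable M h" using h1 by (intro integrable_const_bound[where B=1]) auto
  have inte: "integrable M (\<lambda>w. iexp (s * X w))" for s
    by (intro integrable_const_bound[where B=1]) auto
  have inthe: "integrable M (\<lambda>w. h w * iexp (s * X w))" for s
    using h1 by (intro integrable_const_bound[where B=1]) (auto simp: norm_mult)
  have intA: "integrable M (\<lambda>w. indicator A (X w) :: real)"
    by (intro integrable_const_bound[where B=1]) auto
  have inthA: "integrable M (\<lambda>w. h w * indicator A (X w))"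
    using h1 by (intro integrable_const_bound[where B=1]) (auto simp: indicator_def)
  define m where "m = 2 + (\<integral>w. h w \<partial>M)"
  have "(\<integral>w. -1 \<partial>M) \<le> (\<integral>w. h w \<partial>M)"
    using inth h1 by (intro integral_mono) (auto simp: abs_le_iff minus_le_iff)
  then have m: "m \<ge> 1" unfolding m_def by (simp add: prob_space)
  have pos: "0 \<le> (2 + h w) / m" for w using h1[of w] m by (simp add: abs_le_iff)
  define N where "N = density M (\<lambda>w. ennreal ((2 + h w) / m))"
  have "emeasure N (space N) = (\<integral>\<^sup>+ w. ennreal ((2 + h w) / m) \<partial>M)"
    unfolding N_def by (subst emeasure_density) (auto intro!: nn_integral_cong)
  also have "\<dots> = ennreal (\<integral>w. (2 + h w) / m \<partial>M)"
    using pos inth by (intro nn_integral_eq_integral) auto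
  also have "(\<integral>w. (2 + h w) / m \<partial>M) = 1"
    using inth m unfolding m_def by (simp add: prob_space)
  finally have N: "prob_space N" by (intro prob_spaceI) simp
  have XN: "X \<in> borel_measurable N" unfolding N_def by simp
  have D: "real_distribution (distr N borel X)"
    unfolding real_distribution_def real_distribution_axioms_def using prob_space.prob_space_distr[OF N XN] by simp
  have DM: "real_distribution (distr M borel X)"
    unfolding real_distribution_def real_distribution_axioms_def using prob_space_distr[OF X] by simp
  have "char (distr N borel X) s = char \<nu> s" for s
  proof -
    have "char (distr N borel X) s = (\<integral>w. iexp (s * X w) \<partial>N)"
      unfolding char_def using XN by (subst integral_distr) auto
    also have "\<dots> = (\<integral>w. ((2 + h w) / m) *\<^sub>R iexp (s * X w) \<partial>M)"
      unfolding N_def using pos by (intro integral_density) auto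
    also have "\<dots> = (\<integral>w. (2 * iexp (s * X w) + h w * iexp (s * X w)) / complex_of_real m \<partial>M)"
      by (intro Bochner_Integration.integral_cong) (auto simp: scaleR_conv_of_real algebra_simps add_divide_distrib)
    also have "\<dots> = (2 * char \<nu> s + (\<integral>w. h w \<partial>M) * char \<nu> s) / complex_of_real m"
      using inte[of s] inthe[of s]
      by (simp only: integral_divide_zero Bochner_Integration.integral_add integral_mult_right_zero cX ch
          integrable_mult_right)
    also have "2 * char \<nu> s + (\<integral>w. h w \<partial>M) * char \<nu> s = char \<nu> s * complex_of_real m"
      unfolding m_def by (simp add: algebra_simps)
    finally show ?thesis using m by simp
  qed
  then have eqN: "distr N borel X = \<nu>" using Levy_uniqueness[OF D \<nu>] by blast
  have "char (distr M borel X) s = char \<nu> s" for s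
  proof -
    have "char (distr M borel X) s = (\<integral>w. iexp (s * X w) \<partial>M)"
      unfolding char_def by (subst integral_distr) auto
    then show ?thesis by (simp only: cX)
  qed
  then have eqM: "distr M borel X = \<nu>" using Levy_uniqueness[OF DM \<nu>] by blast
  have "measure \<nu> A = (\<integral>x. indicator A x \<partial>\<nu>)" by simp
  also have "\<dots> = (\<integral>x. indicator A x \<partial>distr M borel X)" by (simp only: eqM)
  also have "\<dots> = (\<integral>w. indicator A (X w) \<partial>M)" by (intro integral_distr) auto
  finally have 1: "measure \<nu> A = (\<integral>w. indicator A (X w) \<partial>M)" .
  have "measure \<nu> A = (\<integral>x. indicator A x \<partial>\<nu>)" by simp
  also have "\<dots> = (\<integral>x. indicator A x \<partial>distr N borel X)" by (simp only: eqN)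
  also have "\<dots> = (\<integral>w. indicator A (X w) \<partial>N)" using XN by (intro integral_distr) auto
  also have "\<dots> = (\<integral>w. ((2 + h w) / m) *\<^sub>R indicator A (X w) \<partial>M)"
    unfolding N_def using pos by (intro integral_density) auto
  also have "\<dots> = (\<integral>w. (2 * indicator A (X w) + h w * indicator A (X w)) / m \<partial>M)"
    by (intro Bochner_Integration.integral_cong) (auto simp: algebra_simps add_divide_distrib)
  also have "\<dots> = (2 * measure \<nu> A + (\<integral>w. h w * indicator A (X w) \<partial>M)) / m"
    using intA inthA by (simp add: 1)
  finally have "measure \<nu> A * m = 2 * measure \<nu> A + (\<integral>w. h w * indicator A (X w) \<partial>M)"
    using m by (simp add: field_simps)
  then show ?thesis unfolding m_def by (simp add: algebra_simps)
qed

text \<open>The real case is applied to the real parts of \<open>H\<close> and of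
  \<open>- \<i> * H\<close>. The conjugate weight satisfies the same hypothesis because the
  characteristic function of a real law at \<open>- s\<close> is the conjugate of its value at
  \<open>s\<close>.\<close>

lemma (in prob_space) integral_weight_indicator:
  fixes H :: "'a \<Rightarrow> complex"
  assumes \<nu>: "real_distribution \<nu>" and X[measurable]: "X \<in> borel_measurable M" and H[measurable]: "H \<in> borel_measurable M"
    and H1: "\<And>w. cmod (H w) \<le> 1"
    and cX: "\<And>s. (\<integral>w. iexp (s * X w) \<partial>M) = char \<nu> s"
    and cH: "\<And>s. (\<integral>w. H w * iexp (s * X w) \<partial>M) = (\<integral>w. H w \<partial>M) * char \<nu> s"
    and A[measurable]: "A \<in> sets borel"
  shows "(\<integral>w. H w * indicator A (X w) \<partial>M) = (\<integral>w. H w \<partial>M) * measure \<nu> A"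
proof -
  have intH: "integrable M H" using H1 by (intro integrable_const_bound[where B=1]) auto
  have intHe: "integrable M (\<lambda>w. H w * iexp (s * X w))" for s
    using H1 by (intro integrable_const_bound[where B=1]) (auto simp: norm_mult)
  have [measurable]: "cnj \<in> borel_measurable borel"
    by (intro borel_measurable_continuous_onI continuous_intros)
  have intHc: "integrable M (\<lambda>w. cnj (H w) * iexp (s * X w))" for s
    using H1 by (intro integrable_const_bound[where B=1]) (auto simp: norm_mult)
  have intHA: "integrable M (\<lambda>w. H w * indicator A (X w))"
    using H1 by (intro integrable_const_bound[where B=1]) (auto simp: indicator_def norm_mult)
  have cc: "(\<integral>w. cnj (H w) * iexp (s * X w) \<partial>M) = cnj (\<integral>w. H w \<partial>M) * char \<nu> s" for s
  proof -
    have "(\<integral>w. cnj (H w) * iexp (s * X w) \<partial>M) = (\<integral>w. cnj (H w * iexp ((- s) * X w)) \<partial>M)"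
      by (intro Bochner_Integration.integral_cong) (auto simp: exp_cnj)
    also have "\<dots> = cnj ((\<integral>w. H w \<partial>M) * char \<nu> (- s))"
      using cH[of "- s"] by (simp add: integral_cnj del: mult_minus_left complex_cnj_mult)
    also have "cnj (char \<nu> (- s)) = char \<nu> s"
    proof -
      have "cnj (\<integral>x. iexp (- s * x) \<partial>\<nu>) = (\<integral>x. cnj (iexp (- s * x)) \<partial>\<nu>)" by simp
      then show ?thesis unfolding char_def by (simp add: exp_cnj)
    qed
    then have "cnj ((\<integral>w. H w \<partial>M) * char \<nu> (- s)) = cnj (\<integral>w. H w \<partial>M) * char \<nu> s" by simp
    finally show ?thesis .
  qed
  have part: "(\<integral>w. Re (a * H w) * indicator A (X w) \<partial>M) = Re (a * (\<integral>w. H w \<partial>M)) * measure \<nu> A"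
    if a: "cmod a = 1" for a
  proof -
    have re: "complex_of_real (Re (a * z)) = (a * z + cnj a * cnj z) / 2" for z
      by (simp add: complex_eq_iff)
    have intRe: "(\<integral>w. Re (a * H w) \<partial>M) = Re (a * (\<integral>w. H w \<partial>M))"
      using integral_Re[of M "\<lambda>w. a * H w"] intH by simp
    have "(\<integral>w. Re (a * H w) * indicator A (X w) \<partial>M) = (\<integral>w. Re (a * H w) \<partial>M) * measure \<nu> A"
    proof (rule integral_weight_indicator_real[OF \<nu> X _ _ cX])
      show "\<bar>Re (a * H w)\<bar> \<le> 1" for w using abs_Re_le_cmod[of "a * H w"] H1[of w] a by (simp add: norm_mult)
      show "(\<integral>w. Re (a * H w) * iexp (s * X w) \<partial>M) = (\<integral>w. Re (a * H w) \<partial>M) * char \<nu> s" for s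
      proof -
        have "(\<integral>w. Re (a * H w) * iexp (s * X w) \<partial>M)
          = (\<integral>w. (a * (H w * iexp (s * X w)) + cnj a * (cnj (H w) * iexp (s * X w))) / 2 \<partial>M)"
          unfolding re by (intro Bochner_Integration.integral_cong) (auto simp: algebra_simps)
        also have "\<dots> = (a * ((\<integral>w. H w \<partial>M) * char \<nu> s) + cnj a * (cnj (\<integral>w. H w \<partial>M) * char \<nu> s)) / 2"
          using intHe[of s] intHc[of s]
          by (simp only: integral_divide_zero Bochner_Integration.integral_add integrable_mult_right
              integral_mult_right_zero cH cc)
        also have "\<dots> = complex_of_real (Re (a * (\<integral>w. H w \<partial>M))) * char \<nu> s"
          unfolding re by (simp add: algebra_simps)
        finally show ?thesis unfolding intRe .
      qed
    qed auto
    then show ?thesis unfolding intRe .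
  qed
  have Re_ind: "Re (z * indicator B x) = Re z * indicator B x" "Im (z * indicator B x) = Im z * indicator B x"
    for z :: complex and B and x :: real by (auto simp: indicator_def)
  show ?thesis
    using part[of 1] part[of "- \<i>"] integral_Re[OF intHA] integral_Im[OF intHA]
    unfolding complex_eq_iff Re_ind by simp
qed

text \<open>Uniqueness of joint characteristic functions, reduced to dimension one: exponentials are
  exchanged for indicators one coordinate at a time, the other factors forming the bounded weight
  \<open>H\<close>.\<close>

lemma (in prob_space) distr_eq_PiM_if_char:
  fixes X :: "'i \<Rightarrow> 'a \<Rightarrow> real"
  assumes K: "finite K" and \<nu>: "\<And>i. real_distribution (\<nu> i)"
    and X[measurable]: "\<And>i. i \<in> K \<Longrightarrow> X i \<in> borel_measurable M"
    and ch: "\<And>t. (\<integral>w. iexp (\<Sum>i\<in>K. t i * X i w) \<partial>M) = (\<Prod>i\<in>K. char (\<nu> i) (t i))"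
  shows "distr M (PiM K \<nu>) (\<lambda>w. \<lambda>i\<in>K. X i w) = PiM K \<nu>"
proof -
  interpret \<nu>: real_distribution "\<nu> i" for i by fact
  interpret P: product_prob_space \<nu> K by standard
  have marg: "(\<integral>w. iexp (s * X i w) \<partial>M) = char (\<nu> i) s" if "i \<in> K" for i s
  proof -
    let ?t = "\<lambda>i'. if i' = i then s else 0"
    have "(\<Sum>i'\<in>K. ?t i' * X i' w) = (\<Sum>i'\<in>K. if i' = i then s * X i' w else 0)" for w
      by (intro sum.cong) auto
    then have 1: "(\<Sum>i'\<in>K. ?t i' * X i' w) = s * X i w" for w
      using that K by simp
    have "(\<Prod>i'\<in>K. char (\<nu> i') (?t i')) = (\<Prod>i'\<in>K. if i' = i then char (\<nu> i') s else 1)"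
      by (intro prod.cong) (auto simp: \<nu>.char_zero)
    also have "\<dots> = char (\<nu> i) s" using that K by simp
    finally show ?thesis using ch[of ?t] unfolding 1 by simp
  qed
  \<comment> \<open>\<open>D\<close> holds the coordinates already turned into indicators. All
    \<open>t\<close> are kept, since the induction step varies the entry of \<open>t\<close> at the
    new coordinate.\<close>
  have main: "(\<integral>w. (\<Prod>i\<in>D. indicator (A i) (X i w)) * iexp (\<Sum>i\<in>K-D. t i * X i w) \<partial>M)
     = (\<Prod>i\<in>D. complex_of_real (measure (\<nu> i) (A i))) * (\<Prod>i\<in>K-D. char (\<nu> i) (t i))"
    if A: "\<And>i. i \<in> K \<Longrightarrow> A i \<in> sets borel" and D: "D \<subseteq> K" for A D t
    using finite_subset[OF D K] D
  proof (induction D arbitrary: t rule: finite_induct)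
    case empty
    then show ?case using ch by simp
  next
    case (insert i D)
    define R where "R = K - insert i D"
    have KD: "K - D = insert i R" "i \<notin> R" "finite R" "R \<subseteq> K" "i \<in> K"
      using insert K unfolding R_def by auto
    define H where "H w = (\<Prod>i\<in>D. indicator (A i) (X i w)) * iexp (\<Sum>i\<in>R. t i * X i w)" for w
    define c where "c = (\<Prod>i\<in>D. complex_of_real (measure (\<nu> i) (A i))) * (\<Prod>i\<in>R. char (\<nu> i) (t i))"
    have [measurable]: "X i' \<in> borel_measurable M" if "i' \<in> D \<or> i' \<in> R" for i'
      using that insert.prems KD X by auto
    have [measurable]: "A i' \<in> sets borel" if "i' \<in> D" for i'
      using that insert.prems A by auto
    have mH: "H \<in> borel_measurable M" unfolding H_def by measurable
    have "cmod (H w) = (\<Prod>i\<in>D. indicator (A i) (X i w))" for w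
      unfolding H_def by (simp add: norm_mult prod_norm[symmetric] indicator_def of_bool_def if_distrib cong: if_cong)
    then have H1: "cmod (H w) \<le> 1" for w
      by (auto intro!: prod_le_1)
    have Hs: "(\<integral>w. H w * iexp (s * X i w) \<partial>M) = c * char (\<nu> i) s" for s
    proof -
      have s1: "(\<Sum>i'\<in>R. (if i' = i then s else t i') * X i' w) = (\<Sum>i\<in>R. t i * X i w)" for w
        using KD by (intro sum.cong) auto
      have s2: "(\<Prod>i'\<in>R. char (\<nu> i') (if i' = i then s else t i')) = (\<Prod>i\<in>R. char (\<nu> i) (t i))"
        using KD by (intro prod.cong) auto
      have "(\<integral>w. H w * iexp (s * X i w) \<partial>M) = (\<integral>w. (\<Prod>i\<in>D. indicator (A i) (X i w)) *
          iexp (\<Sum>i'\<in>K - D. (if i' = i then s else t i') * X i' w) \<partial>M)"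
        unfolding H_def KD(1) sum.insert[OF KD(3,2)] s1
        by (intro Bochner_Integration.integral_cong) (auto simp: exp_add algebra_simps simp del: of_real_sum)
      also have "\<dots> = c * char (\<nu> i) s"
        using insert.prems unfolding c_def by (subst insert.IH) (auto simp: KD s2)
      finally show ?thesis .
    qed
    have c: "(\<integral>w. H w \<partial>M) = c" using Hs[of 0] by (simp add: \<nu>.char_zero)
    have "(\<integral>w. H w * indicator (A i) (X i w) \<partial>M) = c * measure (\<nu> i) (A i)"
      using integral_weight_indicator[OF \<nu> X[OF KD(5)] mH H1 marg[OF KD(5)], of "A i"] Hs A KD by (simp add: c)
    then show ?case
      using insert.hyps unfolding H_def c_def R_def by (simp add: mult_ac)
  qed
  have mX: "(\<lambda>w. \<lambda>i\<in>K. X i w) \<in> M \<rightarrow>\<^sub>M PiM K \<nu>"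
    by (intro measurable_restrict) (simp cong: measurable_cong_sets add: X)
  show ?thesis
  proof (rule P.PiM_eqI[OF K])
    fix A assume A: "\<And>i. i \<in> K \<Longrightarrow> A i \<in> sets (\<nu> i)"
    then have A': "\<And>i. i \<in> K \<Longrightarrow> A i \<in> sets borel" by simp
    let ?B = "{w\<in>space M. \<forall>i\<in>K. X i w \<in> A i}"
    have B: "?B \<in> sets M"
      using A' K by (intro sets.sets_Collect_finite_All) (auto intro!: measurable_sets_Collect[OF X])
    have "complex_of_real (measure M ?B) = (\<integral>w. complex_of_real (indicator ?B w) \<partial>M)"
      using B by (simp add: Int_absorb2 sets.sets_into_space)
    also have "\<dots> = (\<integral>w. (\<Prod>i\<in>K. indicator (A i) (X i w)) \<partial>M)"
    proof (intro Bochner_Integration.integral_cong refl)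
      fix w assume w: "w \<in> space M"
      show "complex_of_real (indicator ?B w) = (\<Prod>i\<in>K. indicator (A i) (X i w))"
      proof (cases "w \<in> ?B")
        case False
        then obtain i where "i \<in> K" "X i w \<notin> A i" using w by auto
        then have "(\<Prod>i\<in>K. indicator (A i) (X i w)) = (0::complex)"
          using K by (auto simp: prod_zero_iff intro!: bexI[of _ i])
        then show ?thesis using False by simp
      qed simp
    qed
    also have "\<dots> = complex_of_real (\<Prod>i\<in>K. measure (\<nu> i) (A i))"
    proof -
      have "(\<integral>w. (\<Prod>i\<in>K. indicator (A i) (X i w)) * iexp (\<Sum>i\<in>K-K. 0 * X i w) \<partial>M)
        = (\<Prod>i\<in>K. complex_of_real (measure (\<nu> i) (A i))) * (\<Prod>i\<in>K-K. char (\<nu> i) 0)"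
        by (rule main) (auto intro: A')
      then show ?thesis by simp
    qed
    finally have "measure M ?B = (\<Prod>i\<in>K. measure (\<nu> i) (A i))" by (simp only: of_real_eq_iff)
    moreover have "emeasure (distr M (PiM K \<nu>) (\<lambda>w. \<lambda>i\<in>K. X i w)) (Pi\<^sub>E K A) = emeasure M ?B"
      using A K by (subst emeasure_distr[OF mX]) (auto intro!: sets_PiM_I_finite arg_cong[where f="emeasure M"] simp: PiE_iff)
    ultimately show "emeasure (distr M (PiM K \<nu>) (\<lambda>w. \<lambda>i\<in>K. X i w)) (Pi\<^sub>E K A) = (\<Prod>i\<in>K. emeasure (\<nu> i) (A i))"
      by (simp add: emeasure_eq_measure \<nu>.emeasure_eq_measure prod_ennreal)
  qed simp
qed

section \<open>Gaussian vectors from Brownian increments\<close>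

abbreviation normal_law :: "real \<Rightarrow> real measure" where
  "normal_law \<sigma> \<equiv> density lborel (\<lambda>x. ennreal (normal_density 0 \<sigma> x))"

lemma real_distribution_normal_law: "0 < \<sigma> \<Longrightarrow> real_distribution (normal_law \<sigma>)"
  unfolding real_distribution_def real_distribution_axioms_def using prob_space_normal_density[of \<sigma> 0] by simp

lemma normal_law_eq_distr:
  assumes "0 < \<sigma>"
  shows "normal_law \<sigma> = distr std_normal_distribution borel (\<lambda>x. \<sigma> * x)"
proof -
  interpret S: prob_space std_normal_distribution by (rule prob_space_normal_density) simp
  have "distributed std_normal_distribution lborel (\<lambda>x. x) std_normal_density"
    unfolding distributed_def by (auto simp: distr_id2)
  then have "distributed std_normal_distribution lborel (\<lambda>x. 0 + \<sigma> * x) (normal_density (0 + \<sigma> * 0) (\<bar>\<sigma>\<bar> * 1))"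
    using assms by (intro S.normal_density_affine) auto
  then have "distr std_normal_distribution lborel (\<lambda>x. \<sigma> * x) = normal_law \<sigma>"
    using assms by (simp add: distributed_def)
  moreover have "distr std_normal_distribution lborel (\<lambda>x. \<sigma> * x) = distr std_normal_distribution borel (\<lambda>x. \<sigma> * x)"
    by (intro distr_cong) auto
  ultimately show ?thesis by simp
qed

lemma char_normal_law:
  assumes "0 < \<sigma>"
  shows "char (normal_law \<sigma>) t = complex_of_real (exp (- (\<sigma>\<^sup>2 * t\<^sup>2) / 2))"
proof -
  have "char (normal_law \<sigma>) t = char std_normal_distribution (\<sigma> * t)"
    unfolding normal_law_eq_distr[OF assms] char_def by (subst integral_distr) (auto simp: mult_ac)
  then show ?thesis by (simp add: char_std_normal_distribution power_mult_distrib)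
qed

lemma distr_uminus_if_char_even:
  assumes \<nu>: "real_distribution \<nu>" and even: "\<And>t. char \<nu> (- t) = char \<nu> t"
  shows "distr \<nu> borel uminus = \<nu>"
proof -
  interpret real_distribution \<nu> by fact
  have D: "real_distribution (distr \<nu> borel uminus)"
    unfolding real_distribution_def real_distribution_axioms_def by (auto intro!: prob_space_distr)
  have "char (distr \<nu> borel uminus) t = char \<nu> t" for t
    unfolding even[of t, symmetric] unfolding char_def by (subst integral_distr) auto
  then show ?thesis using Levy_uniqueness[OF D \<nu>] by blast
qed

text \<open>There are no atoms, so the mass of \<open>{- c<..c}\<close> depends continuously on
  \<open>c\<close> and passes through one half.\<close>

lemma median_std_normal:
  obtains c where "0 < c" "measure std_normal_distribution {x. c \<le> \<bar>x\<bar>} = 1/2"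
proof -
  let ?S = std_normal_distribution
  interpret S: real_distribution ?S by (rule real_distribution_normal_law) simp
  have null: "measure ?S {x} = 0" for x
  proof -
    have "emeasure ?S {x} = 0"
      by (subst emeasure_density) (auto simp: nn_integral_0_iff_AE intro!: AE_I[of _ _ "{x}"] split: split_indicator)
    then show ?thesis by (simp add: measure_def)
  qed
  have cont: "isCont (cdf ?S) x" for x using S.isCont_cdf null by simp
  define F where "F c = cdf ?S c - cdf ?S (- c)" for c
  have contF: "isCont F c" for c
    unfolding F_def by (intro continuous_intros cont isCont_o2[OF _ cont])
  have "(F \<longlongrightarrow> 1 - 0) at_top"
    unfolding F_def
    by (intro tendsto_intros S.cdf_lim_at_top_prob filterlim_compose[OF S.cdf_lim_at_bot] filterlim_uminus_at_bot_at_top)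
  then have "eventually (\<lambda>c. F c > 1/2) at_top"
    by (intro order_tendstoD(1)) auto
  then have "eventually (\<lambda>c. F c > 1/2 \<and> c \<ge> 0) at_top"
    using eventually_ge_at_top by (rule eventually_conj)
  then obtain b where b: "F b > 1/2" "b \<ge> 0"
    by (auto simp: eventually_at_top_linorder)
  have "\<exists>c. 0 \<le> c \<and> c \<le> b \<and> F c = 1/2"
  proof (intro IVT)
    show "F 0 \<le> 1/2" by (simp add: F_def)
  qed (use b contF in auto)
  then obtain c where c: "0 \<le> c" "F c = 1/2" by auto
  then have c0: "c > 0" by (cases "c = 0") (auto simp: F_def)
  have "F c = measure ?S {- c <.. c}"
    unfolding F_def using c0 by (subst S.cdf_diff_eq) auto
  also have "\<dots> = measure ?S ({- c <..< c} \<union> {c})"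
    using c0 by (intro arg_cong[where f="measure ?S"]) auto
  also have "\<dots> = measure ?S {- c <..< c} + measure ?S {c}"
    by (intro S.finite_measure_Union) auto
  finally have "measure ?S {- c <..< c} = 1/2" using c null by simp
  moreover have "{x. c \<le> \<bar>x\<bar>} = UNIV - {- c <..< c}" by auto
  ultimately have "measure ?S {x. c \<le> \<bar>x\<bar>} = 1/2"
    using S.prob_compl[of "{- c <..< c}"] by simp
  with c0 show thesis by (rule that)
qed

lemma median_normal_law:
  assumes \<sigma>: "0 < \<sigma>" and c: "measure std_normal_distribution {x. c \<le> \<bar>x\<bar>} = 1/2"
  shows "measure (normal_law \<sigma>) {x. \<sigma> * c \<le> \<bar>x\<bar>} = 1/2"
proof -
  have "measure (normal_law \<sigma>) {x. \<sigma> * c \<le> \<bar>x\<bar>} = measure std_normal_distribution {x. \<sigma> * c \<le> \<bar>\<sigma> * x\<bar>}"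
    unfolding normal_law_eq_distr[OF \<sigma>] by (subst measure_distr) (auto simp: vimage_def)
  also have "{x. \<sigma> * c \<le> \<bar>\<sigma> * x\<bar>} = {x. c \<le> \<bar>x\<bar>}"
    using \<sigma> by (auto simp: abs_mult)
  finally show ?thesis using c by simp
qed

lemma brownian_motion_prob_space: "brownian_motion M W \<Longrightarrow> prob_space M"
  and brownian_motion_measurable: "brownian_motion M W \<Longrightarrow> W t \<in> borel_measurable M"
  and brownian_motion_distributed: "brownian_motion M W \<Longrightarrow> 0 \<le> s \<Longrightarrow> s < t \<Longrightarrow>
    distributed M lborel (\<lambda>w. W t w - W s w) (normal_density 0 (sqrt (t - s)))"
  by (auto simp: brownian_motion_def)

lemma brownian_increments_char:
  assumes bm: "brownian_motion M W" and N: "0 < N"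
  shows "(\<integral>w. iexp (\<Sum>i<N. a i * (W (real (Suc i) / real N) w - W (real i / real N) w)) \<partial>M)
    = complex_of_real (exp (- (\<Sum>i<N. (a i)\<^sup>2) / (2 * real N)))"
proof -
  interpret prob_space M by (rule brownian_motion_prob_space[OF bm])
  note [measurable] = brownian_motion_measurable[OF bm]
  define d where "d i w = W (real (Suc i) / real N) w - W (real i / real N) w" for i w
  have [measurable]: "d i \<in> borel_measurable M" for i unfolding d_def by measurable
  have h1: "\<forall>i<N. 0 \<le> real i / real N \<and> real i / real N \<le> real (Suc i) / real N"
    using N by (auto simp: divide_right_mono)
  have h2: "\<forall>n (\<tau>::nat \<Rightarrow> real). (\<forall>i<n. 0 \<le> \<tau> i \<and> \<tau> i \<le> \<tau> (Suc i)) \<longrightarrow>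
      indep_vars (\<lambda>_. borel) (\<lambda>i w. W (\<tau> (Suc i)) w - W (\<tau> i) w) {..<n}"
    using bm unfolding brownian_motion_def by blast
  have "indep_vars (\<lambda>_. borel) (\<lambda>i w. W (real (Suc i) / real N) w - W (real i / real N) w) {..<N}"
    by (rule h2[THEN spec[of _ N], THEN spec[of _ "\<lambda>i. real i / real N"], THEN mp, OF h1])
  then have "indep_vars (\<lambda>_. borel) d {..<N}" unfolding d_def .
  then have "indep_vars (\<lambda>_. borel) (\<lambda>i w. a i * d i w) {..<N}"
    by (rule indep_vars_compose2) auto
  from char_distr_sum[OF this, of 1]
  have "(\<integral>w. iexp (\<Sum>i<N. a i * d i w) \<partial>M) = (\<Prod>i<N. char (distr M borel (\<lambda>w. a i * d i w)) 1)"
    by (simp add: char_def integral_distr del: of_real_sum)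
  also have "\<dots> = (\<Prod>i<N. complex_of_real (exp (- (a i)\<^sup>2 / (2 * real N))))"
  proof (intro prod.cong refl)
    fix i
    have gap: "real (Suc i) / real N - real i / real N = 1 / real N"
      using N by (simp add: field_simps)
    have "distributed M lborel (d i) (normal_density 0 (sqrt (real (Suc i) / real N - real i / real N)))"
      unfolding d_def using N by (intro brownian_motion_distributed[OF bm]) (auto simp: divide_strict_right_mono)
    then have "distr M lborel (d i) = normal_law (sqrt (1 / real N))"
      unfolding gap by (simp add: distributed_def)
    moreover have "distr M lborel (d i) = distr M borel (d i)" by (intro distr_cong) auto
    ultimately have dist: "distr M borel (d i) = normal_law (sqrt (1 / real N))" by simp
    have "char (distr M borel (\<lambda>w. a i * d i w)) 1 = char (distr M borel (d i)) (a i)"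
      unfolding char_def by (subst (1 2) integral_distr) auto
    also have "\<dots> = complex_of_real (exp (- (a i)\<^sup>2 / (2 * real N)))"
      unfolding dist using N by (subst char_normal_law) (auto simp: field_simps)
    finally show "char (distr M borel (\<lambda>w. a i * d i w)) 1 = complex_of_real (exp (- (a i)\<^sup>2 / (2 * real N)))" .
  qed
  also have "\<dots> = complex_of_real (exp (\<Sum>i<N. - (a i)\<^sup>2 / (2 * real N)))"
    by (simp only: exp_sum[OF finite_lessThan] of_real_prod)
  also have "(\<Sum>i<N. - (a i)\<^sup>2 / (2 * real N)) = - (\<Sum>i<N. (a i)\<^sup>2) / (2 * real N)"
    by (simp add: sum_divide_distrib sum_negf)
  finally show ?thesis unfolding d_def .
qed

lemma sum_square_orthogonal:
  fixes u :: "'k \<Rightarrow> 'i \<Rightarrow> real"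
  assumes K: "finite K" and ort: "\<And>\<kappa> \<kappa>'. \<kappa> \<in> K \<Longrightarrow> \<kappa>' \<in> K \<Longrightarrow> \<kappa> \<noteq> \<kappa>' \<Longrightarrow> (\<Sum>i\<in>A. u \<kappa> i * u \<kappa>' i) = 0"
  shows "(\<Sum>i\<in>A. (\<Sum>\<kappa>\<in>K. t \<kappa> * u \<kappa> i)\<^sup>2) = (\<Sum>\<kappa>\<in>K. (t \<kappa>)\<^sup>2 * (\<Sum>i\<in>A. (u \<kappa> i)\<^sup>2))"
proof -
  have "(\<Sum>i\<in>A. (\<Sum>\<kappa>\<in>K. t \<kappa> * u \<kappa> i)\<^sup>2) = (\<Sum>i\<in>A. \<Sum>\<kappa>\<in>K. \<Sum>\<kappa>'\<in>K. t \<kappa> * t \<kappa>' * (u \<kappa> i * u \<kappa>' i))"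
    by (simp add: power2_eq_square sum_product mult_ac)
  also have "\<dots> = (\<Sum>\<kappa>\<in>K. \<Sum>\<kappa>'\<in>K. t \<kappa> * t \<kappa>' * (\<Sum>i\<in>A. u \<kappa> i * u \<kappa>' i))"
    unfolding sum_distrib_left
    by (subst sum.swap, intro sum.cong refl, subst sum.swap, simp)
  also have "\<dots> = (\<Sum>\<kappa>\<in>K. \<Sum>\<kappa>'\<in>K. if \<kappa>' = \<kappa> then (t \<kappa>)\<^sup>2 * (\<Sum>i\<in>A. (u \<kappa> i)\<^sup>2) else 0)"
    using ort by (intro sum.cong refl) (auto simp: power2_eq_square)
  also have "\<dots> = (\<Sum>\<kappa>\<in>K. (t \<kappa>)\<^sup>2 * (\<Sum>i\<in>A. (u \<kappa> i)\<^sup>2))"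
    using K by simp
  finally show ?thesis .
qed

text \<open>Orthogonal coefficient vectors diagonalise the quadratic form in the characteristic
  exponent, which then factors: uncorrelated Gaussian combinations are independent.\<close>

lemma brownian_orthogonal_distr:
  fixes u :: "'k \<Rightarrow> nat \<Rightarrow> real"
  assumes bm: "brownian_motion M W" and N: "0 < N" and K: "finite K"
    and ort: "\<And>\<kappa> \<kappa>'. \<kappa> \<in> K \<Longrightarrow> \<kappa>' \<in> K \<Longrightarrow> \<kappa> \<noteq> \<kappa>' \<Longrightarrow> (\<Sum>i<N. u \<kappa> i * u \<kappa>' i) = 0"
    and \<sigma>: "\<And>\<kappa>. 0 < \<sigma> \<kappa>" and \<sigma>u: "\<And>\<kappa>. \<kappa> \<in> K \<Longrightarrow> (\<sigma> \<kappa>)\<^sup>2 = (\<Sum>i<N. (u \<kappa> i)\<^sup>2) / real N"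
  defines "g \<equiv> \<lambda>\<kappa> w. \<Sum>i<N. u \<kappa> i * (W (real (Suc i) / real N) w - W (real i / real N) w)"
  shows "distr M (PiM K (\<lambda>\<kappa>. normal_law (\<sigma> \<kappa>))) (\<lambda>w. \<lambda>\<kappa>\<in>K. g \<kappa> w) = PiM K (\<lambda>\<kappa>. normal_law (\<sigma> \<kappa>))"
proof -
  interpret prob_space M by (rule brownian_motion_prob_space[OF bm])
  note [measurable] = brownian_motion_measurable[OF bm]
  show ?thesis
  proof (rule distr_eq_PiM_if_char[OF K])
    show "real_distribution (normal_law (\<sigma> \<kappa>))" for \<kappa> using \<sigma> by (rule real_distribution_normal_law)
    show "g \<kappa> \<in> borel_measurable M" for \<kappa> unfolding g_def by measurable
    fix t :: "'k \<Rightarrow> real"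
    have eq: "(\<Sum>\<kappa>\<in>K. t \<kappa> * g \<kappa> w)
      = (\<Sum>i<N. (\<Sum>\<kappa>\<in>K. t \<kappa> * u \<kappa> i) * (W (real (Suc i) / real N) w - W (real i / real N) w))" for w
      unfolding g_def sum_distrib_left sum_distrib_right by (subst sum.swap) (simp add: mult_ac)
    have "(\<integral>w. iexp (\<Sum>\<kappa>\<in>K. t \<kappa> * g \<kappa> w) \<partial>M)
      = complex_of_real (exp (- (\<Sum>i<N. (\<Sum>\<kappa>\<in>K. t \<kappa> * u \<kappa> i)\<^sup>2) / (2 * real N)))"
      unfolding eq by (rule brownian_increments_char[OF bm N])
    also have "- (\<Sum>i<N. (\<Sum>\<kappa>\<in>K. t \<kappa> * u \<kappa> i)\<^sup>2) / (2 * real N) = (\<Sum>\<kappa>\<in>K. - ((\<sigma> \<kappa>)\<^sup>2 * (t \<kappa>)\<^sup>2) / 2)"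
    proof -
      have sq: "(\<Sum>i<N. (\<Sum>\<kappa>\<in>K. t \<kappa> * u \<kappa> i)\<^sup>2) = (\<Sum>\<kappa>\<in>K. (t \<kappa>)\<^sup>2 * (\<Sum>i<N. (u \<kappa> i)\<^sup>2))"
        by (rule sum_square_orthogonal[OF K ort])
      show ?thesis
        unfolding sq sum_negf[of _ K, symmetric] sum_divide_distrib[of _ K]
        using N by (intro sum.cong refl) (simp add: \<sigma>u mult.commute)
    qed
    also have "complex_of_real (exp \<dots>) = (\<Prod>\<kappa>\<in>K. char (normal_law (\<sigma> \<kappa>)) (t \<kappa>))"
      unfolding char_normal_law[OF \<sigma>] exp_sum[OF K] of_real_prod ..
    finally show "(\<integral>w. iexp (\<Sum>\<kappa>\<in>K. t \<kappa> * g \<kappa> w) \<partial>M) = (\<Prod>\<kappa>\<in>K. char (normal_law (\<sigma> \<kappa>)) (t \<kappa>))" .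
  qed
qed

section \<open>The Wiener isometry\<close>

lemma brownian_second_moment:
  assumes bm: "brownian_motion M W" and "0 \<le> s" "0 \<le> t"
  shows "integrable M (\<lambda>w. (W t w - W s w)\<^sup>2)" and "(\<integral>w. (W t w - W s w)\<^sup>2 \<partial>M) = \<bar>t - s\<bar>"
proof -
  interpret prob_space M by (rule brownian_motion_prob_space[OF bm])
  note [measurable] = brownian_motion_measurable[OF bm]
  have *: "integrable M (\<lambda>w. (W t w - W s w)\<^sup>2) \<and> (\<integral>w. (W t w - W s w)\<^sup>2 \<partial>M) = t - s"
    if "0 \<le> s" "s < t" for s t
  proof -
    note D = brownian_motion_distributed[OF bm that]
    have \<sigma>: "0 < sqrt (t - s)" using that by simp
    have "integrable lborel (\<lambda>x. normal_density 0 (sqrt (t - s)) x * x\<^sup>2)"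
      using integrable_normal_moment[OF \<sigma>, of 0 2] by simp
    then have 1: "integrable M (\<lambda>w. (W t w - W s w)\<^sup>2)"
      using distributed_integrable[OF D, of "\<lambda>x. x\<^sup>2"] by simp
    have "variance (\<lambda>w. W t w - W s w) = t - s"
      using normal_distributed_variance[OF \<sigma> D] that by simp
    then show ?thesis using 1 normal_distributed_expectation[OF \<sigma> D] by simp
  qed
  consider "s < t" | "s = t" | "t < s" by linarith
  then have "integrable M (\<lambda>w. (W t w - W s w)\<^sup>2) \<and> (\<integral>w. (W t w - W s w)\<^sup>2 \<partial>M) = \<bar>t - s\<bar>"
  proof cases
    case 1 then show ?thesis using *[of s t] assms by simp
  next
    case 2 then show ?thesis by simp
  next
    case 3
    then show ?thesis using *[of t s] assms by (simp add: power2_commute)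
  qed
  then show "integrable M (\<lambda>w. (W t w - W s w)\<^sup>2)" "(\<integral>w. (W t w - W s w)\<^sup>2 \<partial>M) = \<bar>t - s\<bar>" by auto
qed

lemma brownian_covariance:
  assumes bm: "brownian_motion M W" and "0 \<le> a" "a \<le> b" "0 \<le> c" "c \<le> d"
  shows "integrable M (\<lambda>w. (W b w - W a w) * (W d w - W c w))"
    and "(\<integral>w. (W b w - W a w) * (W d w - W c w) \<partial>M) = max 0 (min b d - max a c)"
proof -
  \<comment> \<open>Polarisation reduces covariances to second moments, whatever the relative
    position of the two intervals.\<close>
  have *: "(W b w - W a w) * (W d w - W c w)
    = ((W d w - W a w)\<^sup>2 + (W c w - W b w)\<^sup>2 - (W d w - W b w)\<^sup>2 - (W c w - W a w)\<^sup>2) / 2" for w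
    by (simp add: power2_eq_square field_simps)
  note i = brownian_second_moment[OF bm]
  show "integrable M (\<lambda>w. (W b w - W a w) * (W d w - W c w))"
    unfolding * using assms i(1) by auto
  show "(\<integral>w. (W b w - W a w) * (W d w - W c w) \<partial>M) = max 0 (min b d - max a c)"
    unfolding * using assms i by (simp add: max_def min_def)
qed

text \<open>Both sides are the same quadratic form in \<open>c\<close>, with the overlap lengths
  \<open>r i j\<close> as Gram matrix.\<close>

lemma brownian_step_isometry:
  fixes c a b :: "'i \<Rightarrow> real"
  assumes bm: "brownian_motion M W" and I: "finite I" and ab: "\<And>i. i \<in> I \<Longrightarrow> 0 \<le> a i \<and> a i \<le> b i \<and> b i \<le> 1"
  shows "(\<integral>\<^sup>+ w. ennreal ((\<Sum>i\<in>I. c i * (W (b i) w - W (a i) w))\<^sup>2) \<partial>M)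
    = (\<integral>\<^sup>+ t\<in>{0..1}. ennreal ((\<Sum>i\<in>I. c i * indicator {a i<..b i} t)\<^sup>2) \<partial>lborel)"
proof -
  define X where "X i w = W (b i) w - W (a i) w" for i w
  define e where "e i = (indicator {a i<..b i} :: real \<Rightarrow> real)" for i
  define r where "r i j = max 0 (min (b i) (b j) - max (a i) (a j))" for i j
  have X: "integrable M (\<lambda>w. X i w * X j w)" "(\<integral>w. X i w * X j w \<partial>M) = r i j" if "i \<in> I" "j \<in> I" for i j
    using brownian_covariance[OF bm, of "a i" "b i" "a j" "b j"] ab that unfolding X_def r_def by auto
  have e_prod: "e i t * e j t = indicator {max (a i) (a j)<..min (b i) (b j)} t" for i j t
    unfolding e_def by (auto split: split_indicator)
  have e: "integrable lborel (\<lambda>t. e i t * e j t)" "(\<integral>t. e i t * e j t \<partial>lborel) = r i j" for i j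
  proof -
    have "integrable lborel (indicator {l<..u} :: real \<Rightarrow> real) \<and> (\<integral>t. indicator {l<..u} t \<partial>lborel) = max 0 (u - l)"
      for l u :: real
      by (cases "l \<le> u") auto
    then show "integrable lborel (\<lambda>t. e i t * e j t)" "(\<integral>t. e i t * e j t \<partial>lborel) = r i j"
      unfolding e_prod r_def by blast+
  qed
  have sq: "(\<Sum>i\<in>I. c i * f i)\<^sup>2 = (\<Sum>i\<in>I. \<Sum>j\<in>I. c i * c j * (f i * f j))" for f :: "'i \<Rightarrow> real"
    by (simp add: power2_eq_square sum_product mult_ac)
  have "(\<integral>\<^sup>+ w. ennreal ((\<Sum>i\<in>I. c i * X i w)\<^sup>2) \<partial>M) = ennreal (\<integral>w. (\<Sum>i\<in>I. c i * X i w)\<^sup>2 \<partial>M)"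
    unfolding sq using X
    by (intro nn_integral_eq_integral Bochner_Integration.integrable_sum integrable_mult_right)
       (auto simp: sq[symmetric])
  also have "(\<integral>w. (\<Sum>i\<in>I. c i * X i w)\<^sup>2 \<partial>M) = (\<Sum>i\<in>I. \<Sum>j\<in>I. c i * c j * r i j)"
    unfolding sq using X by (simp add: Bochner_Integration.integral_sum Bochner_Integration.integrable_sum)
  also have "\<dots> = (\<integral>t. (\<Sum>i\<in>I. c i * e i t)\<^sup>2 \<partial>lborel)"
    unfolding sq using e by (simp add: Bochner_Integration.integral_sum Bochner_Integration.integrable_sum)
  also have "ennreal \<dots> = (\<integral>\<^sup>+ t. ennreal ((\<Sum>i\<in>I. c i * e i t)\<^sup>2) \<partial>lborel)"
    unfolding sq using e
    by (intro nn_integral_eq_integral[symmetric] Bochner_Integration.integrable_sum integrable_mult_right)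
       (auto simp: sq[symmetric])
  also have "\<dots> = (\<integral>\<^sup>+ t\<in>{0..1}. ennreal ((\<Sum>i\<in>I. c i * e i t)\<^sup>2) \<partial>lborel)"
  proof (intro nn_integral_cong)
    fix t :: real
    have "e i t = 0" if "t \<notin> {0..1}" "i \<in> I" for i using that ab[of i] unfolding e_def by (auto split: split_indicator)
    then show "ennreal ((\<Sum>i\<in>I. c i * e i t)\<^sup>2) = ennreal ((\<Sum>i\<in>I. c i * e i t)\<^sup>2) * indicator {0..1} t"
      by (cases "t \<in> {0..1}") (auto simp: sum.neutral)
  qed
  finally show ?thesis unfolding X_def e_def .
qed

lemma ennreal_diff_square_le:
  fixes x y z :: real
  shows "ennreal ((x - z)\<^sup>2) \<le> 2 * ennreal ((x - y)\<^sup>2) + 2 * ennreal ((y - z)\<^sup>2)"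
proof -
  have "(x - z)\<^sup>2 \<le> 2 * (x - y)\<^sup>2 + 2 * (y - z)\<^sup>2"
    using zero_le_power2[of "x - 2 * y + z"] by (simp add: power2_eq_square algebra_simps)
  then have "ennreal ((x - z)\<^sup>2) \<le> ennreal (2 * (x - y)\<^sup>2 + 2 * (y - z)\<^sup>2)" by (rule ennreal_leI)
  also have "\<dots> = 2 * ennreal ((x - y)\<^sup>2) + 2 * ennreal ((y - z)\<^sup>2)"
    by (simp add: ennreal_plus ennreal_mult)
  finally show ?thesis .
qed

text \<open>The Wiener integral comes with some approximating sequence of step functions; the
  isometry compares that sequence with the prescribed step function. The square is split twice at
  cost 2 each, hence \<open>4 * \<epsilon>\<^sup>2\<close>.\<close>

lemma wiener_integral_step_bound:
  fixes d \<alpha> \<beta> :: "nat \<Rightarrow> real"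
  assumes bm: "brownian_motion M W" and wi: "wiener_integral M W g Z"
    and g: "g \<in> borel_measurable (restrict_space lborel {0..1})"
    and \<alpha>\<beta>: "\<And>i. i < m \<Longrightarrow> 0 \<le> \<alpha> i \<and> \<alpha> i \<le> \<beta> i \<and> \<beta> i \<le> 1"
    and \<epsilon>: "\<And>t. t \<in> {0..1} \<Longrightarrow> \<bar>g t - (\<Sum>i<m. d i * indicator {\<alpha> i<..\<beta> i} t)\<bar> \<le> \<epsilon>"
  shows "(\<integral>\<^sup>+ w. ennreal ((Z w - (\<Sum>i<m. d i * (W (\<beta> i) w - W (\<alpha> i) w)))\<^sup>2) \<partial>M) \<le> ennreal (4 * \<epsilon>\<^sup>2)"
proof -
  interpret prob_space M by (rule brownian_motion_prob_space[OF bm])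
  note [measurable] = brownian_motion_measurable[OF bm]
  have Z[measurable]: "Z \<in> borel_measurable M" using wi by (simp add: wiener_integral_def)
  from wi obtain k :: "nat \<Rightarrow> nat" and c a b :: "nat \<Rightarrow> nat \<Rightarrow> real"
    where ab: "\<And>n i. 0 \<le> a n i \<and> a n i \<le> b n i \<and> b n i \<le> 1"
      and lim1: "(\<lambda>n. \<integral>\<^sup>+ t\<in>{0..1}. ennreal ((g t - (\<Sum>i<k n. c n i * indicator {a n i<..b n i} t))\<^sup>2) \<partial>lborel) \<longlonglongrightarrow> 0"
      and lim2: "(\<lambda>n. \<integral>\<^sup>+ w. ennreal ((Z w - (\<Sum>i<k n. c n i * (W (b n i) w - W (a n i) w)))\<^sup>2) \<partial>M) \<longlonglongrightarrow> 0"
    unfolding wiener_integral_def by auto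
  define h where "h n t = (\<Sum>i<k n. c n i * indicator {a n i<..b n i} t)" for n and t :: real
  define H where "H n w = (\<Sum>i<k n. c n i * (W (b n i) w - W (a n i) w))" for n w
  define s where "s t = (\<Sum>i<m. d i * indicator {\<alpha> i<..\<beta> i} t)" for t :: real
  define S where "S w = (\<Sum>i<m. d i * (W (\<beta> i) w - W (\<alpha> i) w))" for w
  have [measurable]: "h n \<in> borel_measurable borel" "s \<in> borel_measurable borel"
    "H n \<in> borel_measurable M" "S \<in> borel_measurable M" for n
    unfolding h_def s_def H_def S_def by measurable
  \<comment> \<open>\<open>g\<close> is measurable on the unit interval only, hence the extension by
    zero.\<close>
  define G where "G t = indicator {0..1} t * g t" for t :: real
  have G[measurable]: "G \<in> borel_measurable borel"
    using g unfolding G_def by (subst (asm) borel_measurable_restrict_space_iff) auto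
  have iso: "(\<integral>\<^sup>+ w. ennreal ((H n w - S w)\<^sup>2) \<partial>M) = (\<integral>\<^sup>+ t\<in>{0..1}. ennreal ((h n t - s t)\<^sup>2) \<partial>lborel)" for n
  proof -
    \<comment> \<open>The difference of two step functions with unrelated intervals is one step
      function over the disjoint sum of the index sets.\<close>
    let ?I = "{..<k n} <+> {..<m}"
    let ?c = "case_sum (c n) (\<lambda>i. - d i)" and ?a = "case_sum (a n) \<alpha>" and ?b = "case_sum (b n) \<beta>"
    have 1: "(\<Sum>i\<in>?I. ?c i * (W (?b i) w - W (?a i) w)) = H n w - S w" for w
      unfolding H_def S_def by (subst sum.Plus) (auto simp: sum_negf o_def)
    have 2: "(\<Sum>i\<in>?I. ?c i * indicator {?a i<..?b i} t) = h n t - s t" for t :: real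
      unfolding h_def s_def by (subst sum.Plus) (auto simp: sum_negf o_def)
    have "(\<integral>\<^sup>+ w. ennreal ((\<Sum>i\<in>?I. ?c i * (W (?b i) w - W (?a i) w))\<^sup>2) \<partial>M)
      = (\<integral>\<^sup>+ t\<in>{0..1}. ennreal ((\<Sum>i\<in>?I. ?c i * indicator {?a i<..?b i} t)\<^sup>2) \<partial>lborel)"
      using ab \<alpha>\<beta> by (intro brownian_step_isometry[OF bm]) auto
    then show ?thesis unfolding 1 2 .
  qed
  let ?A = "\<lambda>n. \<integral>\<^sup>+ w. ennreal ((Z w - H n w)\<^sup>2) \<partial>M"
  let ?B = "\<lambda>n. \<integral>\<^sup>+ t\<in>{0..1}. ennreal ((g t - h n t)\<^sup>2) \<partial>lborel"
  have le: "(\<integral>\<^sup>+ w. ennreal ((Z w - S w)\<^sup>2) \<partial>M) \<le> 2 * ?A n + 2 * (2 * ?B n + ennreal (2 * \<epsilon>\<^sup>2))" for n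
  proof -
    have "(\<integral>\<^sup>+ w. ennreal ((Z w - S w)\<^sup>2) \<partial>M)
      \<le> (\<integral>\<^sup>+ w. 2 * ennreal ((Z w - H n w)\<^sup>2) + 2 * ennreal ((H n w - S w)\<^sup>2) \<partial>M)"
      by (intro nn_integral_mono ennreal_diff_square_le)
    also have "\<dots> = 2 * ?A n + 2 * (\<integral>\<^sup>+ w. ennreal ((H n w - S w)\<^sup>2) \<partial>M)"
      by (simp add: nn_integral_add nn_integral_cmult)
    also have "(\<integral>\<^sup>+ w. ennreal ((H n w - S w)\<^sup>2) \<partial>M) \<le> 2 * ?B n + ennreal (2 * \<epsilon>\<^sup>2)"
    proof -
      have "(\<integral>\<^sup>+ w. ennreal ((H n w - S w)\<^sup>2) \<partial>M)
        \<le> (\<integral>\<^sup>+ t. 2 * (ennreal ((G t - h n t)\<^sup>2) * indicator {0..1} t) + ennreal (2 * \<epsilon>\<^sup>2) * indicator {0..1} t \<partial>lborel)"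
        unfolding iso
      proof (intro nn_integral_mono)
        fix t :: real
        show "ennreal ((h n t - s t)\<^sup>2) * indicator {0..1} t
          \<le> 2 * (ennreal ((G t - h n t)\<^sup>2) * indicator {0..1} t) + ennreal (2 * \<epsilon>\<^sup>2) * indicator {0..1} t"
        proof (cases "t \<in> {0..1}")
          case True
          have "(g t - s t)\<^sup>2 \<le> \<epsilon>\<^sup>2" using power_mono[OF \<epsilon>[OF True], of 2] unfolding s_def by simp
          then have "2 * ennreal ((g t - s t)\<^sup>2) \<le> ennreal (2 * \<epsilon>\<^sup>2)"
            by (simp add: ennreal_mult ennreal_leI mult_left_mono)
          with ennreal_diff_square_le[of "h n t" "s t" "g t"] True show ?thesis
            by (simp add: G_def power2_commute[of "h n t" "g t"]) (meson add_left_mono order_trans)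
        qed simp
      qed
      also have "\<dots> = 2 * (\<integral>\<^sup>+ t\<in>{0..1}. ennreal ((G t - h n t)\<^sup>2) \<partial>lborel) + ennreal (2 * \<epsilon>\<^sup>2)"
        by (simp add: nn_integral_add nn_integral_cmult nn_integral_cmult_indicator)
      also have "(\<integral>\<^sup>+ t\<in>{0..1}. ennreal ((G t - h n t)\<^sup>2) \<partial>lborel) = ?B n"
        by (intro nn_integral_cong) (auto simp: G_def split: split_indicator)
      finally show ?thesis .
    qed
    finally show ?thesis by (simp add: add_left_mono mult_left_mono)
  qed
  have "(\<lambda>n. 2 * ?A n + 2 * (2 * ?B n + ennreal (2 * \<epsilon>\<^sup>2))) \<longlonglongrightarrow> 2 * 0 + 2 * (2 * 0 + ennreal (2 * \<epsilon>\<^sup>2))"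
    using lim1 lim2 unfolding h_def H_def
    by (intro tendsto_add tendsto_const ennreal_tendsto_cmult) auto
  then have "(\<integral>\<^sup>+ w. ennreal ((Z w - S w)\<^sup>2) \<partial>M) \<le> 2 * 0 + 2 * (2 * 0 + ennreal (2 * \<epsilon>\<^sup>2))"
    using le by (intro LIMSEQ_le_const) auto
  also have "2 * 0 + 2 * (2 * 0 + ennreal (2 * \<epsilon>\<^sup>2)) = ennreal (4 * \<epsilon>\<^sup>2)"
    using ennreal_mult[of 2 "2 * \<epsilon>\<^sup>2"] by simp
  finally show ?thesis unfolding S_def .
qed

section \<open>An orthogonal system of hats\<close>

definition hat :: "real \<Rightarrow> real" where
  "hat s = max 0 (1 - \<bar>s\<bar>)"

text \<open>A second difference of hats: it is orthogonal to affine functions, and affine between consecutive multiples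
  of a quarter, so that its dilates by different powers of four are mutually orthogonal.\<close>

definition wavelet :: "real \<Rightarrow> real" where
  "wavelet t = hat (4 * t - 1) - 2 * hat (4 * t - 2) + hat (4 * t - 3)"

lemma wavelet_eq_0: "t \<le> 0 \<or> 1 \<le> t \<Longrightarrow> wavelet t = 0"
  by (auto simp: wavelet_def hat_def)

lemma wavelet_of_int: "t \<in> \<int> \<Longrightarrow> wavelet t = 0"
proof -
  assume "t \<in> \<int>"
  then obtain k :: int where "t = of_int k" by (auto elim: Ints_cases)
  then have "t \<le> 0 \<or> 1 \<le> t" by (cases "k \<le> 0") auto
  then show ?thesis by (rule wavelet_eq_0)
qed

lemma wavelet_abs_le: "\<bar>wavelet t\<bar> \<le> 2"
  unfolding wavelet_def hat_def max_def abs_if by auto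

lemma wavelet_lipschitz: "\<bar>wavelet s - wavelet t\<bar> \<le> 16 * \<bar>s - t\<bar>"
proof -
  have hat: "\<bar>hat a - hat b\<bar> \<le> \<bar>a - b\<bar>" for a b
    unfolding hat_def by auto
  have "\<bar>hat (4 * s - c) - hat (4 * t - c)\<bar> \<le> 4 * \<bar>s - t\<bar>" for c
  proof -
    have "(4 * s - c) - (4 * t - c) = 4 * (s - t)" by simp
    then show ?thesis using hat[of "4 * s - c" "4 * t - c"] by (simp only: abs_mult abs_numeral)
  qed
  from this[of 1] this[of 2] this[of 3] show ?thesis
    unfolding wavelet_def abs_le_iff by linarith
qed

lemma wavelet_affine:
  fixes m :: int
  obtains A B :: real where "\<And>t::real. of_int m \<le> 4 * t \<Longrightarrow> 4 * t \<le> of_int m + 1 \<Longrightarrow> wavelet t = A + B * t"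
proof -
  define A B where "A n = (if n = -1 \<or> n = 0 then 1 else 0 :: real)"
    and "B n = (if n = -1 then 1 else if n = 0 then -1 else 0 :: real)" for n :: int
  have hat: "hat s = A n + B n * s" if "of_int n \<le> s" "s \<le> of_int n + 1" for n s
  proof -
    consider "n \<le> -2" | "n = -1" | "n = 0" | "n \<ge> 1" by linarith
    then show ?thesis using that by cases (auto simp: hat_def A_def B_def)
  qed
  show thesis
  proof (rule that)
    fix t :: real assume "of_int m \<le> 4 * t" "4 * t \<le> of_int m + 1"
    then show "wavelet t = (A (m - 1) - B (m - 1) - 2 * A (m - 2) + 4 * B (m - 2) + A (m - 3) - 3 * B (m - 3))
        + (4 * B (m - 1) - 8 * B (m - 2) + 4 * B (m - 3)) * t"
      unfolding wavelet_def using hat[of "m - 1" "4 * t - 1"] hat[of "m - 2" "4 * t - 2"] hat[of "m - 3" "4 * t - 3"]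
      by (simp add: algebra_simps)
  qed
qed

text \<open>At the multiples of a quarter the values are 0, 1, -2, 1, 0, with linear interpolation
  between them.\<close>

lemma wavelet_quarters:
  assumes "0 \<le> u" "u \<le> 1"
  shows "wavelet (u / 4) = u" "wavelet ((1 + u) / 4) = 1 - 3 * u" "wavelet ((2 + u) / 4) = 3 * u - 2"
    "wavelet ((3 + u) / 4) = 1 - u"
proof -
  have "wavelet (s / 4) = hat (s - 1) - 2 * hat (s - 2) + hat (s - 3)" for s
    by (simp add: wavelet_def)
  then show "wavelet (u / 4) = u" "wavelet ((1 + u) / 4) = 1 - 3 * u" "wavelet ((2 + u) / 4) = 3 * u - 2"
    "wavelet ((3 + u) / 4) = 1 - u"
    using assms by (auto simp: hat_def)
qed

lemma sum_lessThan_add: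
  fixes f :: "nat \<Rightarrow> 'a::comm_monoid_add"
  shows "(\<Sum>m<a + b. f m) = (\<Sum>m<a. f m) + (\<Sum>r<b. f (a + r))"
  by (induction b) (simp_all add: add.assoc)

lemma sum_four_blocks:
  fixes f :: "nat \<Rightarrow> real"
  shows "(\<Sum>m<4 * n. f m) = (\<Sum>r<n. f r + f (n + r) + f (2 * n + r) + f (3 * n + r))"
proof -
  have "4 * n = ((n + n) + n) + n" by simp
  then have "(\<Sum>m<4 * n. f m) = (\<Sum>m<((n + n) + n) + n. f m)" by (simp only:)
  also have "\<dots> = (\<Sum>r<n. f r) + (\<Sum>r<n. f (n + r)) + (\<Sum>r<n. f (n + n + r)) + (\<Sum>r<n. f (n + n + n + r))"
    unfolding sum_lessThan_add ..
  also have "n + n = 2 * n" by simp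
  also have "2 * n + n = 3 * n" by simp
  finally show ?thesis by (simp add: sum.distrib)
qed

lemma wavelet_grid_quarters:
  assumes "0 < n" "r < n"
  shows "wavelet (real r / real (4 * n)) = real r / real n"
    "wavelet (real (n + r) / real (4 * n)) = 1 - 3 * (real r / real n)"
    "wavelet (real (2 * n + r) / real (4 * n)) = 3 * (real r / real n) - 2"
    "wavelet (real (3 * n + r) / real (4 * n)) = 1 - real r / real n"
proof -
  define u where "u = real r / real n"
  have u: "0 \<le> u" "u \<le> 1" using assms by (auto simp: u_def)
  have eq: "real r / real (4 * n) = u / 4" "real (n + r) / real (4 * n) = (1 + u) / 4"
    "real (2 * n + r) / real (4 * n) = (2 + u) / 4" "real (3 * n + r) / real (4 * n) = (3 + u) / 4"
    using assms by (auto simp: u_def field_simps)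
  show "wavelet (real r / real (4 * n)) = real r / real n"
    "wavelet (real (n + r) / real (4 * n)) = 1 - 3 * (real r / real n)"
    "wavelet (real (2 * n + r) / real (4 * n)) = 3 * (real r / real n) - 2"
    "wavelet (real (3 * n + r) / real (4 * n)) = 1 - real r / real n"
    unfolding eq wavelet_quarters[OF u] by (simp_all only: u_def)
qed

text \<open>The cancellation happens within each quadruple \<open>r\<close>, \<open>n + r\<close>,
  \<open>2 * n + r\<close>, \<open>3 * n + r\<close>: with \<open>u = r / n\<close> the values
  \<open>u\<close>, \<open>1 - 3 * u\<close>, \<open>3 * u - 2\<close>, \<open>1 - u\<close> sum to
  0, and so they do when weighted by 0, 1, 2, 3.\<close>

lemma wavelet_grid_orthogonal_affine:
  assumes "0 < n"
  shows "(\<Sum>m<4 * n. (A + B * real m) * wavelet (real m / real (4 * n))) = 0"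
  unfolding sum_four_blocks
proof (intro sum.neutral ballI)
  fix r assume "r \<in> {..<n}"
  then have r: "r < n" by simp
  show "(A + B * real r) * wavelet (real r / real (4 * n))
    + (A + B * real (n + r)) * wavelet (real (n + r) / real (4 * n))
    + (A + B * real (2 * n + r)) * wavelet (real (2 * n + r) / real (4 * n))
    + (A + B * real (3 * n + r)) * wavelet (real (3 * n + r) / real (4 * n)) = 0"
    unfolding wavelet_grid_quarters[OF assms r] using assms by (simp add: field_simps)
qed

text \<open>Each of the \<open>n\<close> quadruples contributes
  \<open>1 + 20 * (u - 1/2)\<^sup>2\<close>.\<close>

lemma wavelet_grid_square_ge:
  assumes "0 < n"
  shows "real n \<le> (\<Sum>m<4 * n. (wavelet (real m / real (4 * n)))\<^sup>2)"
proof -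
  have "(\<Sum>r<n. 1) \<le> (\<Sum>m<4 * n. (wavelet (real m / real (4 * n)))\<^sup>2)"
    unfolding sum_four_blocks
  proof (intro sum_mono)
    fix r assume r: "r \<in> {..<n}"
    define u where "u = real r / real n"
    have "u\<^sup>2 + (1 - 3 * u)\<^sup>2 + (3 * u - 2)\<^sup>2 + (1 - u)\<^sup>2 = 1 + 20 * (u - 1/2)\<^sup>2"
      by (simp add: power2_eq_square field_simps)
    then have "1 \<le> u\<^sup>2 + (1 - 3 * u)\<^sup>2 + (3 * u - 2)\<^sup>2 + (1 - u)\<^sup>2" by simp
    then show "1 \<le> (wavelet (real r / real (4 * n)))\<^sup>2 + (wavelet (real (n + r) / real (4 * n)))\<^sup>2
       + (wavelet (real (2 * n + r) / real (4 * n)))\<^sup>2 + (wavelet (real (3 * n + r) / real (4 * n)))\<^sup>2"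
      using r assms unfolding u_def by (simp only: wavelet_grid_quarters lessThan_iff)
  qed
  then show ?thesis by simp
qed

text \<open>The translate lives on the \<open>N\<close> grid points from \<open>k * N\<close> on. A
  general \<open>G\<close> covers products and squares alike.\<close>

lemma wavelet_grid_sum:
  fixes F :: "nat \<Rightarrow> real" and G :: "real \<Rightarrow> real"
  assumes j: "j < J" and k: "k < 4 ^ j" and G0: "G 0 = 0"
  defines "N \<equiv> 4 ^ (J - j)"
  shows "(\<Sum>i<4 ^ J. F i * G (wavelet (4 ^ j * (real i / 4 ^ J) - real k)))
    = (\<Sum>r<N. F (k * N + r) * G (wavelet (real r / real N)))"
proof -
  have JN: "(4::real) ^ J = 4 ^ j * real N" and JN': "(4::nat) ^ J = 4 ^ j * N"
    unfolding N_def using j by (simp_all add: power_add[symmetric])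
  have N: "0 < N" unfolding N_def by simp
  have arg: "4 ^ j * (real i / 4 ^ J) - real k = real i / real N - real k" for i
    unfolding JN by simp
  have sub: "(\<lambda>r. k * N + r) ` {..<N} \<subseteq> {..<4 ^ J}"
  proof (clarsimp simp: JN')
    fix r assume "r < N"
    then have "k * N + r < (k + 1) * N" by simp
    also have "\<dots> \<le> 4 ^ j * N" using k by (intro mult_right_mono) auto
    finally show "k * N + r < 4 ^ j * N" .
  qed
  have "(\<Sum>i<4 ^ J. F i * G (wavelet (real i / real N - real k)))
    = (\<Sum>i\<in>(\<lambda>r. k * N + r) ` {..<N}. F i * G (wavelet (real i / real N - real k)))"
  proof (rule sum.mono_neutral_right[OF finite_lessThan sub], intro ballI)
    fix i assume i: "i \<in> {..<4 ^ J} - (\<lambda>r. k * N + r) ` {..<N}"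
    have "i < k * N \<or> (k + 1) * N \<le> i"
    proof (rule ccontr)
      assume "\<not> ?thesis"
      then have "i = k * N + (i - k * N)" "i - k * N < N" by auto
      then show False using i by blast
    qed
    then have "real i / real N - real k \<le> 0 \<or> 1 \<le> real i / real N - real k"
    proof
      assume "i < k * N"
      then have "real i < real k * real N" by (metis of_nat_less_iff of_nat_mult)
      then show ?thesis using N by (simp add: field_simps)
    next
      assume "(k + 1) * N \<le> i"
      then have "(real k + 1) * real N \<le> real i" by (metis of_nat_le_iff of_nat_mult of_nat_add of_nat_1)
      then show ?thesis using N by (simp add: field_simps)
    qed
    then show "F i * G (wavelet (real i / real N - real k)) = 0"
      using wavelet_eq_0 G0 by simp
  qed
  also have "\<dots> = (\<Sum>r<N. F (k * N + r) * G (wavelet (real r / real N)))"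
    using N by (subst sum.reindex) (auto simp: inj_on_def add_divide_distrib)
  finally show ?thesis unfolding arg .
qed

text \<open>The support of the finer function fits into one quarter of a cell of level
  \<open>j\<close>, where the coarser function is affine.\<close>

lemma wavelet_grid_orthogonal_levels:
  assumes jj: "j < j'" "j' < J" and k': "k' < 4 ^ j'"
  shows "(\<Sum>i<4 ^ J. wavelet (4 ^ j * (real i / 4 ^ J) - real k) * wavelet (4 ^ j' * (real i / 4 ^ J) - real k')) = 0"
proof -
  define N :: nat where "N = 4 ^ (J - j')"
  define e where "e = j' - Suc j"
  have e: "j' = Suc (j + e)" unfolding e_def using jj by simp
  have N: "0 < N" unfolding N_def by simp
  have JN: "(4::real) ^ J = 4 ^ j' * real N"
    unfolding N_def using jj by (simp add: power_add[symmetric])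
  have N4: "N = 4 * 4 ^ (J - j' - 1)"
    unfolding N_def using jj by (simp add: power_Suc[symmetric] del: power_Suc)
  \<comment> \<open>\<open>k' div 4 ^ e\<close> numbers the quarter cells of level \<open>j\<close>
    from the origin; subtracting \<open>4 * int k\<close> makes the count relative to the translate
    by \<open>k\<close>.\<close>
  define m :: int where "m = int (k' div 4 ^ e) - 4 * int k"
  obtain A B where AB: "\<And>t::real. of_int m \<le> 4 * t \<Longrightarrow> 4 * t \<le> of_int m + 1 \<Longrightarrow> wavelet t = A + B * t"
    using wavelet_affine[of m] by blast
  define b where "b = B * 4 ^ j / 4 ^ J"
  have "wavelet (4 ^ j * (real (k' * N + r) / 4 ^ J) - real k) = (A + B * (4 ^ j * (real (k' * N) / 4 ^ J) - real k)) + b * real r"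
    if r: "r < N" for r
  proof -
    let ?t = "4 ^ j * (real (k' * N + r) / 4 ^ J) - real k"
    define y where "y = (real k' + real r / real N) / 4 ^ e"
    have t: "4 * ?t = y - 4 * real k"
      unfolding y_def JN e using N by (simp add: power_add field_simps)
    have "k' div 4 ^ e * 4 ^ e \<le> k'" by (rule div_times_less_eq_dividend)
    then have lo: "real (k' div 4 ^ e) * 4 ^ e \<le> real k'"
      by (metis of_nat_le_iff of_nat_mult of_nat_numeral of_nat_power)
    have "k' + 1 \<le> (k' div 4 ^ e + 1) * 4 ^ e"
      using dividend_less_div_times[of "4 ^ e" k'] by simp
    then have "real (k' + 1) \<le> real ((k' div 4 ^ e + 1) * 4 ^ e)" by (rule of_nat_mono)
    then have hi: "real k' + 1 \<le> (real (k' div 4 ^ e) + 1) * 4 ^ e"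
      by (simp add: algebra_simps)
    have r1: "0 \<le> real r / real N" "real r / real N \<le> 1" using r by auto
    have "real (k' div 4 ^ e) * 4 ^ e \<le> y * 4 ^ e" "y * 4 ^ e \<le> (real (k' div 4 ^ e) + 1) * 4 ^ e"
    proof -
      have "y * 4 ^ e = real k' + real r / real N" unfolding y_def by simp
      then show "real (k' div 4 ^ e) * 4 ^ e \<le> y * 4 ^ e" "y * 4 ^ e \<le> (real (k' div 4 ^ e) + 1) * 4 ^ e"
        using lo hi r1 by linarith+
    qed
    then have "real (k' div 4 ^ e) \<le> y" "y \<le> real (k' div 4 ^ e) + 1"
      by (simp_all add: mult_le_cancel_right)
    then have "wavelet ?t = A + B * ?t"
      by (intro AB; unfold t m_def) auto
    then show ?thesis unfolding b_def by (simp add: algebra_simps add_divide_distrib)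
  qed
  then have "(\<Sum>r<N. wavelet (4 ^ j * (real (k' * N + r) / 4 ^ J) - real k) * wavelet (real r / real N))
    = (\<Sum>r<N. ((A + B * (4 ^ j * (real (k' * N) / 4 ^ J) - real k)) + b * real r) * wavelet (real r / real N))"
    by (intro sum.cong) auto
  also have "\<dots> = 0"
    unfolding N4 by (rule wavelet_grid_orthogonal_affine) simp
  finally show ?thesis
    using wavelet_grid_sum[OF jj(2) k', of "\<lambda>x. x" "\<lambda>i. wavelet (4 ^ j * (real i / 4 ^ J) - real k)"] unfolding N_def by simp
qed

lemma wavelet_grid_orthogonal:
  assumes "j < J" "k < 4 ^ j" "j' < J" "k' < 4 ^ j'" "(j, k) \<noteq> (j', k')"
  shows "(\<Sum>i<4 ^ J. wavelet (4 ^ j * (real i / 4 ^ J) - real k) * wavelet (4 ^ j' * (real i / 4 ^ J) - real k')) = 0"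
proof (cases j j' rule: linorder_cases)
  case less
  then show ?thesis using assms by (intro wavelet_grid_orthogonal_levels)
next
  case greater
  then have "(\<Sum>i<4 ^ J. wavelet (4 ^ j' * (real i / 4 ^ J) - real k') * wavelet (4 ^ j * (real i / 4 ^ J) - real k)) = 0"
    using assms by (intro wavelet_grid_orthogonal_levels)
  then show ?thesis by (simp add: mult.commute)
next
  case equal
  then have "k \<noteq> k'" using assms by auto
  then have kk: "real k + 1 \<le> real k' \<or> real k' + 1 \<le> real k" by linarith
  \<comment> \<open>Translates of one level have supports that meet at most in end points, where
    they vanish.\<close>
  have "wavelet (t - real k) * wavelet (t - real k') = 0" for t
    using kk wavelet_eq_0[of "t - real k"] wavelet_eq_0[of "t - real k'"] by (cases "t - real k \<le> 0"; cases "1 \<le> t - real k"; auto)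
  then show ?thesis unfolding equal by (intro sum.neutral ballI)
qed

lemma wavelet_grid_norm:
  assumes "j < J" "k < 4 ^ j"
  shows "4 ^ (J - j) / 4 \<le> (\<Sum>i<4 ^ J. (wavelet (4 ^ j * (real i / 4 ^ J) - real k))\<^sup>2)"
proof -
  define n :: nat where "n = 4 ^ (J - j - 1)"
  have N4: "(4::nat) ^ (J - j) = 4 * n"
    unfolding n_def using assms by (simp add: power_Suc[symmetric] del: power_Suc)
  have "(\<Sum>i<4 ^ J. (wavelet (4 ^ j * (real i / 4 ^ J) - real k))\<^sup>2) = (\<Sum>r<4 * n. (wavelet (real r / real (4 * n)))\<^sup>2)"
    using wavelet_grid_sum[OF assms, of "\<lambda>x. x\<^sup>2" "\<lambda>_. 1"] unfolding N4 by simp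
  moreover have "real n \<le> (\<Sum>r<4 * n. (wavelet (real r / real (4 * n)))\<^sup>2)"
    by (rule wavelet_grid_square_ge) (simp add: n_def)
  moreover have "real ((4::nat) ^ (J - j)) = 4 * real n" unfolding N4 by simp
  ultimately show ?thesis by simp
qed

section \<open>Hoelder regularity of the series\<close>

definition wavelet_level :: "(nat \<Rightarrow> nat \<Rightarrow> 'e::real_normed_vector) \<Rightarrow> nat \<Rightarrow> real \<Rightarrow> 'e" where
  "wavelet_level x j t = (\<Sum>k<4 ^ j. wavelet (4 ^ j * t - real k) *\<^sub>R x j k)"

definition wavelet_series :: "real \<Rightarrow> (nat \<Rightarrow> nat \<Rightarrow> 'e::real_normed_vector) \<Rightarrow> real \<Rightarrow> 'e" where
  "wavelet_series \<alpha> x t = (\<Sum>j. (4 powr - \<alpha>) ^ j *\<^sub>R wavelet_level x j t)"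

text \<open>At each point at most one translate is nonzero, so at most two values of
  \<open>k\<close> contribute, each bounded by twice the supremum bound 2 and by the Lipschitz bound
  with constant 16.\<close>

lemma sum_wavelet_diff_le:
  "(\<Sum>k<n. \<bar>wavelet (u - real k) - wavelet (v - real k)\<bar>) \<le> 2 * min 4 (16 * \<bar>u - v\<bar>)"
proof -
  let ?b = "min 4 (16 * \<bar>u - v\<bar>)"
  let ?T = "{..<n} \<inter> {nat \<lfloor>u\<rfloor>, nat \<lfloor>v\<rfloor>}"
  have loc: "k = nat \<lfloor>w\<rfloor>" if "wavelet (w - real k) \<noteq> 0" for w k
  proof -
    have "\<not> (w - real k \<le> 0 \<or> 1 \<le> w - real k)" using that wavelet_eq_0 by blast
    then have "\<lfloor>w\<rfloor> = int k" by (intro floor_unique) auto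
    then show ?thesis by simp
  qed
  have "(\<Sum>k<n. \<bar>wavelet (u - real k) - wavelet (v - real k)\<bar>) = (\<Sum>k\<in>?T. \<bar>wavelet (u - real k) - wavelet (v - real k)\<bar>)"
  proof (intro sum.mono_neutral_right ballI)
    fix k assume "k \<in> {..<n} - ?T"
    then have "wavelet (u - real k) = 0" "wavelet (v - real k) = 0" using loc[of u k] loc[of v k] by auto
    then show "\<bar>wavelet (u - real k) - wavelet (v - real k)\<bar> = 0" by simp
  qed auto
  also have "\<dots> \<le> (\<Sum>k\<in>?T. ?b)"
  proof (intro sum_mono min.boundedI)
    fix k
    show "\<bar>wavelet (u - real k) - wavelet (v - real k)\<bar> \<le> 4"
      using wavelet_abs_le[of "u - real k"] wavelet_abs_le[of "v - real k"] by linarith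
    show "\<bar>wavelet (u - real k) - wavelet (v - real k)\<bar> \<le> 16 * \<bar>u - v\<bar>"
      using wavelet_lipschitz[of "u - real k" "v - real k"] by simp
  qed
  also have "\<dots> = real (card ?T) * ?b" by simp
  also have "\<dots> \<le> 2 * ?b"
  proof (intro mult_right_mono)
    have "card ?T \<le> card {nat \<lfloor>u\<rfloor>, nat \<lfloor>v\<rfloor>}" by (intro card_mono) auto
    also have "\<dots> \<le> 2" by (simp add: card_insert_if)
    finally show "real (card ?T) \<le> 2" by simp
  qed simp
  finally show ?thesis .
qed

lemma sum_geometric_le:
  fixes w :: real
  assumes "0 \<le> w" "w < 1"
  shows "(\<Sum>i<n. w ^ i) \<le> 1 / (1 - w)"
  using sum_le_suminf[OF summable_geometric[of w], of "{..<n}"] suminf_geometric[of w] assms by simp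

context
  fixes x :: "nat \<Rightarrow> nat \<Rightarrow> 'e::banach"
  assumes x1: "\<And>j k. norm (x j k) \<le> 1"
begin

lemma wavelet_level_diff_le:
  "norm (wavelet_level x j t - wavelet_level x j s) \<le> min 8 (32 * (4 ^ j * \<bar>t - s\<bar>))"
proof -
  have "norm (wavelet_level x j t - wavelet_level x j s)
    = norm (\<Sum>k<4 ^ j. (wavelet (4 ^ j * t - real k) - wavelet (4 ^ j * s - real k)) *\<^sub>R x j k)"
    unfolding wavelet_level_def by (simp add: sum_subtractf scaleR_diff_left)
  also have "\<dots> \<le> (\<Sum>k<4 ^ j. \<bar>wavelet (4 ^ j * t - real k) - wavelet (4 ^ j * s - real k)\<bar>)"
    using x1 by (intro order_trans[OF norm_sum] sum_mono) (auto simp: mult_left_le)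
  also have "\<dots> \<le> 2 * min 4 (16 * \<bar>4 ^ j * t - 4 ^ j * s\<bar>)"
    by (rule sum_wavelet_diff_le)
  also have "\<bar>4 ^ j * t - 4 ^ j * s\<bar> = 4 ^ j * \<bar>t - s\<bar>"
    by (simp add: right_diff_distrib[symmetric] abs_mult)
  finally show ?thesis by (simp add: min_mult_distrib_left)
qed

lemma wavelet_level_0: "wavelet_level x j 0 = 0"
  unfolding wavelet_level_def by (simp add: wavelet_eq_0)

lemma norm_wavelet_level_le: "norm (wavelet_level x j t) \<le> 8"
  using wavelet_level_diff_le[of j t 0] wavelet_level_0[of j] by simp

lemma wavelet_series_grid:
  "wavelet_series \<alpha> x (real i / 4 ^ J) = (\<Sum>j<J. (4 powr - \<alpha>) ^ j *\<^sub>R wavelet_level x j (real i / 4 ^ J))"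
  unfolding wavelet_series_def
proof (rule suminf_finite)
  fix j assume "j \<notin> {..<J}"
  then have j: "j = J + (j - J)" by simp
  have "(4::real) ^ j * (real i / 4 ^ J) - real k = of_int (4 ^ (j - J) * int i - int k)" for k
    by (subst j) (simp add: power_add)
  then have "wavelet (4 ^ j * (real i / 4 ^ J) - real k) = 0" for k
    by (simp only: wavelet_of_int Ints_of_int)
  then show "(4 powr - \<alpha>) ^ j *\<^sub>R wavelet_level x j (real i / 4 ^ J) = 0"
    by (simp add: wavelet_level_def)
qed simp

text \<open>Levels coarser than the scale of \<open>h = t - s\<close> are controlled by the
  Lipschitz bound, the others by the supremum. Both parts decay geometrically away from the critical
  level \<open>m\<close>, whose coefficient \<open>w ^ m\<close> is bounded by a multiple of
  \<open>h powr \<alpha>\<close>.\<close>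

lemma wavelet_series_holder:
  assumes \<alpha>: "0 < \<alpha>" "\<alpha> \<le> 1/2"
  obtains C where "0 \<le> C" "\<And>s t. 0 \<le> s \<Longrightarrow> s \<le> t \<Longrightarrow> t \<le> 1 \<Longrightarrow>
    norm (wavelet_series \<alpha> x t - wavelet_series \<alpha> x s) \<le> C * (t - s) powr \<alpha>"
proof -
  define w where "w = (4::real) powr - \<alpha>"
  have w: "0 < w" "w < 1" unfolding w_def using \<alpha> by (auto simp: powr_less_one)
  have "(4::real) powr - 1 \<le> 4 powr - (2 * \<alpha>)" using \<alpha> by (intro powr_mono) auto
  also have "\<dots> = w\<^sup>2" unfolding w_def by (simp add: power2_eq_square powr_add[symmetric])
  \<comment> \<open>Here \<open>\<alpha> \<le> 1/2\<close> enters: the Lipschitz gain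
    \<open>1/4\<close> per level is at most \<open>w\<^sup>2\<close>, of which one factor
    \<open>w\<close> compensates the larger coefficient of the coarser level and the other gives the
    decay.\<close>
  finally have w2: "1 / 4 \<le> w\<^sup>2" by (simp add: powr_minus_divide)
  \<comment> \<open>32 comes from the bound on one level, \<open>2 / (1 - w)\<close> from two
    geometric sums, and \<open>4 powr \<alpha>\<close> from knowing only
    \<open>h > 1 / 4 ^ Suc m\<close>.\<close>
  define C where "C = 64 / (1 - w) * 4 powr \<alpha>"
  have sumf: "summable (\<lambda>j. w ^ j *\<^sub>R wavelet_level x j t)" for t
  proof (rule summable_comparison_test')
    show "summable (\<lambda>j. w ^ j * 8)" using w by (intro summable_mult2 summable_geometric) simp
    show "norm (w ^ j *\<^sub>R wavelet_level x j t) \<le> w ^ j * 8" for j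
      using w norm_wavelet_level_le[of j t] by (simp add: mult_left_mono)
  qed
  show thesis
  proof (rule that[of C])
    show "0 \<le> C" unfolding C_def using w by simp
    fix s t :: real assume st: "0 \<le> s" "s \<le> t" "t \<le> 1"
    show "norm (wavelet_series \<alpha> x t - wavelet_series \<alpha> x s) \<le> C * (t - s) powr \<alpha>"
    proof (cases "s = t")
      case False
      define h where "h = t - s"
      have h: "0 < h" "h \<le> 1" using st False by (auto simp: h_def)
      have "\<exists>m. inverse (4 ^ m) < h" using real_arch_pow_inv[of h "1/4"] h by (auto simp: power_one_over inverse_eq_divide)
      then obtain m' where m': "1 / 4 ^ m' < h" "\<And>i. i < m' \<Longrightarrow> \<not> 1 / 4 ^ i < h"
        using exists_least_iff[of "\<lambda>m. 1 / 4 ^ m < h"] by (auto simp: inverse_eq_divide)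
      have "m' \<noteq> 0" using m'(1) h by (cases m') auto
      then obtain m where m: "m' = Suc m" by (cases m') auto
      have h1: "1 / 4 ^ Suc m < h" "h \<le> 1 / 4 ^ m" using m'(1) m'(2)[of m] unfolding m by auto
      let ?e = "\<lambda>j. if j < m then w ^ (m - j) else w ^ (j - m)"
      have termwise: "norm (w ^ j *\<^sub>R (wavelet_level x j t - wavelet_level x j s))
        \<le> 32 * w ^ m * ?e j" for j
      proof -
        have b: "norm (wavelet_level x j t - wavelet_level x j s) \<le> min 8 (32 * (4 ^ j * h))"
          using wavelet_level_diff_le[of j t s] st by (simp add: h_def)
        have "w ^ j * min 8 (32 * (4 ^ j * h)) \<le> 32 * w ^ m * ?e j"
        proof (cases "j < m")
          case True
          define d where "d = m - j"
          have d: "m = j + d" unfolding d_def using True by simp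
          have "4 ^ j * h \<le> 4 ^ j * (1 / 4 ^ m)" using h1 by (intro mult_left_mono) auto
          also have "\<dots> = (1/4) ^ d" unfolding d by (simp add: power_add power_one_over)
          also have "\<dots> \<le> (w\<^sup>2) ^ d" using w2 by (intro power_mono) auto
          also have "\<dots> = w ^ d * w ^ d" by (simp add: power_mult[symmetric] power_add[symmetric] mult_2)
          finally have "min 8 (32 * (4 ^ j * h)) \<le> 32 * (w ^ d * w ^ d)" by (simp add: min_le_iff_disj)
          then have "w ^ j * min 8 (32 * (4 ^ j * h)) \<le> w ^ j * (32 * (w ^ d * w ^ d))"
            using w by (intro mult_left_mono) auto
          then show ?thesis using True unfolding d by (simp add: power_add mult_ac)
        next
          case False
          have "w ^ j * min 8 (32 * (4 ^ j * h)) \<le> w ^ j * 32" using w by (intro mult_left_mono) auto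
          also have "\<dots> = 32 * w ^ m * w ^ (j - m)" using False by (simp add: power_add[symmetric])
          finally show ?thesis using False by simp
        qed
        moreover have "norm (w ^ j *\<^sub>R (wavelet_level x j t - wavelet_level x j s)) \<le> w ^ j * min 8 (32 * (4 ^ j * h))"
          using w unfolding norm_scaleR by (intro mult_mono b) auto
        ultimately show ?thesis by (rule order_trans[rotated])
      qed
      have part: "(\<Sum>j<n. ?e j) \<le> 2 / (1 - w)" for n
      proof -
        have "(\<Sum>j<n. ?e j) \<le> (\<Sum>j<m + n. ?e j)"
          using w by (intro sum_mono2) auto
        also have "\<dots> = (\<Sum>j<m. ?e j) + (\<Sum>i<n. ?e (m + i))"
          by (rule sum_lessThan_add)
        also have "(\<Sum>j<m. ?e j) = (\<Sum>j<m. w ^ (m - j))" by (intro sum.cong) auto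
        also have "(\<Sum>i<n. ?e (m + i)) = (\<Sum>i<n. w ^ i)" by (intro sum.cong) auto
        also have "(\<Sum>j<m. w ^ (m - j)) \<le> (\<Sum>j<m. w ^ (m - Suc j))"
          using w by (intro sum_mono power_decreasing) auto
        also have "\<dots> = (\<Sum>j<m. w ^ j)" by (rule sum.nat_diff_reindex)
        also have "\<dots> \<le> 1 / (1 - w)" using w by (intro sum_geometric_le) auto
        finally show ?thesis using sum_geometric_le[of w n] w by simp
      qed
      have "wavelet_series \<alpha> x t - wavelet_series \<alpha> x s = (\<Sum>j. w ^ j *\<^sub>R (wavelet_level x j t - wavelet_level x j s))"
        unfolding wavelet_series_def w_def[symmetric] by (simp add: suminf_diff[OF sumf sumf] scaleR_diff_right)
      moreover have "(\<lambda>n. \<Sum>j<n. w ^ j *\<^sub>R (wavelet_level x j t - wavelet_level x j s))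
          \<longlonglongrightarrow> (\<Sum>j. w ^ j *\<^sub>R (wavelet_level x j t - wavelet_level x j s))"
        using summable_diff[OF sumf sumf, of t s] by (intro summable_LIMSEQ) (simp add: scaleR_diff_right)
      moreover have "norm (\<Sum>j<n. w ^ j *\<^sub>R (wavelet_level x j t - wavelet_level x j s)) \<le> 64 / (1 - w) * w ^ m" for n
      proof -
        have "norm (\<Sum>j<n. w ^ j *\<^sub>R (wavelet_level x j t - wavelet_level x j s))
          \<le> (\<Sum>j<n. 32 * w ^ m * ?e j)"
          by (intro order_trans[OF norm_sum] sum_mono termwise)
        also have "\<dots> = 32 * w ^ m * (\<Sum>j<n. ?e j)"
          by (simp only: sum_distrib_left)
        also have "\<dots> \<le> 32 * w ^ m * (2 / (1 - w))"
          using w by (intro mult_left_mono part) auto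
        finally show ?thesis by simp
      qed
      ultimately have "norm (wavelet_series \<alpha> x t - wavelet_series \<alpha> x s) \<le> 64 / (1 - w) * w ^ m"
        by (intro Lim_norm_ubound[of sequentially]) auto
      also have "\<dots> \<le> 64 / (1 - w) * (4 powr \<alpha> * h powr \<alpha>)"
      proof (intro mult_left_mono)
        have "w ^ m = (1 / 4 ^ m) powr \<alpha>"
          unfolding w_def by (simp add: powr_realpow[symmetric] powr_powr powr_divide powr_minus_divide[symmetric] mult.commute)
        also have "\<dots> \<le> (4 * h) powr \<alpha>" using h1 \<alpha> by (intro powr_mono2) (auto simp: field_simps)
        finally show "w ^ m \<le> 4 powr \<alpha> * h powr \<alpha>" using h by (simp add: powr_mult)
      qed (use w in auto)
      finally show ?thesis unfolding C_def h_def by simp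
    qed simp
  qed
qed

lemma wavelet_series_0: "wavelet_series \<alpha> x 0 = 0"
  by (simp add: wavelet_series_def wavelet_level_0)

lemma wavelet_series_in_holder_space:
  assumes \<alpha>: "0 < \<alpha>" "\<alpha> \<le> 1/2"
  shows "wavelet_series \<alpha> x \<in> holder_space \<alpha>"
proof -
  obtain C where C: "0 \<le> C" "\<And>s t. 0 \<le> s \<Longrightarrow> s \<le> t \<Longrightarrow> t \<le> 1 \<Longrightarrow>
    norm (wavelet_series \<alpha> x t - wavelet_series \<alpha> x s) \<le> C * (t - s) powr \<alpha>"
    using wavelet_series_holder[OF \<alpha>] by blast
  have "norm (wavelet_series \<alpha> x t) \<le> C" if "t \<in> {0..1}" for t
  proof -
    have "norm (wavelet_series \<alpha> x t) \<le> C * t powr \<alpha>"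
      using C(2)[of 0 t] that wavelet_series_0[of \<alpha>] by simp
    also have "\<dots> \<le> C * 1" using that \<alpha> C(1) by (intro mult_left_mono powr_le1) auto
    finally show ?thesis by simp
  qed
  then show ?thesis unfolding holder_space_def using C(2) by (auto intro!: exI[of _ C])
qed

end

section \<open>The gliding hump\<close>

definition dyads :: "nat \<Rightarrow> (nat \<times> nat) set" where
  "dyads J = (SIGMA j:{..<J}. {..<4 ^ j})"

lemma finite_dyads [simp]: "finite (dyads J)"
  by (simp add: dyads_def)

text \<open>One \<open>R\<close> must serve all \<open>J\<close> and all families in the unit ball.
  The probability \<open>1/8\<close> is small enough for the tail to improve itself in
  \<open>rsum_levels_tail\<close>.\<close>

definition dyadic_bound :: "'e::real_normed_vector itself \<Rightarrow> real \<Rightarrow> real \<Rightarrow> bool" where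
  "dyadic_bound _ b R \<longleftrightarrow> (\<forall>J (x :: nat \<Rightarrow> nat \<Rightarrow> 'e). (\<forall>j k. norm (x j k) \<le> 1) \<longrightarrow>
     rsum (dyads J) (\<lambda>(j, k). b ^ j *\<^sub>R x j k) (\<lambda>u. of_bool (norm u > R)) \<le> 1/8)"

lemma dyads_mono: "J \<le> J' \<Longrightarrow> dyads J \<subseteq> dyads J'"
  by (auto simp: dyads_def)

text \<open>Discretisation at the points \<open>i / 4 ^ J\<close>: there the levels from \<open>J\<close> on vanish, so this is a finite sum of
  independent Gaussians with the coefficients \<open>x j k\<close>.\<close>

definition riemann_sum :: "(real \<Rightarrow> 'a \<Rightarrow> real) \<Rightarrow> (real \<Rightarrow> 'e::real_normed_vector) \<Rightarrow> nat \<Rightarrow> 'a \<Rightarrow> 'e" where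
  "riemann_sum W f J \<omega> = (\<Sum>i<4 ^ J. (W (real (Suc i) / 4 ^ J) \<omega> - W (real i / 4 ^ J) \<omega>) *\<^sub>R f (real i / 4 ^ J))"

text \<open>On the grid the Riemann sum is a combination of the \<open>y \<kappa>\<close> with
  independent normal coefficients of standard deviation at least \<open>b ^ j / 2\<close>, hence of
  median modulus at least \<open>c / 2 * b ^ j\<close>; this fits \<open>rsum_le_integral\<close>
  with \<open>t = c * s / 4\<close>.\<close>

lemma rsum_le_riemann_sum:
  fixes x :: "nat \<Rightarrow> nat \<Rightarrow> 'e::banach"
  assumes bm: "brownian_motion M W" and p: "0 < p" "\<alpha> = 1/p - 1/2"
    and c: "0 < c" "measure std_normal_distribution {x. c \<le> \<bar>x\<bar>} = 1/2"
    and x1: "\<And>j k. norm (x j k) \<le> 1"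
    and q: "real_seminorm q" "\<And>v. q v \<le> norm v" and s: "0 \<le> s"
  shows "rsum (dyads J) (\<lambda>(j, k). (4 powr - (1/p)) ^ j *\<^sub>R x j k) (\<lambda>u. of_bool (q u > s))
    \<le> 4 * measure M {\<omega>\<in>space M. c * s / 4 < q (riemann_sum W (wavelet_series \<alpha> x) J \<omega>)}"
proof -
  interpret M: prob_space M by (rule brownian_motion_prob_space[OF bm])
  note [measurable] = brownian_motion_measurable[OF bm]
  define N :: nat where "N = 4 ^ J"
  have N: "0 < N" "real N = 4 ^ J" unfolding N_def by auto
  define w where "w = (4::real) powr - \<alpha>"
  define b where "b = (4::real) powr - (1/p)"
  have w0: "0 < w" and b0: "0 < b" by (auto simp: w_def b_def)
  \<comment> \<open>A dilate of level \<open>j\<close> lives on a cell of length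
    \<open>1 / 4 ^ j\<close>, so its root mean square carries an extra \<open>(1/2) ^ j\<close>;
    with the coefficient \<open>w ^ j\<close> this makes \<open>b ^ j\<close>.\<close>
  have "b = 4 powr - \<alpha> * 4 powr - (1/2)" unfolding b_def p by (simp add: powr_add[symmetric])
  also have "(4::real) powr - (1/2) = 1/2" by (simp add: powr_minus_divide powr_half_sqrt)
  finally have bw: "b = w / 2" unfolding w_def by simp
  define u where "u \<kappa> i = (case \<kappa> of (j, k) \<Rightarrow> w ^ j * wavelet (4 ^ j * (real i / 4 ^ J) - real k))" for \<kappa> :: "nat \<times> nat" and i :: nat
  define y where "y \<kappa> = (case \<kappa> of (j, k) \<Rightarrow> x j k)" for \<kappa> :: "nat \<times> nat"
  \<comment> \<open>The value 1 off the index set keeps every law of the family a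
    probability.\<close>
  define \<sigma> where "\<sigma> \<kappa> = (if \<kappa> \<in> dyads J then sqrt ((\<Sum>i<N. (u \<kappa> i)\<^sup>2) / real N) else 1)" for \<kappa>
  have \<sigma>ge: "b ^ j / 2 \<le> sqrt ((\<Sum>i<N. (u (j, k) i)\<^sup>2) / real N)" if "(j, k) \<in> dyads J" for j k
  proof -
    have jk: "j < J" "k < 4 ^ j" using that by (auto simp: dyads_def)
    have "(b ^ j / 2)\<^sup>2 = (w ^ j)\<^sup>2 * ((1/4) ^ j / 4)"
      unfolding bw by (simp add: power_divide power2_eq_square power_mult_distrib[symmetric])
    also have "(1/4) ^ j / 4 = (4 ^ (J - j) / 4) / (real N)"
      unfolding N using jk by (simp add: power_one_over power_diff)
    also have "(w ^ j)\<^sup>2 * \<dots> \<le> (w ^ j)\<^sup>2 * ((\<Sum>i<4 ^ J. (wavelet (4 ^ j * (real i / 4 ^ J) - real k))\<^sup>2) / real N)"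
      using N by (intro mult_left_mono divide_right_mono wavelet_grid_norm[OF jk]) auto
    also have "\<dots> = (\<Sum>i<N. (u (j, k) i)\<^sup>2) / real N"
      unfolding u_def N_def by (simp add: power_mult_distrib sum_distrib_left[symmetric])
    finally show ?thesis by (rule real_le_rsqrt)
  qed
  have \<sigma>: "0 < \<sigma> \<kappa>" for \<kappa>
  proof (cases "\<kappa> \<in> dyads J")
    case True
    obtain j k where jk: "\<kappa> = (j, k)" by (cases \<kappa>)
    have "0 < b ^ j / 2" using b0 by simp
    also have "\<dots> \<le> \<sigma> \<kappa>" using \<sigma>ge True unfolding \<sigma>_def jk by simp
    finally show ?thesis .
  qed (simp add: \<sigma>_def)
  have \<sigma>u: "(\<sigma> \<kappa>)\<^sup>2 = (\<Sum>i<N. (u \<kappa> i)\<^sup>2) / real N" if "\<kappa> \<in> dyads J" for \<kappa>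
    using that unfolding \<sigma>_def by (simp add: sum_nonneg)
  have ort: "(\<Sum>i<N. u \<kappa> i * u \<kappa>' i) = 0" if \<kappa>: "\<kappa> \<in> dyads J" "\<kappa>' \<in> dyads J" "\<kappa> \<noteq> \<kappa>'" for \<kappa> \<kappa>'
  proof -
    obtain j k j' k' where jk: "\<kappa> = (j, k)" "\<kappa>' = (j', k')" by (cases \<kappa>, cases \<kappa>')
    have "(\<Sum>i<N. u \<kappa> i * u \<kappa>' i)
      = (w ^ j * w ^ j') * (\<Sum>i<4 ^ J. wavelet (4 ^ j * (real i / 4 ^ J) - real k) * wavelet (4 ^ j' * (real i / 4 ^ J) - real k'))"
      unfolding u_def jk N_def sum_distrib_left by (intro sum.cong) auto
    also have "\<dots> = 0"
      using \<kappa> unfolding jk by (subst wavelet_grid_orthogonal) (auto simp: dyads_def)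
    finally show ?thesis .
  qed
  define g where "g \<kappa> \<omega> = (\<Sum>i<N. u \<kappa> i * (W (real (Suc i) / real N) \<omega> - W (real i / real N) \<omega>))" for \<kappa> \<omega>
  let ?\<nu> = "\<lambda>\<kappa>. normal_law (\<sigma> \<kappa>)"
  let ?P = "PiM (dyads J) ?\<nu>"
  let ?G = "\<lambda>\<omega>. \<lambda>\<kappa>\<in>dyads J. g \<kappa> \<omega>"
  let ?Q = "{z \<in> space ?P. q (\<Sum>\<kappa>\<in>dyads J. z \<kappa> *\<^sub>R y \<kappa>) > c * s / 4}"
  have law: "distr M (?P) ?G = ?P"
    unfolding g_def by (rule brownian_orthogonal_distr[OF bm N(1) finite_dyads ort \<sigma> \<sigma>u])
  interpret L: real_distribution "?\<nu> \<kappa>" for \<kappa> by (rule real_distribution_normal_law[OF \<sigma>])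
  interpret S: sym_laws ?\<nu> "dyads J"
  proof
    show "distr (?\<nu> \<kappa>) borel uminus = ?\<nu> \<kappa>" for \<kappa>
      by (rule distr_uminus_if_char_even[OF real_distribution_normal_law[OF \<sigma>]]) (simp add: char_normal_law[OF \<sigma>])
  qed auto
  have [measurable]: "g \<kappa> \<in> borel_measurable M" for \<kappa> unfolding g_def by measurable
  have mg: "?G \<in> M \<rightarrow>\<^sub>M ?P"
    by (intro measurable_restrict) (simp cong: measurable_cong_sets)
  have mq: "(\<lambda>z. q (\<Sum>\<kappa>\<in>dyads J. z \<kappa> *\<^sub>R y \<kappa>)) \<in> borel_measurable (?P)"
    by (intro measurable_compose[OF borel_measurable_sum_scaleR_const borel_measurable_real_seminorm[OF q]]) simp
  have sum_eq: "(\<Sum>\<kappa>\<in>dyads J. g \<kappa> \<omega> *\<^sub>R y \<kappa>) = riemann_sum W (wavelet_series \<alpha> x) J \<omega>" for \<omega>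
  proof -
    have f: "wavelet_series \<alpha> x (real i / 4 ^ J) = (\<Sum>\<kappa>\<in>dyads J. u \<kappa> i *\<^sub>R y \<kappa>)" for i
      unfolding wavelet_series_grid[of x, OF x1] wavelet_level_def dyads_def u_def y_def w_def
      by (simp add: scaleR_sum_right sum.Sigma split_def)
    have "(\<Sum>\<kappa>\<in>dyads J. g \<kappa> \<omega> *\<^sub>R y \<kappa>)
      = (\<Sum>\<kappa>\<in>dyads J. \<Sum>i<N. (u \<kappa> i * (W (real (Suc i) / real N) \<omega> - W (real i / real N) \<omega>)) *\<^sub>R y \<kappa>)"
      unfolding g_def by (simp add: scaleR_sum_left)
    also have "\<dots> = (\<Sum>i<N. \<Sum>\<kappa>\<in>dyads J. (u \<kappa> i * (W (real (Suc i) / real N) \<omega> - W (real i / real N) \<omega>)) *\<^sub>R y \<kappa>)"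
      by (rule sum.swap)
    also have "\<dots> = riemann_sum W (wavelet_series \<alpha> x) J \<omega>"
      unfolding riemann_sum_def f N N_def by (simp add: scaleR_sum_right mult.commute)
    finally show ?thesis .
  qed
  have "rsum (dyads J) (\<lambda>\<kappa>. (c / 2 * b ^ fst \<kappa>) *\<^sub>R y \<kappa>) (\<lambda>v. of_bool (q v > 2 * (c * s / 4)))
     \<le> 4 * measure (?P) ?Q"
  proof (rule S.rsum_le_integral[OF q, where c="\<lambda>\<kappa>. \<sigma> \<kappa> * c"])
    show "0 \<le> c * s / 4" using c s by simp
    show "measure (normal_law (\<sigma> \<kappa>)) {x. \<sigma> \<kappa> * c \<le> \<bar>x\<bar>} = 1/2" for \<kappa>
      by (rule median_normal_law[OF \<sigma> c(2)])
    show "0 < c / 2 * b ^ fst \<kappa> \<and> c / 2 * b ^ fst \<kappa> \<le> \<sigma> \<kappa> * c" if "\<kappa> \<in> dyads J" for \<kappa>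
    proof -
      obtain j k where jk: "\<kappa> = (j, k)" by (cases \<kappa>)
      have "b ^ j / 2 \<le> \<sigma> \<kappa>" using \<sigma>ge that unfolding \<sigma>_def jk by simp
      then have "b ^ j / 2 * c \<le> \<sigma> \<kappa> * c" using c(1) by (intro mult_right_mono) auto
      then show ?thesis using b0 c(1) by (simp add: jk mult.commute)
    qed
  qed
  also have "rsum (dyads J) (\<lambda>\<kappa>. (c / 2 * b ^ fst \<kappa>) *\<^sub>R y \<kappa>) (\<lambda>v. of_bool (q v > 2 * (c * s / 4)))
    = rsum (dyads J) (\<lambda>\<kappa>. b ^ fst \<kappa> *\<^sub>R y \<kappa>) (\<lambda>v. of_bool (q ((c / 2) *\<^sub>R v) > 2 * (c * s / 4)))"
    using rsum_scaleR[of "dyads J" "c / 2" "\<lambda>\<kappa>. b ^ fst \<kappa> *\<^sub>R y \<kappa>"] by simp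
  also have "(\<lambda>v. of_bool (q ((c / 2) *\<^sub>R v) > 2 * (c * s / 4)) :: real) = (\<lambda>v. of_bool (q v > s))"
    unfolding real_seminorm_scaleR[OF q(1)] using c(1) by (auto simp: fun_eq_iff)
  also have "measure (?P) ?Q
    = measure (distr M (?P) ?G)
        ?Q"
    by (simp only: law)
  also have "\<dots> = measure M (?G -`
      ?Q \<inter> space M)"
    by (intro measure_distr mg borel_measurable_less borel_measurable_const mq)
  also have "(?G -`
      ?Q \<inter> space M)
    = {\<omega>\<in>space M. c * s / 4 < q (riemann_sum W (wavelet_series \<alpha> x) J \<omega>)}"
    using measurable_space[OF mg] unfolding sum_eq[symmetric] by auto
  finally show ?thesis unfolding b_def y_def by (simp add: split_def)
qed

text \<open>The left endpoint step function differs from \<open>f\<close> by at most the Hoelder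
  modulus at mesh \<open>1 / 4 ^ J\<close>, uniformly, so \<open>wiener_integral_step_bound\<close>
  applies.\<close>

lemma riemann_sum_close:
  fixes x :: "nat \<Rightarrow> nat \<Rightarrow> 'e::banach" and \<phi> :: "'e \<Rightarrow>\<^sub>L real"
  assumes bm: "brownian_motion M W" and \<alpha>: "0 < \<alpha>"
    and C: "0 \<le> C" "\<And>s t. 0 \<le> s \<Longrightarrow> s \<le> t \<Longrightarrow> t \<le> 1 \<Longrightarrow> norm (f t - f s) \<le> C * (t - s) powr \<alpha>"
    and f0: "f 0 = (0::'e)"
    and wi: "wiener_integral M W (\<lambda>t. \<phi> (f t)) (\<lambda>\<omega>. \<phi> (Y \<omega>))"
    and L2: "L2_01 (\<lambda>t. \<phi> (f t))"
    and \<phi>: "\<And>v. \<bar>\<phi> v\<bar> \<le> norm v"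
  shows "(\<integral>\<^sup>+ \<omega>. ennreal ((\<phi> (Y \<omega>) - \<phi> (riemann_sum W f J \<omega>))\<^sup>2) \<partial>M)
    \<le> ennreal (4 * (C * (1 / 4 ^ J) powr \<alpha>)\<^sup>2)"
proof -
  let ?d = "\<lambda>i. \<phi> (f (real i / 4 ^ J))"
  have "(\<integral>\<^sup>+ \<omega>. ennreal ((\<phi> (Y \<omega>) - (\<Sum>i<4 ^ J. ?d i * (W (real (Suc i) / 4 ^ J) \<omega> - W (real i / 4 ^ J) \<omega>)))\<^sup>2) \<partial>M)
    \<le> ennreal (4 * (C * (1 / 4 ^ J) powr \<alpha>)\<^sup>2)"
  proof (rule wiener_integral_step_bound[OF bm wi])
    show "(\<lambda>t. \<phi> (f t)) \<in> borel_measurable (restrict_space lborel {0..1})"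
      using L2 by (simp add: L2_01_def)
    fix i :: nat assume "i < 4 ^ J"
    then have "real i < 4 ^ J" "real (Suc i) \<le> real (4 ^ J)" by (simp, intro of_nat_mono) simp
    then have "real (Suc i) \<le> 4 ^ J" by simp
    then show "0 \<le> real i / 4 ^ J \<and> real i / 4 ^ J \<le> real (Suc i) / 4 ^ J \<and> real (Suc i) / 4 ^ J \<le> 1"
      by (auto simp: divide_simps)
  next
    fix t :: real assume t: "t \<in> {0..1}"
    let ?s = "\<Sum>i<4 ^ J. ?d i * indicator {real i / 4 ^ J<..real (Suc i) / 4 ^ J} t"
    show "\<bar>\<phi> (f t) - ?s\<bar> \<le> C * (1 / 4 ^ J) powr \<alpha>"
    proof (cases "t = 0")
      \<comment> \<open>\<open>0\<close> lies in no left-open cell; the step function vanishes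
        there, and so does \<open>f\<close>.\<close>
      case True
      then have "?s = 0" by (intro sum.neutral) (auto simp: indicator_def divide_less_0_iff)
      then show ?thesis using True f0 C(1) by simp
    next
      case False
      \<comment> \<open>Cells are open on the left, so the cell of \<open>t\<close> has the ceiling
        minus 1 as its index.\<close>
      define n where "n = nat (\<lceil>t * 4 ^ J\<rceil> - 1)"
      have pos: "0 < t * 4 ^ J" "t * 4 ^ J \<le> 4 ^ J" using False t by auto
      then have c1: "1 \<le> \<lceil>t * 4 ^ J\<rceil>" by linarith
      have n: "real n = of_int \<lceil>t * 4 ^ J\<rceil> - 1" unfolding n_def using c1 by simp
      have nt: "real n < t * 4 ^ J" "t * 4 ^ J \<le> real (Suc n)" unfolding of_nat_Suc n by linarith+
      have "real n < 4 ^ J" using nt pos by linarith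
      then have nJ: "n < 4 ^ J" by simp
      have in_iff: "t \<in> {real i / 4 ^ J<..real (Suc i) / 4 ^ J} \<longleftrightarrow> i = n" for i
      proof
        assume "t \<in> {real i / 4 ^ J<..real (Suc i) / 4 ^ J}"
        then have "real i < t * 4 ^ J" "t * 4 ^ J \<le> real (Suc i)" by (auto simp: field_simps)
        then have "real i < real (Suc n)" "real n < real (Suc i)" using nt by linarith+
        then show "i = n" by simp
      qed (use nt in \<open>auto simp: field_simps\<close>)
      have "?s = (\<Sum>i<4 ^ J. if i = n then ?d i else 0)"
        by (intro sum.cong) (auto simp: in_iff indicator_def simp del: greaterThanAtMost_iff of_nat_Suc)
      also have "\<dots> = ?d n" using nJ by simp
      finally have s: "?s = ?d n" .
      have le: "real n / 4 ^ J \<le> t" "t - real n / 4 ^ J \<le> 1 / 4 ^ J"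
      proof -
        show "real n / 4 ^ J \<le> t" using nt by (simp add: pos_divide_le_eq)
        have "t \<le> (real n + 1) / 4 ^ J" using nt by (simp add: pos_le_divide_eq)
        then show "t - real n / 4 ^ J \<le> 1 / 4 ^ J" by (simp add: add_divide_distrib)
      qed
      have "\<bar>\<phi> (f t) - ?s\<bar> = \<bar>\<phi> (f t - f (real n / 4 ^ J))\<bar>"
        unfolding s by (simp add: blinfun.diff_right)
      also have "\<dots> \<le> norm (f t - f (real n / 4 ^ J))" by (rule \<phi>)
      also have "\<dots> \<le> C * (t - real n / 4 ^ J) powr \<alpha>" using le t by (intro C(2)) auto
      also have "\<dots> \<le> C * (1 / 4 ^ J) powr \<alpha>" using le \<alpha> C(1) by (intro mult_left_mono powr_mono2) auto
      finally show ?thesis .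
    qed
  qed
  moreover have "\<phi> (riemann_sum W f J \<omega>) = (\<Sum>i<4 ^ J. ?d i * (W (real (Suc i) / 4 ^ J) \<omega> - W (real i / 4 ^ J) \<omega>))" for \<omega>
    unfolding riemann_sum_def by (simp add: blinfun.sum_right blinfun.scaleR_right mult.commute)
  ultimately show ?thesis by simp
qed

section \<open>Concatenating bad families on successive blocks of levels\<close>

lemma rsum_norm_gt_eq_0:
  fixes z :: "'i \<Rightarrow> 'e::real_normed_vector"
  assumes "(\<Sum>i\<in>S. norm (z i)) \<le> B"
  shows "rsum S z (\<lambda>u. of_bool (norm u > B)) = 0"
proof -
  have "norm (\<Sum>i\<in>S. if i \<in> A then z i else - z i) \<le> B" for A
  proof -
    have "norm (\<Sum>i\<in>S. if i \<in> A then z i else - z i) \<le> (\<Sum>i\<in>S. norm (z i))"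
      by (intro order_trans[OF norm_sum] sum_mono) auto
    then show ?thesis using assms by simp
  qed
  then have "of_bool (norm (\<Sum>i\<in>S. if i \<in> A then z i else - z i) > B) = (0::real)" for A
    by (simp add: not_less)
  then show ?thesis unfolding rsum_def by simp
qed

text \<open>The part on \<open>S\<close> never exceeds \<open>B\<close>, whatever the signs, so
  dropping it only shifts the threshold.\<close>

lemma rsum_remove_bounded:
  fixes z :: "'i \<Rightarrow> 'e::real_normed_vector"
  assumes T: "finite T" and B: "(\<Sum>i\<in>T \<inter> S. norm (z i)) \<le> B"
  shows "rsum T z (\<lambda>u. of_bool (norm u > t + B)) \<le> rsum (T - S) z (\<lambda>u. of_bool (norm u > t))"
proof -
  have le: "of_bool (norm (v + w) > t + B) \<le> of_bool (norm v > B) + (of_bool (norm w > t) :: real)" for v w :: 'e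
    using norm_triangle_ineq[of v w] by (auto simp: of_bool_def)
  have "rsum T z (\<lambda>u. of_bool (norm u > t + B)) = rsum ((T \<inter> S) \<union> (T - S)) z (\<lambda>u. of_bool (norm u > t + B))"
    by (simp add: Int_Diff_Un)
  also have "\<dots> = rsum (T \<inter> S) z (\<lambda>v. rsum (T - S) z (\<lambda>w. of_bool (norm (v + w) > t + B)))"
    using T by (intro rsum_union) auto
  also have "\<dots> \<le> rsum (T \<inter> S) z (\<lambda>v. rsum (T - S) z (\<lambda>w. of_bool (norm v > B) + of_bool (norm w > t)))"
    by (intro rsum_mono le)
  also have "\<dots> = rsum (T \<inter> S) z (\<lambda>u. of_bool (norm u > B)) + rsum (T - S) z (\<lambda>u. of_bool (norm u > t))"
    using T by (simp add: rsum_add rsum_const)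
  finally show ?thesis using rsum_norm_gt_eq_0[OF B] by simp
qed

text \<open>Block \<open>n\<close> consists of the levels from \<open>L n\<close> to below
  \<open>L (Suc n)\<close> and copies a family that beats the threshold \<open>n + B (L n)\<close>.
  The first \<open>L n\<close> levels of that family have total norm at most \<open>B (L n)\<close>,
  so what remains still beats \<open>n\<close>.\<close>

lemma gliding_hump:
  fixes b :: real
  assumes b0: "0 < b"
    and unb: "\<nexists>R. dyadic_bound TYPE('e::real_normed_vector) b R"
  obtains x :: "nat \<Rightarrow> nat \<Rightarrow> 'e::real_normed_vector" where "\<And>j k. norm (x j k) \<le> 1"
    "\<And>n. \<exists>J D. D \<subseteq> dyads J \<and> rsum D (\<lambda>(j, k). b ^ j *\<^sub>R x j k) (\<lambda>u. of_bool (norm u > real n)) > 1/8"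
proof -
  obtain J X where X1: "\<And>R j k. norm (X R j k :: 'e) \<le> 1"
    and X: "\<And>R. rsum (dyads (J R)) (\<lambda>(j, k). b ^ j *\<^sub>R X R j k) (\<lambda>u. of_bool (norm u > R)) > 1/8"
    using unb unfolding dyadic_bound_def not_ex not_all not_imp not_le by metis
  define B where "B l = (\<Sum>\<kappa>\<in>dyads l. b ^ fst \<kappa>)" for l
  define L where "L = rec_nat (0::nat) (\<lambda>n l. max l (J (real n + B l)))"
  have L: "L (Suc n) = max (L n) (J (real n + B (L n)))" for n by (simp add: L_def)
  have "mono L" unfolding mono_iff_le_Suc L by simp
  \<comment> \<open>The \<open>LEAST\<close> finds the block to which level \<open>j\<close>
    belongs.\<close>
  define x where "x j k = X (real (LEAST n. j < L (Suc n)) + B (L (LEAST n. j < L (Suc n)))) j k" for j k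
  show thesis
  proof (rule that)
    show "norm (x j k) \<le> 1" for j k unfolding x_def by (rule X1)
    fix n
    define R where "R = real n + B (L n)"
    let ?T = "dyads (J R)" and ?S = "dyads (L n)"
    let ?Z = "\<lambda>(j, k). b ^ j *\<^sub>R X R j k"
    have "(\<Sum>\<kappa>\<in>?T \<inter> ?S. norm (?Z \<kappa>)) \<le> (\<Sum>\<kappa>\<in>?T \<inter> ?S. b ^ fst \<kappa>)"
      using b0 X1 by (intro sum_mono) (auto simp: mult_left_le)
    also have "\<dots> \<le> B (L n)" unfolding B_def using b0 by (intro sum_mono2) auto
    finally have "rsum ?T ?Z (\<lambda>u. of_bool (norm u > real n + B (L n))) \<le> rsum (?T - ?S) ?Z (\<lambda>u. of_bool (norm u > real n))"
      by (intro rsum_remove_bounded) auto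
    with X[of R] have "1/8 < rsum (?T - ?S) ?Z (\<lambda>u. of_bool (norm u > real n))" unfolding R_def by simp
    also have "rsum (?T - ?S) ?Z (\<lambda>u. of_bool (norm u > real n)) = rsum (?T - ?S) (\<lambda>(j, k). b ^ j *\<^sub>R x j k) (\<lambda>u. of_bool (norm u > real n))"
    proof (intro rsum_cong)
      fix \<kappa> assume \<kappa>: "\<kappa> \<in> ?T - ?S"
      obtain j k where jk: "\<kappa> = (j, k)" by (cases \<kappa>)
      have j: "j < J R" "L n \<le> j" using \<kappa> unfolding jk dyads_def by auto
      have "(LEAST m. j < L (Suc m)) = n"
      proof (rule Least_equality)
        show "j < L (Suc n)" using j(1) unfolding L R_def by simp
        fix m assume "j < L (Suc m)"
        then have "\<not> L (Suc m) \<le> L n" using j(2) by simp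
        then have "\<not> Suc m \<le> n" using monoD[OF \<open>mono L\<close>] by blast
        then show "n \<le> m" by simp
      qed
      then show "?Z \<kappa> = (case \<kappa> of (j, k) \<Rightarrow> b ^ j *\<^sub>R x j k)" unfolding jk x_def R_def by simp
    qed
    finally show "\<exists>J D. D \<subseteq> dyads J \<and> rsum D (\<lambda>(j, k). b ^ j *\<^sub>R x j k) (\<lambda>u. of_bool (norm u > real n)) > 1/8"
      by (intro exI[of _ "J R"] exI[of _ "?T - ?S"]) auto
  qed
qed

section \<open>From integrability to a uniform bound in probability\<close>

lemma real_seminorm_Max:
  fixes \<Phi> :: "('e::real_normed_vector \<Rightarrow>\<^sub>L real) set"
  assumes \<Phi>: "finite \<Phi>" "\<Phi> \<noteq> {}"
  shows "real_seminorm (\<lambda>v. Max ((\<lambda>\<phi>. \<bar>blinfun_apply \<phi> v\<bar>) ` \<Phi>))"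
  unfolding real_seminorm_def
proof (intro conjI allI)
  fix u v :: 'e and c :: real
  show "Max ((\<lambda>\<phi>. \<bar>blinfun_apply \<phi> (u + v)\<bar>) ` \<Phi>)
    \<le> Max ((\<lambda>\<phi>. \<bar>blinfun_apply \<phi> u\<bar>) ` \<Phi>) + Max ((\<lambda>\<phi>. \<bar>blinfun_apply \<phi> v\<bar>) ` \<Phi>)"
  proof (rule Max.boundedI)
    fix a assume "a \<in> (\<lambda>\<phi>. \<bar>blinfun_apply \<phi> (u + v)\<bar>) ` \<Phi>"
    then obtain \<phi> where \<phi>: "\<phi> \<in> \<Phi>" "a = \<bar>\<phi> (u + v)\<bar>" by auto
    have "a \<le> \<bar>\<phi> u\<bar> + \<bar>\<phi> v\<bar>" unfolding \<phi>(2) by (simp add: blinfun.add_right)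
    also have "\<dots> \<le> Max ((\<lambda>\<phi>. \<bar>blinfun_apply \<phi> u\<bar>) ` \<Phi>) + Max ((\<lambda>\<phi>. \<bar>blinfun_apply \<phi> v\<bar>) ` \<Phi>)"
      using \<Phi> \<phi>(1) by (intro add_mono Max_ge) auto
    finally show "a \<le> Max ((\<lambda>\<phi>. \<bar>blinfun_apply \<phi> u\<bar>) ` \<Phi>) + Max ((\<lambda>\<phi>. \<bar>blinfun_apply \<phi> v\<bar>) ` \<Phi>)" .
  qed (use \<Phi> in auto)
  have "mono ((*) \<bar>c\<bar>)" by (auto simp: mono_def mult_left_mono)
  then have "\<bar>c\<bar> * Max ((\<lambda>\<phi>. \<bar>blinfun_apply \<phi> v\<bar>) ` \<Phi>) = Max ((*) \<bar>c\<bar> ` (\<lambda>\<phi>. \<bar>blinfun_apply \<phi> v\<bar>) ` \<Phi>)"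
    using \<Phi> by (intro mono_Max_commute) auto
  then show "Max ((\<lambda>\<phi>. \<bar>blinfun_apply \<phi> (c *\<^sub>R v)\<bar>) ` \<Phi>) = \<bar>c\<bar> * Max ((\<lambda>\<phi>. \<bar>blinfun_apply \<phi> v\<bar>) ` \<Phi>)"
    by (simp add: image_image blinfun.scaleR_right abs_mult)
qed

lemma strongly_measurable_imp_borel:
  "strongly_measurable N f \<Longrightarrow> f \<in> borel_measurable N"
  unfolding strongly_measurable_def by (auto intro: borel_measurable_LIMSEQ_metric)

lemma (in prob_space) prob_norm_ge_small:
  assumes Y: "Y \<in> borel_measurable M" and "0 < \<delta>"
  obtains n :: nat where "0 < n" "prob {\<omega>\<in>space M. norm (Y \<omega> :: 'e::real_normed_vector) \<ge> real n} < \<delta>"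
proof -
  let ?A = "\<lambda>n::nat. {\<omega>\<in>space M. norm (Y \<omega>) \<ge> real n}"
  have [measurable]: "(\<lambda>\<omega>. norm (Y \<omega>)) \<in> borel_measurable M"
    using Y by (rule measurable_compose) simp
  have "(\<lambda>n. prob (?A n)) \<longlonglongrightarrow> prob (\<Inter>n. ?A n)"
    by (intro finite_Lim_measure_decseq) (auto simp: decseq_def)
  also have "(\<Inter>n. ?A n) = {}"
  proof -
    have "\<exists>n. \<not> norm (Y \<omega>) \<ge> real n" for \<omega> using reals_Archimedean2[of "norm (Y \<omega>)"] by (auto simp: not_le)
    then show ?thesis by auto
  qed
  finally have "(\<lambda>n. prob (?A n)) \<longlonglongrightarrow> 0" by simp
  then have "eventually (\<lambda>n. prob (?A n) < \<delta> \<and> 0 < n) sequentially"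
    using \<open>0 < \<delta>\<close> by (intro eventually_conj order_tendstoD(2)[of _ 0] eventually_gt_at_top) auto
  then show thesis using that by (auto simp: eventually_sequentially)
qed

lemma (in prob_space) prob_abs_ge_le:
  assumes [measurable]: "Z \<in> borel_measurable M" and "0 < a" "0 \<le> e"
    and le: "(\<integral>\<^sup>+ \<omega>. ennreal ((Z \<omega>)\<^sup>2) \<partial>M) \<le> ennreal e"
  shows "prob {\<omega>\<in>space M. \<bar>Z \<omega>\<bar> \<ge> a} \<le> e / a\<^sup>2"
proof -
  have "emeasure M {\<omega>\<in>space M. \<bar>Z \<omega>\<bar> \<ge> a} \<le> emeasure M {\<omega>\<in>space M. 1 \<le> ennreal (1 / a\<^sup>2) * ennreal ((Z \<omega>)\<^sup>2)}"
  proof (intro emeasure_mono subsetI)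
    fix \<omega> assume "\<omega> \<in> {\<omega>\<in>space M. \<bar>Z \<omega>\<bar> \<ge> a}"
    then have \<omega>: "\<omega> \<in> space M" "a \<le> \<bar>Z \<omega>\<bar>" by auto
    have "a\<^sup>2 \<le> (Z \<omega>)\<^sup>2" using power_mono[OF \<omega>(2), of 2] \<open>0 < a\<close> by simp
    then have "1 \<le> 1 / a\<^sup>2 * (Z \<omega>)\<^sup>2" using \<open>0 < a\<close> by simp
    then have "1 \<le> ennreal (1 / a\<^sup>2) * ennreal ((Z \<omega>)\<^sup>2)"
      by (metis ennreal_1 ennreal_leI ennreal_mult zero_le_divide_1_iff zero_le_power2)
    then show "\<omega> \<in> {\<omega>\<in>space M. 1 \<le> ennreal (1 / a\<^sup>2) * ennreal ((Z \<omega>)\<^sup>2)}" using \<omega> by simp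
  qed measurable
  also have "\<dots> \<le> ennreal (1 / a\<^sup>2) * (\<integral>\<^sup>+ \<omega>. ennreal ((Z \<omega>)\<^sup>2) * indicator (space M) \<omega> \<partial>M)"
    by (intro nn_integral_Markov_inequality) auto
  also have "(\<integral>\<^sup>+ \<omega>. ennreal ((Z \<omega>)\<^sup>2) * indicator (space M) \<omega> \<partial>M) = (\<integral>\<^sup>+ \<omega>. ennreal ((Z \<omega>)\<^sup>2) \<partial>M)"
    by (intro nn_integral_cong) auto
  also have "ennreal (1 / a\<^sup>2) * (\<integral>\<^sup>+ \<omega>. ennreal ((Z \<omega>)\<^sup>2) \<partial>M) \<le> ennreal (1 / a\<^sup>2) * ennreal e"
    by (intro mult_left_mono le) auto
  also have "\<dots> = ennreal (e / a\<^sup>2)" using assms by (simp add: ennreal_mult[symmetric])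
  finally show ?thesis using assms by (simp add: emeasure_eq_measure)
qed

text \<open>Otherwise the series \<open>f\<close> built from a gliding hump has an integral
  \<open>Y\<close>. With \<open>D\<close> and its functionals fixed, the probability that
  \<open>q\<close> of the Riemann sum exceeds \<open>\<tau>\<close> has an upper bound tending to
  \<open>1/128\<close> as the grid is refined, while \<open>rsum_le_riemann_sum\<close> keeps it at
  least \<open>1/64\<close> on all grids finer than \<open>J\<close>.\<close>

lemma rademacher_bound:
  fixes M :: "'a measure" and W :: "real \<Rightarrow> 'a \<Rightarrow> real" and \<alpha> p :: real
  assumes bm: "brownian_motion M W"
    and \<alpha>: "0 < \<alpha>" "\<alpha> \<le> 1/2" and p: "0 < p" "\<alpha> = 1/p - 1/2"
    and int: "\<forall>\<phi>::real \<Rightarrow> 'e::banach. \<phi> \<in> holder_space \<alpha> \<longrightarrow> stoch_integrable M W \<phi>"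
  shows "\<exists>R. dyadic_bound TYPE('e) (4 powr - (1/p)) R"
proof (rule ccontr)
  interpret prob_space M by (rule brownian_motion_prob_space[OF bm])
  note [measurable] = brownian_motion_measurable[OF bm]
  define b where "b = (4::real) powr - (1/p)"
  assume "\<not> ?thesis"
  then have unb: "\<nexists>R. dyadic_bound TYPE('e) b R" unfolding b_def .
  have b0: "0 < b" by (simp add: b_def)
  obtain x :: "nat \<Rightarrow> nat \<Rightarrow> 'e" where x1: "\<And>j k. norm (x j k) \<le> 1"
    and hump: "\<And>n. \<exists>J D. D \<subseteq> dyads J \<and> rsum D (\<lambda>(j, k). b ^ j *\<^sub>R x j k) (\<lambda>u. of_bool (norm u > real n)) > 1/8"
  proof (rule gliding_hump[OF b0 unb])
    fix x :: "nat \<Rightarrow> nat \<Rightarrow> 'e"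
    assume "\<And>j k. norm (x j k) \<le> 1"
      and "\<And>n. \<exists>J D. D \<subseteq> dyads J \<and> rsum D (\<lambda>(j, k). b ^ j *\<^sub>R x j k) (\<lambda>u. of_bool (norm u > real n)) > 1/8"
    then show thesis by (rule that)
  qed
  define f where "f = wavelet_series \<alpha> x"
  define z where "z \<kappa> = (case \<kappa> of (j, k) \<Rightarrow> b ^ j *\<^sub>R x j k)" for \<kappa>
  obtain C where C: "0 \<le> C" "\<And>s t. 0 \<le> s \<Longrightarrow> s \<le> t \<Longrightarrow> t \<le> 1 \<Longrightarrow> norm (f t - f s) \<le> C * (t - s) powr \<alpha>"
    using wavelet_series_holder[of x, OF x1 \<alpha>] unfolding f_def by blast
  have f0: "f 0 = 0" unfolding f_def by (rule wavelet_series_0[of x, OF x1])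
  have "f \<in> holder_space \<alpha>" unfolding f_def by (rule wavelet_series_in_holder_space[of x, OF x1 \<alpha>])
  then have "stoch_integrable M W f" using int by blast
  then obtain Y where Y: "strongly_measurable M Y"
    and L2: "\<And>\<phi>::'e \<Rightarrow>\<^sub>L real. L2_01 (\<lambda>t. \<phi> (f t))"
    and wi: "\<And>\<phi>::'e \<Rightarrow>\<^sub>L real. wiener_integral M W (\<lambda>t. \<phi> (f t)) (\<lambda>\<omega>. \<phi> (Y \<omega>))"
    unfolding stoch_integrable_def by blast
  have Ym[measurable]: "Y \<in> borel_measurable M" by (rule strongly_measurable_imp_borel[OF Y])
  obtain c where c: "0 < c" "measure std_normal_distribution {x. c \<le> \<bar>x\<bar>} = 1/2"
    using median_std_normal by blast
  \<comment> \<open>\<open>1/128\<close> is to lie below \<open>1/64\<close>, which is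
    \<open>1/8\<close> divided by 2 for passing from \<open>D\<close> to all dyads and by 4 for
    passing to Gaussians.\<close>
  obtain n0 where n0: "0 < n0" "prob {\<omega>\<in>space M. norm (Y \<omega>) \<ge> real n0} < 1/128"
    using prob_norm_ge_small[OF Ym, of "1/128"] by auto
  \<comment> \<open>Makes \<open>\<tau>\<close> at least \<open>2 * n0\<close>: if \<open>q\<close>
    of the Riemann sum exceeds \<open>\<tau>\<close>, then \<open>Y\<close> has norm at least
    \<open>n0\<close> or some functional errs by at least \<open>\<tau> / 2\<close>.\<close>
  obtain n :: nat where n: "8 * real n0 / c \<le> real n" using real_arch_simple by blast
  define \<tau> where "\<tau> = c * real n / 4"
  have \<tau>: "2 * real n0 \<le> \<tau>" using n c(1) unfolding \<tau>_def by (simp add: field_simps)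
  have \<tau>0: "0 < \<tau>" using \<tau> n0(1) by linarith
  obtain J D where D: "D \<subseteq> dyads J" and big: "rsum D z (\<lambda>u. of_bool (norm u > real n)) > 1/8"
    using hump[of n] unfolding z_def by blast
  have finD: "finite D" by (rule finite_subset[OF D finite_dyads])
  define v where "v A = (\<Sum>i\<in>D. if i \<in> A then z i else - z i)" for A
  have "\<exists>\<phi>::'e \<Rightarrow>\<^sub>L real. (\<forall>u. \<bar>\<phi> u\<bar> \<le> norm u) \<and> \<phi> (v A) = norm (v A)" for A
    using norming_functional[of "v A"] by blast
  then obtain \<Phi> where \<Phi>1: "\<And>A u. \<bar>blinfun_apply (\<Phi> A) u\<bar> \<le> norm (u::'e)"
    and \<Phi>2: "\<And>A. blinfun_apply (\<Phi> A) (v A) = norm (v A)"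
    by metis
  let ?F = "\<Phi> ` Pow D"
  have F: "finite ?F" "?F \<noteq> {}" using finD by auto
  define q where "q u = Max ((\<lambda>\<phi>. \<bar>blinfun_apply \<phi> u\<bar>) ` ?F)" for u
  have q: "real_seminorm q" unfolding q_def by (rule real_seminorm_Max[OF F])
  have qn: "q u \<le> norm u" for u unfolding q_def using F \<Phi>1 by (intro Max.boundedI) auto
  have qv: "q (v A) = norm (v A)" if "A \<in> Pow D" for A
  proof (rule antisym[OF qn])
    have "norm (v A) = \<bar>(\<Phi> A) (v A)\<bar>" by (simp add: \<Phi>2)
    also have "\<dots> \<le> q (v A)" unfolding q_def using F that by (intro Max_ge) auto
    finally show "norm (v A) \<le> q (v A)" .
  qed
  \<comment> \<open>\<open>q\<close> agrees with the norm on every signed sum \<open>v A\<close>, so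
    the average over the signs on \<open>D\<close> is the same for both.\<close>
  have "rsum D z (\<lambda>u. of_bool (norm u > real n)) = rsum D z (\<lambda>u. of_bool (q u > real n))"
    unfolding rsum_def v_def[symmetric] using qv by (intro arg_cong2[where f="(/)"] sum.cong) auto
  with big have bigq: "1/8 < rsum D z (\<lambda>u. of_bool (q u > real n))" by simp
  let ?S = "\<lambda>J'. riemann_sum W f J'"
  have mS[measurable]: "?S J' \<in> borel_measurable M" for J'
    unfolding riemann_sum_def by (intro borel_measurable_sum_scaleR_const) measurable
  have mapp[measurable]: "(\<lambda>\<omega>. \<phi> (G \<omega>)) \<in> borel_measurable M" if "G \<in> borel_measurable M" for \<phi> :: "'e \<Rightarrow>\<^sub>L real" and G
    using that by (rule measurable_compose) (intro borel_measurable_continuous_onI continuous_intros)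
  have mq: "(\<lambda>\<omega>. q (G \<omega>)) \<in> borel_measurable M" if "G \<in> borel_measurable M" for G
    using that by (rule measurable_compose) (rule borel_measurable_real_seminorm[OF q qn])
  have lower: "1/64 \<le> prob {\<omega>\<in>space M. \<tau> < q (?S J' \<omega>)}" if "J \<le> J'" for J'
  proof -
    have "rsum D z (\<lambda>u. of_bool (q u > real n)) \<le> 2 * rsum (dyads J') z (\<lambda>u. of_bool (q u > real n))"
      using D dyads_mono[OF that] by (intro rsum_subset[OF q]) auto
    also have "rsum (dyads J') z (\<lambda>u. of_bool (q u > real n)) \<le> 4 * prob {\<omega>\<in>space M. c * real n / 4 < q (?S J' \<omega>)}"
      unfolding z_def b_def f_def by (rule rsum_le_riemann_sum[OF bm p c x1 q qn]) simp
    finally show ?thesis using bigq unfolding \<tau>_def by simp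
  qed
  define E where "E J' = 4 * (C * (1 / 4 ^ J') powr \<alpha>)\<^sup>2" for J' :: nat
  have Elim: "E \<longlonglongrightarrow> 4 * (C * 0)\<^sup>2"
  proof -
    have "(\<lambda>J'. (1 / 4 ^ J') powr \<alpha>) \<longlonglongrightarrow> (0::real)"
    proof (rule tendsto_zero_powrI[where b=\<alpha>])
      show "(\<lambda>J'. 1 / 4 ^ J' :: real) \<longlonglongrightarrow> 0"
        using LIMSEQ_power_zero[of "1/4::real"] by (simp add: power_one_over)
    qed (use \<alpha> in auto)
    then show ?thesis unfolding E_def by (intro tendsto_intros)
  qed
  have upper: "prob {\<omega>\<in>space M. \<tau> < q (?S J' \<omega>)} \<le> 1/128 + real (card (Pow D)) * (E J' / (\<tau> / 2)\<^sup>2)" for J'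
  proof -
    let ?B = "\<lambda>A. {\<omega>\<in>space M. \<bar>(\<Phi> A) (Y \<omega>) - (\<Phi> A) (?S J' \<omega>)\<bar> \<ge> \<tau> / 2}"
    let ?Y = "{\<omega>\<in>space M. norm (Y \<omega>) \<ge> real n0}"
    have mB: "?B A \<in> events" for A by measurable
    have mY: "?Y \<in> events" by measurable
    have "{\<omega>\<in>space M. \<tau> < q (?S J' \<omega>)} \<subseteq> ?Y \<union> (\<Union>A\<in>Pow D. ?B A)"
    proof
      fix \<omega> assume "\<omega> \<in> {\<omega>\<in>space M. \<tau> < q (?S J' \<omega>)}"
      then have \<omega>: "\<omega> \<in> space M" "\<tau> < q (?S J' \<omega>)" by auto
      have "q (?S J' \<omega>) \<in> (\<lambda>\<phi>. \<bar>blinfun_apply \<phi> (?S J' \<omega>)\<bar>) ` ?F"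
        unfolding q_def using F by (intro Max_in) auto
      then obtain A where A: "A \<in> Pow D" "q (?S J' \<omega>) = \<bar>(\<Phi> A) (?S J' \<omega>)\<bar>" by auto
      have "\<tau> < \<bar>(\<Phi> A) (Y \<omega>)\<bar> + \<bar>(\<Phi> A) (Y \<omega>) - (\<Phi> A) (?S J' \<omega>)\<bar>"
        using \<omega>(2) A(2) by linarith
      then have "real n0 \<le> norm (Y \<omega>) \<or> \<tau> / 2 \<le> \<bar>(\<Phi> A) (Y \<omega>) - (\<Phi> A) (?S J' \<omega>)\<bar>"
        using \<Phi>1[of A "Y \<omega>"] \<tau> by linarith
      then show "\<omega> \<in> ?Y \<union> (\<Union>A\<in>Pow D. ?B A)" using A(1) \<omega>(1) by blast
    qed
    then have "prob {\<omega>\<in>space M. \<tau> < q (?S J' \<omega>)} \<le> prob (?Y \<union> (\<Union>A\<in>Pow D. ?B A))"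
      using mB mY finD by (intro finite_measure_mono sets.Un sets.finite_UN) auto
    also have "\<dots> \<le> prob ?Y + prob (\<Union>A\<in>Pow D. ?B A)"
      using mB mY finD by (intro measure_Un_le sets.finite_UN) auto
    also have "prob (\<Union>A\<in>Pow D. ?B A) \<le> (\<Sum>A\<in>Pow D. prob (?B A))"
      using mB finD by (intro finite_measure_subadditive_finite) auto
    also have "\<dots> \<le> (\<Sum>A\<in>Pow D. E J' / (\<tau> / 2)\<^sup>2)"
    proof (intro sum_mono prob_abs_ge_le)
      fix A
      show "(\<integral>\<^sup>+ \<omega>. ennreal (((\<Phi> A) (Y \<omega>) - (\<Phi> A) (?S J' \<omega>))\<^sup>2) \<partial>M) \<le> ennreal (E J')"
        unfolding E_def by (rule riemann_sum_close[OF bm \<alpha>(1) C f0 wi L2 \<Phi>1])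
    qed (use \<tau>0 in \<open>auto simp: E_def\<close>)
    finally show ?thesis using n0(2) by simp
  qed
  have "(\<lambda>J'. 1/128 + real (card (Pow D)) * (E J' / (\<tau> / 2)\<^sup>2)) \<longlonglongrightarrow> 1/128 + real (card (Pow D)) * (4 * (C * 0)\<^sup>2 / (\<tau> / 2)\<^sup>2)"
    using \<tau>0 by (intro tendsto_intros Elim) auto
  moreover have "eventually (\<lambda>J'. 1/64 \<le> 1/128 + real (card (Pow D)) * (E J' / (\<tau> / 2)\<^sup>2)) sequentially"
    using eventually_ge_at_top[of J] by eventually_elim (use lower upper order_trans in blast)
  ultimately have "1/64 \<le> 1/128 + real (card (Pow D)) * (4 * (C * 0)\<^sup>2 / (\<tau> / 2)\<^sup>2)"
    by (intro tendsto_lowerbound) auto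
  then show False by simp
qed

section \<open>Families sorted into levels\<close>

text \<open>A family is indexed by the dyads as soon as level \<open>j\<close> carries at most \<open>4 ^ j\<close> vectors, of norm at most
  \<open>b ^ j\<close>; such families are stable under taking \<open>4 ^ l\<close> copies and multiplying by \<open>b ^ l\<close>.\<close>

lemma rsum_levels_le:
  fixes z :: "'i \<Rightarrow> 'e::real_normed_vector" and b R :: real
  assumes b: "0 < b"
    and bound: "dyadic_bound TYPE('e) b R"
    and I: "finite I" and z: "\<And>i. i \<in> I \<Longrightarrow> norm (z i) \<le> b ^ lev i"
    and card: "\<And>j. card {i\<in>I. lev i = j} \<le> 4 ^ j"
  shows "rsum I z (\<lambda>u. of_bool (norm u > R)) \<le> 1/8"
proof -
  have "\<exists>e. e ` {i\<in>I. lev i = j} \<subseteq> {..<4 ^ j :: nat} \<and> inj_on e {i\<in>I. lev i = j}" for j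
    using card[of j] I by (intro card_le_inj) auto
  then obtain e :: "nat \<Rightarrow> 'i \<Rightarrow> nat" where e: "\<And>j. e j ` {i\<in>I. lev i = j} \<subseteq> {..<4 ^ j}" "\<And>j. inj_on (e j) {i\<in>I. lev i = j}"
    by metis
  \<comment> \<open>A level preserving injection of the family into the dyads; the free positions
    will receive the zero vector.\<close>
  define h where "h i = (lev i, e (lev i) i)" for i
  have inj: "inj_on h I"
  proof (rule inj_onI)
    fix i i' assume "i \<in> I" "i' \<in> I" "h i = h i'"
    then show "i = i'" using inj_onD[OF e(2)[of "lev i"], of i i'] unfolding h_def by auto
  qed
  define J where "J = Suc (\<Sum>i\<in>I. lev i)"
  have sub: "h ` I \<subseteq> dyads J"
  proof
    fix \<kappa> assume "\<kappa> \<in> h ` I"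
    then obtain i where i: "i \<in> I" "\<kappa> = (lev i, e (lev i) i)" unfolding h_def by auto
    have "lev i \<le> (\<Sum>i\<in>I. lev i)" using i I by (intro member_le_sum) auto
    moreover have "e (lev i) i < 4 ^ lev i" using e(1)[of "lev i"] i by auto
    ultimately show "\<kappa> \<in> dyads J" unfolding J_def i dyads_def by auto
  qed
  define x where "x j k = (if (j, k) \<in> h ` I then (1 / b ^ j) *\<^sub>R z (inv_into I h (j, k)) else 0)" for j k
  have x1: "norm (x j k) \<le> 1" for j k
  proof (cases "(j, k) \<in> h ` I")
    case True
    then have i: "inv_into I h (j, k) \<in> I" "h (inv_into I h (j, k)) = (j, k)"
      by (auto intro: inv_into_into f_inv_into_f)
    then have "norm (z (inv_into I h (j, k))) \<le> b ^ j" using z[OF i(1)] unfolding h_def by auto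
    then show ?thesis using True b unfolding x_def by (simp add: divide_simps)
  qed (simp add: x_def)
  let ?Z = "\<lambda>(j, k). b ^ j *\<^sub>R x j k"
  have "rsum I z (\<lambda>u. of_bool (norm u > R)) = rsum I (\<lambda>i. ?Z (h i)) (\<lambda>u. of_bool (norm u > R))"
  proof (rule rsum_cong)
    fix i assume i: "i \<in> I"
    obtain j k where jk: "h i = (j, k)" by (cases "h i")
    have "(j, k) \<in> h ` I" using i jk[symmetric] by simp
    moreover have "inv_into I h (j, k) = i" using inv_into_f_f[OF inj i] jk by simp
    ultimately show "z i = ?Z (h i)" using b by (simp add: jk x_def)
  qed
  also have "\<dots> = rsum (h ` I) ?Z (\<lambda>u. of_bool (norm u > R))"
    by (rule rsum_image[OF I inj, symmetric])
  also have "\<dots> = rsum (dyads J) ?Z (\<lambda>u. of_bool (norm u > R))"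
    using sub by (intro rsum_superset[symmetric]) (auto simp: x_def)
  also have "\<dots> \<le> 1/8" using bound x1 by (auto simp: dyadic_bound_def)
  finally show ?thesis .
qed

text \<open>Scaling by \<open>b ^ l\<close> raises all levels by \<open>l\<close>, and
  \<open>4 ^ l\<close> copies still respect the cardinality bound, so \<open>rsum_levels_le\<close>
  applies to them. Through \<open>rsum_copies\<close> this reads
  \<open>(1 - a) ^ m \<ge> 3/4\<close> with \<open>m = 4 ^ l\<close>.\<close>

lemma rsum_levels_tail:
  fixes z :: "'i \<Rightarrow> 'e::real_normed_vector" and b R :: real
  assumes b: "0 < b"
    and bound: "dyadic_bound TYPE('e) b R"
    and I: "finite I" and z: "\<And>i. i \<in> I \<Longrightarrow> norm (z i) \<le> b ^ lev i"
    and card: "\<And>j. card {i\<in>I. lev i = j} \<le> 4 ^ j"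
  shows "rsum I z (\<lambda>u. of_bool (norm u > 2 * R / b ^ l)) \<le> 1 / 4 ^ l"
proof -
  define m :: nat where "m = 4 ^ l"
  define a where "a = rsum I (\<lambda>i. b ^ l *\<^sub>R z i) (\<lambda>u. of_bool (norm u > 2 * R))"
  have a1: "a \<le> 1" unfolding a_def using I by (intro rsum_le_1) auto
  have "(1 - (1 - a) ^ m) / 2 \<le> rsum ({..<m} \<times> I) (\<lambda>(j, i). b ^ l *\<^sub>R z i) (\<lambda>u. of_bool (norm (0 + u) > R))"
    unfolding a_def by (rule rsum_copies[OF real_seminorm_norm I])
  also have "\<dots> = rsum ({..<m} \<times> I) (\<lambda>(j, i). b ^ l *\<^sub>R z i) (\<lambda>u. of_bool (norm u > R))" by simp
  also have "\<dots> \<le> 1/8"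
  proof (rule rsum_levels_le[OF b bound, where lev="\<lambda>(j, i). lev i + l"])
    show "finite ({..<m} \<times> I)" using I by simp
    show "norm (case \<kappa> of (j, i) \<Rightarrow> b ^ l *\<^sub>R z i) \<le> b ^ (case \<kappa> of (j, i) \<Rightarrow> lev i + l)" if \<kappa>: "\<kappa> \<in> {..<m} \<times> I" for \<kappa>
    proof -
      obtain j i where ji: "\<kappa> = (j, i)" by (cases \<kappa>)
      have "b ^ l * norm (z i) \<le> b ^ l * b ^ lev i" using z[of i] b \<kappa> unfolding ji by (intro mult_left_mono) auto
      then show ?thesis using b unfolding ji by (simp add: power_add mult.commute)
    qed
    fix j
    show "card {\<kappa> \<in> {..<m} \<times> I. (case \<kappa> of (j, i) \<Rightarrow> lev i + l) = j} \<le> 4 ^ j"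
    proof (cases "l \<le> j")
      case True
      have "{\<kappa> \<in> {..<m} \<times> I. (case \<kappa> of (j, i) \<Rightarrow> lev i + l) = j} = {..<m} \<times> {i\<in>I. lev i = j - l}"
        using True by auto
      then have "card {\<kappa> \<in> {..<m} \<times> I. (case \<kappa> of (j, i) \<Rightarrow> lev i + l) = j} = 4 ^ l * card {i\<in>I. lev i = j - l}"
        by (simp add: m_def card_cartesian_product)
      also have "\<dots> \<le> 4 ^ l * 4 ^ (j - l)" by (intro mult_left_mono card) auto
      also have "\<dots> = 4 ^ j" using True by (simp add: power_add[symmetric])
      finally show ?thesis .
    next
      case False
      then have "{\<kappa> \<in> {..<m} \<times> I. (case \<kappa> of (j, i) \<Rightarrow> lev i + l) = j} = {}" by auto
      then show ?thesis by (simp only: card.empty)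
    qed
  qed
  finally have pow: "3/4 \<le> (1 - a) ^ m" by simp
  have "a \<le> 1 / real m"
  proof (rule ccontr)
    assume "\<not> a \<le> 1 / real m"
    then have am: "1 < a * real m" unfolding m_def by (simp add: field_simps not_le)
    \<comment> \<open>With \<open>a * m > 1\<close> the power would be at most
      \<open>exp (- 1)\<close>, hence at most one half.\<close>
    have "(1 - a) ^ m \<le> exp (- a) ^ m"
      using a1 exp_ge_add_one_self[of "- a"] by (intro power_mono) auto
    also have "\<dots> = exp (- (a * real m))" by (simp add: exp_of_nat_mult[symmetric] mult.commute)
    also have "\<dots> \<le> exp (- 1)" using am by simp
    also have "\<dots> \<le> 1/2" using exp_ge_add_one_self[of 1] by (simp add: exp_minus field_simps)
    finally show False using pow by simp
  qed
  moreover have "a = rsum I z (\<lambda>u. of_bool (norm u > 2 * R / b ^ l))"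
    unfolding a_def rsum_scaleR using b by (simp add: pos_divide_less_eq mult.commute)
  ultimately show ?thesis unfolding m_def by simp
qed

section \<open>Stable sums\<close>

text \<open>\<open>1 - cos (x / s)\<close> is at least \<open>1 - cos 1\<close> for
  \<open>s \<le> \<bar>x\<bar> \<le> 2 * s\<close>, as 2 is below pi, and its mean is read off the
  characteristic function at \<open>1 / s\<close>. The dyadic shells from \<open>t\<close> on sum
  geometrically, with ratio at most \<open>1/2\<close> because \<open>p \<ge> 1\<close>.\<close>

lemma stable_tail:
  assumes p: "1 \<le> p" and \<mu>: "std_sym_stable p \<mu>" and t: "0 < t"
  shows "measure \<mu> {x. t \<le> \<bar>x\<bar>} \<le> 2 / (1 - cos 1) * t powr - p"
proof -
  have ch: "\<And>\<xi>. char \<mu> \<xi> = complex_of_real (exp (- (\<bar>\<xi>\<bar> powr p)))" and "real_distribution \<mu>"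
    using \<mu> by (auto simp: std_sym_stable_def)
  interpret real_distribution \<mu> by fact
  define \<kappa> where "\<kappa> = 1 - cos (1::real)"
  have "cos (1::real) < cos 0" using pi_gt3 by (intro cos_monotone_0_pi) auto
  then have \<kappa>: "0 < \<kappa>" unfolding \<kappa>_def by simp
  have shell: "measure \<mu> {x. s \<le> \<bar>x\<bar> \<and> \<bar>x\<bar> \<le> 2 * s} \<le> s powr - p / \<kappa>" if s: "0 < s" for s
  proof -
    have int: "integrable \<mu> (\<lambda>x. iexp ((1 / s) * x))"
      by (intro integrable_const_bound[where B=1]) auto
    have intcos: "integrable \<mu> (\<lambda>x. cos (x / s))"
      by (intro integrable_const_bound[where B=1]) auto
    have "Re (char \<mu> (1 / s)) = (\<integral>x. Re (iexp ((1 / s) * x)) \<partial>\<mu>)"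
      unfolding char_def by (rule integral_Re[OF int, symmetric])
    also have "\<dots> = (\<integral>x. cos (x / s) \<partial>\<mu>)" by (simp add: Re_exp)
    finally have c: "(\<integral>x. cos (x / s) \<partial>\<mu>) = exp (- (s powr - p))"
      using s by (simp add: ch powr_divide powr_minus_divide)
    have "\<kappa> * measure \<mu> {x. s \<le> \<bar>x\<bar> \<and> \<bar>x\<bar> \<le> 2 * s} = (\<integral>x. \<kappa> * indicator {x. s \<le> \<bar>x\<bar> \<and> \<bar>x\<bar> \<le> 2 * s} x \<partial>\<mu>)"
      by simp
    also have "\<dots> \<le> (\<integral>x. 1 - cos (x / s) \<partial>\<mu>)"
    proof (intro integral_mono)
      show "integrable \<mu> (\<lambda>x. \<kappa> * indicator {x. s \<le> \<bar>x\<bar> \<and> \<bar>x\<bar> \<le> 2 * s} x)"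
        by (intro integrable_mult_right integrable_real_indicator) (auto simp: less_top[symmetric])
      show "integrable \<mu> (\<lambda>x. 1 - cos (x / s))" using intcos by simp
      fix x :: real
      show "\<kappa> * indicator {x. s \<le> \<bar>x\<bar> \<and> \<bar>x\<bar> \<le> 2 * s} x \<le> 1 - cos (x / s)"
      proof (cases "s \<le> \<bar>x\<bar> \<and> \<bar>x\<bar> \<le> 2 * s")
        case True
        have y: "1 \<le> \<bar>x\<bar> / s" "\<bar>x\<bar> / s \<le> 2" using True s by (auto simp: field_simps)
        have "cos (x / s) = cos (\<bar>x\<bar> / s)" by (cases "x \<ge> 0") auto
        also have "\<dots> \<le> cos 1"
          using y pi_gt3 by (intro cos_monotone_0_pi_le) auto
        finally show ?thesis using True unfolding \<kappa>_def by simp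
      next
        case False
        then show ?thesis by simp
      qed
    qed
    also have "\<dots> = 1 - exp (- (s powr - p))" using intcos prob_space by (simp add: c)
    also have "\<dots> \<le> s powr - p" using exp_ge_add_one_self[of "- (s powr - p)"] by simp
    finally show ?thesis using \<kappa> by (simp add: field_simps)
  qed
  define A where "A n = {x. 2 ^ n * t \<le> \<bar>x\<bar> \<and> \<bar>x\<bar> \<le> 2 * (2 ^ n * t)}" for n :: nat
  have A: "measure \<mu> (A n) \<le> (1/2) ^ n * (t powr - p / \<kappa>)" for n
  proof -
    have "measure \<mu> (A n) \<le> (2 ^ n * t) powr - p / \<kappa>"
      unfolding A_def using t by (intro shell) auto
    also have "(2 ^ n * t) powr - p = (2 ^ n) powr - p * t powr - p" using t by (simp add: powr_mult)
    also have "(2 ^ n :: real) powr - p \<le> (2 ^ n) powr - 1" using p by (intro powr_mono) auto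
    also have "(2 ^ n :: real) powr - 1 = (1/2) ^ n" by (simp add: powr_minus_divide power_one_over)
    finally show ?thesis using \<kappa> t by (simp add: divide_right_mono mult_right_mono)
  qed
  have mA: "A n \<in> sets \<mu>" for n unfolding A_def by simp
  have geo: "(\<lambda>n. (1/2) ^ n * (t powr - p / \<kappa>)) sums (2 * (t powr - p / \<kappa>))"
    using geometric_sums[of "1/2::real"] by (intro sums_mult2) simp
  have summ: "summable (\<lambda>n. measure \<mu> (A n))"
    using A by (intro summable_comparison_test'[OF sums_summable[OF geo]]) auto
  have sub: "{x. t \<le> \<bar>x\<bar>} \<subseteq> (\<Union>n. A n)"
  proof
    fix x assume "x \<in> {x. t \<le> \<bar>x\<bar>}"
    then have x: "t \<le> \<bar>x\<bar>" by simp
    have ex: "\<exists>n::nat. \<bar>x\<bar> < 2 ^ n * t"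
      using real_arch_pow[of 2 "\<bar>x\<bar> / t"] t by (auto simp: field_simps)
    then obtain n where n: "\<bar>x\<bar> < 2 ^ n * t" "\<And>m. m < n \<Longrightarrow> \<not> \<bar>x\<bar> < 2 ^ m * t"
      using exists_least_iff[of "\<lambda>n. \<bar>x\<bar> < 2 ^ n * t"] by blast
    have "n \<noteq> 0" using n(1) x by (cases n) auto
    then obtain m where m: "n = Suc m" by (cases n) auto
    then have "x \<in> A m" using n(1) n(2)[of m] unfolding A_def by auto
    then show "x \<in> (\<Union>n. A n)" by auto
  qed
  have "measure \<mu> {x. t \<le> \<bar>x\<bar>} \<le> measure \<mu> (\<Union>n. A n)"
    using mA sub by (intro finite_measure_mono sets.countable_UN) auto
  also have "\<dots> \<le> (\<Sum>n. measure \<mu> (A n))"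
    using mA summ by (intro finite_measure_subadditive_countably) auto
  also have "\<dots> \<le> 2 * (t powr - p / \<kappa>)"
    using suminf_le[OF A summ sums_summable[OF geo]] sums_unique[OF geo] by simp
  finally show ?thesis unfolding \<kappa>_def by simp
qed

text \<open>Chernoff bound: Markov's inequality for \<open>L\<close> to the power of the count,
  whose mean is a product by independence.\<close>

lemma (in finite_product_prob_space) prob_count_ge_le:
  assumes B: "\<And>i. i \<in> I \<Longrightarrow> B i \<in> sets (M i)" and L: "1 \<le> (L::real)"
  shows "measure (PiM I M) {x \<in> space (PiM I M). m \<le> card {i\<in>I. x i \<in> B i}} \<le> exp (L * (\<Sum>i\<in>I. measure (M i) (B i))) / L ^ m"
proof -
  let ?P = "PiM I M"
  let ?g = "\<lambda>i y. 1 + (L - 1) * indicator (B i) y :: real"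
  have gL: "?g i y = (if y \<in> B i then L else 1)" for i y by simp
  have intg: "integrable (M i) (?g i)" if "i \<in> I" for i
    using B[OF that] by (intro Bochner_Integration.integrable_add integrable_mult_right integrable_real_indicator) (auto simp: less_top[symmetric])
  have Eg: "(\<integral>y. ?g i y \<partial>M i) = 1 + (L - 1) * measure (M i) (B i)" if "i \<in> I" for i
    using B[OF that] sets.sets_into_space[OF B[OF that]] by (simp add: M.prob_space Int_absorb2 less_top[symmetric])
  have prodL: "(\<Prod>i\<in>I. ?g i (x i)) = L ^ card {i\<in>I. x i \<in> B i}" for x
  proof -
    have "(\<Prod>i\<in>I. ?g i (x i)) = (\<Prod>i\<in>I. if x i \<in> B i then L else 1)" by (simp only: gL)
    also have "\<dots> = (\<Prod>i\<in>{i\<in>I. x i \<in> B i}. L)"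
      using finite_index by (simp add: prod.If_cases Int_def)
    finally show ?thesis by simp
  qed
  have intP: "integrable ?P (\<lambda>x. \<Prod>i\<in>I. ?g i (x i))"
    by (rule product_integrable_prod[OF finite_index intg])
  have "(\<integral>x. (\<Prod>i\<in>I. ?g i (x i)) \<partial>?P) = (\<Prod>i\<in>I. \<integral>y. ?g i y \<partial>M i)"
    by (rule product_integral_prod[OF finite_index intg])
  also have "\<dots> = (\<Prod>i\<in>I. 1 + (L - 1) * measure (M i) (B i))"
    by (intro prod.cong Eg) auto
  also have "\<dots> \<le> (\<Prod>i\<in>I. exp (L * measure (M i) (B i)))"
  proof (intro prod_mono conjI)
    fix i
    show "0 \<le> 1 + (L - 1) * measure (M i) (B i)" using L by simp
    have "1 + (L - 1) * measure (M i) (B i) \<le> 1 + L * measure (M i) (B i)" by (simp add: mult_right_mono)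
    also have "\<dots> \<le> exp (L * measure (M i) (B i))" by (rule exp_ge_add_one_self)
    finally show "1 + (L - 1) * measure (M i) (B i) \<le> exp (L * measure (M i) (B i))" .
  qed
  also have "\<dots> = exp (L * (\<Sum>i\<in>I. measure (M i) (B i)))"
    using finite_index by (simp add: exp_sum sum_distrib_left)
  finally have E: "(\<integral>x. L ^ card {i\<in>I. x i \<in> B i} \<partial>?P) \<le> exp (L * (\<Sum>i\<in>I. measure (M i) (B i)))"
    unfolding prodL .
  have intL: "integrable ?P (\<lambda>x. L ^ card {i\<in>I. x i \<in> B i})" using intP unfolding prodL .
  have "measure ?P {x \<in> space ?P. m \<le> card {i\<in>I. x i \<in> B i}} \<le> measure ?P {x \<in> space ?P. L ^ m \<le> L ^ card {i\<in>I. x i \<in> B i}}"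
    using L borel_measurable_integrable[OF intL] by (intro finite_measure_mono) (auto intro: power_increasing)
  also have "\<dots> \<le> (\<integral>x. L ^ card {i\<in>I. x i \<in> B i} \<partial>?P) / L ^ m"
    using integral_Markov_inequality_measure[OF intL, of "{}" "L ^ m"] L by simp
  also have "\<dots> \<le> exp (L * (\<Sum>i\<in>I. measure (M i) (B i))) / L ^ m"
    using E L by (intro divide_right_mono) auto
  finally show ?thesis .
qed

text \<open>The level satisfies \<open>b ^ Suc (lev i) < norm (z i) \<le> b ^ lev i\<close>, so the
  counting hypothesis bounds the size of each level. Zero vectors have no level and are
  dropped.\<close>

lemma rsum_bounded_levels_tail:
  fixes z :: "'i \<Rightarrow> 'e::real_normed_vector" and b R :: real
  assumes b: "0 < b" "b < 1"
    and bound: "dyadic_bound TYPE('e) b R"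
    and I: "finite I" and z1: "\<And>i. i \<in> I \<Longrightarrow> norm (z i) \<le> 1"
    and card: "\<And>j. card {i\<in>I. b ^ Suc j < norm (z i)} \<le> 4 ^ j"
  shows "rsum I z (\<lambda>u. of_bool (norm u > 2 * R / b ^ l)) \<le> 1 / 4 ^ l"
proof -
  define I0 where "I0 = {i\<in>I. z i \<noteq> 0}"
  define lev where "lev i = (LEAST j. b ^ Suc j < norm (z i))" for i
  have ex: "\<exists>j. b ^ Suc j < norm (z i)" if i: "i \<in> I0" for i
  proof -
    obtain j where j: "b ^ j < norm (z i)" using real_arch_pow_inv[of "norm (z i)" b] i b by (auto simp: I0_def)
    have "b ^ Suc j \<le> b ^ j" using b by (simp add: mult_left_le_one_le)
    then show ?thesis using j by (intro exI[of _ j]) simp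
  qed
  have lev: "b ^ Suc (lev i) < norm (z i)" if "i \<in> I0" for i
    unfolding lev_def using ex[OF that] by (rule LeastI_ex)
  have "rsum I z (\<lambda>u. of_bool (norm u > 2 * R / b ^ l)) = rsum I0 z (\<lambda>u. of_bool (norm u > 2 * R / b ^ l))"
    using I by (intro rsum_superset) (auto simp: I0_def)
  also have "\<dots> \<le> 1 / 4 ^ l"
  proof (rule rsum_levels_tail[OF b(1) bound, where lev=lev])
    show "finite I0" using I by (simp add: I0_def)
    show "norm (z i) \<le> b ^ lev i" if i: "i \<in> I0" for i
    proof (cases "lev i")
      case 0
      then show ?thesis using z1[of i] i by (simp add: I0_def)
    next
      case (Suc j)
      then have "j < (LEAST j. b ^ Suc j < norm (z i))" by (simp add: lev_def)
      then have "\<not> b ^ Suc j < norm (z i)" by (rule not_less_Least)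
      then show ?thesis using Suc by simp
    qed
    fix j
    have "card {i\<in>I0. lev i = j} \<le> card {i\<in>I. b ^ Suc j < norm (z i)}"
      using lev I by (intro card_mono) (auto simp: I0_def)
    also have "\<dots> \<le> 4 ^ j" by (rule card)
    finally show "card {i\<in>I0. lev i = j} \<le> 4 ^ j" .
  qed
  finally show ?thesis .
qed

text \<open>After scaling by \<open>b ^ l\<close>, the mean number of moduli above
  \<open>b ^ Suc j\<close> is at most \<open>K * 4 ^ Suc j / 4 ^ l\<close>. By Chernoff it is
  unlikely that \<open>4 ^ j\<close> of them are so large; off the exceptional event the scaled
  terms satisfy \<open>rsum_bounded_levels_tail\<close>. Undoing the scaling gives the second factor
  \<open>b ^ l\<close>.\<close>

lemma stable_sum_tail:
  fixes x :: "nat \<Rightarrow> 'e::real_normed_vector" and p R :: real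
  defines "b \<equiv> 4 powr - (1/p)" and "K \<equiv> 2 / (1 - cos 1)"
  assumes p: "1 \<le> p" and \<mu>: "std_sym_stable p \<mu>"
    and bound: "dyadic_bound TYPE('e) b R"
    and x: "(\<Sum>i<n. norm (x i) powr p) \<le> 1"
  shows "measure (PiM {..<n} (\<lambda>_. \<mu>)) {\<theta> \<in> space (PiM {..<n} (\<lambda>_. \<mu>)). 2 * R / (b ^ l)\<^sup>2 < norm (\<Sum>i<n. \<theta> i *\<^sub>R x i)}
    \<le> (9 * exp 1 * K + 1) / 4 ^ l"
proof -
  let ?P = "PiM {..<n} (\<lambda>_. \<mu>)"
  have rd: "real_distribution \<mu>" and ch: "\<And>\<xi>. char \<mu> \<xi> = complex_of_real (exp (- (\<bar>\<xi>\<bar> powr p)))"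
    using \<mu> by (auto simp: std_sym_stable_def)
  interpret \<mu>: real_distribution \<mu> by fact
  interpret S: sym_laws "\<lambda>_. \<mu>" "{..<n}"
    by standard (auto intro!: distr_uminus_if_char_even[OF rd] simp: ch)
  have b: "0 < b" "b < 1" unfolding b_def using p by (auto simp: powr_less_one)
  have bp: "(b ^ k) powr - p = 4 ^ k" for k
    unfolding b_def using p by (simp add: powr_realpow[symmetric] powr_powr)
  have "cos (1::real) < cos 0" using pi_gt3 by (intro cos_monotone_0_pi) auto
  then have K: "0 < K" unfolding K_def by simp
  have tail: "measure \<mu> {y. s < \<bar>y\<bar> * c} \<le> K * (c powr p * s powr - p)" if "0 < s" "0 \<le> c" for s c
  proof (cases "c = 0")
    case True
    then have "{y. s < \<bar>y\<bar> * c} = {}" using that by auto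
    then show ?thesis using K by simp
  next
    case False
    then have c: "0 < c" using that by simp
    have "measure \<mu> {y. s < \<bar>y\<bar> * c} \<le> measure \<mu> {y. s / c \<le> \<bar>y\<bar>}"
      using c by (intro \<mu>.finite_measure_mono) (auto simp: field_simps)
    also have "\<dots> \<le> K * (s / c) powr - p"
      unfolding K_def using that c by (intro stable_tail[OF p \<mu>]) simp
    also have "(s / c) powr - p = c powr p * s powr - p"
      using that c by (simp add: powr_divide powr_minus field_simps)
    finally show ?thesis .
  qed
  define v where "v \<theta> i = b ^ l * \<bar>\<theta> i\<bar> * norm (x i)" for \<theta> :: "nat \<Rightarrow> real" and i
  define N where "N s \<theta> = card {i\<in>{..<n}. s < v \<theta> i}" for s \<theta>
  have N_eq: "N s \<theta> = card {i\<in>{..<n}. \<theta> i \<in> {y. s < b ^ l * \<bar>y\<bar> * norm (x i)}}" for s \<theta>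
    unfolding N_def v_def by simp
  define E where "E m s = {\<theta>\<in>space ?P. m \<le> N s \<theta>}" for m s
  have mN: "E m s \<in> sets ?P" for s m
  proof -
    have "real (N s \<theta>) = (\<Sum>i<n. if s < v \<theta> i then 1 else 0)" for \<theta>
      unfolding N_def by (simp add: sum.If_cases Int_def)
    then have "E m s = {\<theta>\<in>space ?P. real m \<le> (\<Sum>i<n. if s < v \<theta> i then 1 else 0)}"
      unfolding E_def by (metis of_nat_le_iff)
    also have "\<dots> \<in> sets ?P" unfolding v_def by measurable
    finally show ?thesis .
  qed
  \<comment> \<open>\<open>1 / a\<close> is the Chernoff parameter.\<close>
  have count: "measure ?P (E m s) \<le> exp (K * (s / b ^ l) powr - p / a) * a ^ m"
    if s: "0 < s" and a: "0 < a" "a \<le> 1" for m s a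
  proof -
    let ?B = "\<lambda>i. {y. s < b ^ l * \<bar>y\<bar> * norm (x i)}"
    have "measure ?P (E m s) \<le> exp ((1 / a) * (\<Sum>i<n. measure \<mu> (?B i))) / (1 / a) ^ m"
      unfolding E_def N_eq using a by (intro S.prob_count_ge_le) auto
    also have "\<dots> = exp ((1 / a) * (\<Sum>i<n. measure \<mu> (?B i))) * a ^ m"
      by (simp add: power_one_over)
    also have "\<dots> \<le> exp (K * (s / b ^ l) powr - p / a) * a ^ m"
    proof (intro mult_right_mono exp_mono)
      have "(\<Sum>i<n. measure \<mu> (?B i)) \<le> (\<Sum>i<n. K * (norm (x i) powr p * (s / b ^ l) powr - p))"
      proof (intro sum_mono)
        fix i
        have "?B i = {y. s / b ^ l < \<bar>y\<bar> * norm (x i)}" using b by (auto simp: field_simps)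
        then show "measure \<mu> (?B i) \<le> K * (norm (x i) powr p * (s / b ^ l) powr - p)"
          using tail[of "s / b ^ l" "norm (x i)"] s b by simp
      qed
      also have "\<dots> = K * (s / b ^ l) powr - p * (\<Sum>i<n. norm (x i) powr p)"
        by (simp add: sum_distrib_left mult_ac)
      also have "\<dots> \<le> K * (s / b ^ l) powr - p" using x K by (simp add: mult_left_le)
      finally show "(1 / a) * (\<Sum>i<n. measure \<mu> (?B i)) \<le> K * (s / b ^ l) powr - p / a"
        using a by (simp add: divide_right_mono)
    qed (use a in auto)
    finally show ?thesis .
  qed
  \<comment> \<open>Only \<open>j < n\<close> matters: from level \<open>n\<close> on,
    \<open>4 ^ j\<close> exceeds the number of terms.\<close>
  define Bad where "Bad = E 1 1 \<union> (\<Union>j<n. E (4 ^ j) (b ^ Suc j))"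
  have mBad: "Bad \<in> sets ?P" unfolding Bad_def using mN by (intro sets.Un sets.finite_UN) auto
  have PBad: "measure ?P Bad \<le> 9 * exp 1 * K / 4 ^ l"
  \<comment> \<open>For small \<open>l\<close> the claimed bound is at least 1.\<close>
  proof (cases "8 * exp 1 * K \<le> 4 ^ l")
    case False
    have "measure ?P Bad \<le> 1" by (rule S.P.prob_le_1)
    also have "1 \<le> 9 * exp 1 * K / 4 ^ l"
    proof -
      have "8 * exp 1 * K \<le> 9 * exp 1 * K" using K by simp
      then have "4 ^ l \<le> 9 * exp 1 * K" using False by linarith
      then show ?thesis by (simp add: pos_le_divide_eq)
    qed
    finally show ?thesis .
  next
    case True
    \<comment> \<open>With this \<open>a\<close> the exponent in \<open>count\<close> at level
      \<open>j\<close> is exactly \<open>4 ^ j\<close>, so the bound becomes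
      \<open>(exp 1 * a) ^ (4 ^ j)\<close>, and the case assumption makes its base at most
      \<open>1/2\<close>.\<close>
    define a where "a = 4 * K / 4 ^ l"
    have e1: "1 \<le> exp (1::real)" by simp
    have ea: "exp 1 * a \<le> 1/2" "0 < a" using True K unfolding a_def by (auto simp: field_simps)
    have "1 * a \<le> exp 1 * a" using ea(2) e1 by (intro mult_right_mono) auto
    then have a1: "a \<le> 1" using ea(1) by linarith
    have first: "measure ?P (E 1 1) \<le> exp 1 * K / 4 ^ l"
    proof -
      have pw: "(1 / b ^ l) powr - p = 1 / 4 ^ l" using bp[of l] b by (simp add: powr_divide)
      \<comment> \<open>At threshold 1 the parameter \<open>K / 4 ^ l\<close> makes the exponent
        equal to 1.\<close>
      have "measure ?P (E 1 1) \<le> exp (K * (1 / b ^ l) powr - p / (K / 4 ^ l)) * (K / 4 ^ l) ^ 1"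
        using K a1 unfolding a_def by (intro count) (auto simp: field_simps)
      also have "\<dots> = exp 1 * K / 4 ^ l" unfolding pw using K by simp
      finally show ?thesis .
    qed
    have level: "measure ?P (E (4 ^ j) (b ^ Suc j)) \<le> exp 1 * a * (1/2) ^ j" for j
    proof -
      have pw: "(b ^ Suc j / b ^ l) powr - p = 4 ^ Suc j / 4 ^ l"
        using bp[of l] bp[of "Suc j"] b by (simp add: powr_divide del: power_Suc)
      have "measure ?P (E (4 ^ j) (b ^ Suc j)) \<le> exp (K * (b ^ Suc j / b ^ l) powr - p / a) * a ^ (4 ^ j)"
        using b ea a1 by (intro count) auto
      also have "K * (b ^ Suc j / b ^ l) powr - p / a = real (4 ^ j) * 1"
        unfolding pw a_def using K by simp
      also have "exp (real (4 ^ j) * 1) = exp 1 ^ (4 ^ j)" by (rule exp_of_nat_mult)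
      also have "exp 1 ^ (4 ^ j) * a ^ (4 ^ j) = (exp 1 * a) ^ (4 ^ j)" by (simp add: power_mult_distrib)
      also have "\<dots> \<le> (exp 1 * a) ^ Suc j"
      proof (rule power_decreasing)
        show "Suc j \<le> 4 ^ j" by (induction j) auto
      qed (use ea in auto)
      also have "\<dots> = exp 1 * a * (exp 1 * a) ^ j" by simp
      also have "\<dots> \<le> exp 1 * a * (1/2) ^ j" using ea by (intro mult_left_mono power_mono) auto
      finally show ?thesis .
    qed
    have "measure ?P Bad \<le> measure ?P (E 1 1) + measure ?P (\<Union>j<n. E (4 ^ j) (b ^ Suc j))"
      unfolding Bad_def using mN by (intro measure_Un_le sets.finite_UN) auto
    also have "measure ?P (\<Union>j<n. E (4 ^ j) (b ^ Suc j)) \<le> (\<Sum>j<n. measure ?P (E (4 ^ j) (b ^ Suc j)))"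
      using mN by (intro S.P.finite_measure_subadditive_finite) auto
    also have "\<dots> \<le> (\<Sum>j<n. exp 1 * a * (1/2) ^ j)" by (intro sum_mono level)
    also have "\<dots> = exp 1 * a * (\<Sum>j<n. (1/2) ^ j)" by (simp add: sum_distrib_left)
    also have "\<dots> \<le> exp 1 * a * (1 / (1 - 1/2))" using ea by (intro mult_left_mono sum_geometric_le) auto
    also have "exp 1 * a * (1 / (1 - 1/2)) = 8 * exp 1 * K / 4 ^ l" by (simp add: a_def)
    finally show ?thesis using first by (simp add: field_simps)
  qed
  let ?F = "\<lambda>u. of_bool (2 * R / (b ^ l)\<^sup>2 < norm (u::'e)) :: real"
  have good: "rsum {..<n} (\<lambda>i. \<theta> i *\<^sub>R x i) ?F \<le> 1 / 4 ^ l" if \<theta>: "\<theta> \<in> space ?P" "\<theta> \<notin> Bad" for \<theta>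
  proof -
    let ?z = "\<lambda>i. b ^ l *\<^sub>R \<theta> i *\<^sub>R x i"
    have nz: "norm (?z i) = v \<theta> i" for i using b by (simp add: v_def abs_mult)
    have "N 1 \<theta> = 0" using \<theta> unfolding Bad_def E_def by auto
    then have v1: "v \<theta> i \<le> 1" if "i \<in> {..<n}" for i using that unfolding N_def by auto
    have cnt: "card {i\<in>{..<n}. b ^ Suc j < v \<theta> i} \<le> 4 ^ j" for j
    proof (cases "j < n")
      case True
      then show ?thesis using \<theta> unfolding Bad_def E_def N_def by force
    next
      case False
      have "card {i\<in>{..<n}. b ^ Suc j < v \<theta> i} \<le> card {..<n}" by (intro card_mono) auto
      also have "\<dots> \<le> 4 ^ j" using False power_gt_expt[of 4 j] by simp
      finally show ?thesis .
    qed
    have "rsum {..<n} ?z (\<lambda>u. of_bool (norm u > 2 * R / b ^ l)) \<le> 1 / 4 ^ l"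
      using v1 cnt by (intro rsum_bounded_levels_tail[OF b bound]) (simp_all only: nz finite_lessThan)
    also have "rsum {..<n} ?z (\<lambda>u. of_bool (norm u > 2 * R / b ^ l)) = rsum {..<n} (\<lambda>i. \<theta> i *\<^sub>R x i) ?F"
      unfolding rsum_scaleR using b by (simp add: power2_eq_square field_simps)
    finally show ?thesis .
  qed
  have mT: "(\<lambda>\<theta>. norm (\<Sum>i<n. \<theta> i *\<^sub>R x i)) \<in> borel_measurable ?P"
    by (intro measurable_compose[OF borel_measurable_sum_scaleR_const borel_measurable_norm]) measurable
  have mF: "?F \<in> borel_measurable borel" by measurable
  note int = S.integral_eq_rsum[OF mF, of 1 x]
  have "measure ?P {\<theta> \<in> space ?P. 2 * R / (b ^ l)\<^sup>2 < norm (\<Sum>i<n. \<theta> i *\<^sub>R x i)}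
    = (\<integral>\<theta>. indicator {\<theta> \<in> space ?P. 2 * R / (b ^ l)\<^sup>2 < norm (\<Sum>i<n. \<theta> i *\<^sub>R x i)} \<theta> \<partial>?P)"
    using mT by (simp add: Int_absorb2)
  also have "\<dots> = (\<integral>\<theta>. ?F (\<Sum>i<n. \<theta> i *\<^sub>R x i) \<partial>?P)"
    by (intro Bochner_Integration.integral_cong) (auto simp: indicator_def)
  also have "\<dots> = (\<integral>\<theta>. rsum {..<n} (\<lambda>i. \<theta> i *\<^sub>R x i) ?F \<partial>?P)" using int(2) by simp
  also have "\<dots> \<le> (\<integral>\<theta>. indicator Bad \<theta> + 1 / 4 ^ l \<partial>?P)"
  proof (intro integral_mono)
    show "integrable ?P (\<lambda>\<theta>. rsum {..<n} (\<lambda>i. \<theta> i *\<^sub>R x i) ?F)" using int(1) by simp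
    show "integrable ?P (\<lambda>\<theta>. indicator Bad \<theta> + 1 / 4 ^ l :: real)"
      using mBad by (intro Bochner_Integration.integrable_add integrable_real_indicator) (auto simp: less_top[symmetric])
    fix \<theta> assume \<theta>: "\<theta> \<in> space ?P"
    show "rsum {..<n} (\<lambda>i. \<theta> i *\<^sub>R x i) ?F \<le> indicator Bad \<theta> + 1 / 4 ^ l"
    proof (cases "\<theta> \<in> Bad")
      case True
      have "rsum {..<n} (\<lambda>i. \<theta> i *\<^sub>R x i) ?F \<le> 1" by (intro rsum_le_1) auto
      then show ?thesis using True by (simp add: add_increasing2)
    next
      case False
      then show ?thesis using good[OF \<theta>] by simp
    qed
  qed
  also have "\<dots> = measure ?P Bad + 1 / 4 ^ l"
    using mBad sets.sets_into_space[OF mBad] by (simp add: S.P.prob_space Int_absorb2 less_top[symmetric])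
  also have "\<dots> \<le> (9 * exp 1 * K + 1) / 4 ^ l" using PBad by (simp add: add_divide_distrib)
  finally show ?thesis .
qed

text \<open>The thresholds \<open>\<rho> * 16 ^ l\<close> have fourth roots growing like
  \<open>2 ^ l\<close>, which the tail \<open>K / 4 ^ l\<close> outweighs. The bound consists of
  \<open>d\<close> for the values up to \<open>\<rho>\<close> and a geometric sum with ratio
  \<open>1/2\<close> for the layers above.\<close>

lemma (in prob_space) fourth_root_moment_le:
  assumes f[measurable]: "f \<in> borel_measurable M" and f0: "\<And>w. 0 \<le> f w" and \<rho>: "0 < \<rho>" and K: "0 \<le> K"
    and tail: "\<And>l. prob {w\<in>space M. \<rho> * 16 ^ l < f w} \<le> K / 4 ^ l"
  shows "(\<integral>\<^sup>+ w. ennreal (f w powr (1/4)) \<partial>M) \<le> ennreal (\<rho> powr (1/4) * (1 + 4 * K))"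
proof -
  define d where "d = \<rho> powr (1/4)"
  have d: "0 < d" using \<rho> by (simp add: d_def)
  have root: "(\<rho> * 16 ^ l) powr (1/4) = d * 2 ^ l" for l
  proof -
    have "(16::real) ^ l = (2 ^ 4) ^ l" by simp
    also have "\<dots> = (2 ^ l) ^ 4" by (simp only: power_mult[symmetric] mult.commute)
    finally have "(16 ^ l :: real) powr (1/4) = ((2 ^ l) ^ 4) powr (1/4)" by simp
    also have "\<dots> = 2 ^ l" by (simp add: powr_realpow[symmetric] powr_powr)
    finally show ?thesis using \<rho> by (simp add: powr_mult d_def)
  qed
  define A where "A l = {w\<in>space M. \<rho> * 16 ^ l < f w}" for l :: nat
  have mA[measurable]: "A l \<in> events" for l unfolding A_def by measurable
  have "(\<integral>\<^sup>+ w. ennreal (f w powr (1/4)) \<partial>M) \<le> (\<integral>\<^sup>+ w. ennreal d + (\<Sum>l. ennreal (d * 2 ^ Suc l) * indicator (A l) w) \<partial>M)"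
  proof (intro nn_integral_mono)
    fix w assume w: "w \<in> space M"
    show "ennreal (f w powr (1/4)) \<le> ennreal d + (\<Sum>l. ennreal (d * 2 ^ Suc l) * indicator (A l) w)"
    proof (cases "f w \<le> \<rho>")
      case True
      then have "f w powr (1/4) \<le> d" unfolding d_def using f0 by (intro powr_mono2) auto
      then have "ennreal (f w powr (1/4)) \<le> ennreal d" by (rule ennreal_leI)
      then show ?thesis by (rule add_increasing2[rotated]) simp
    next
      case False
      have "\<exists>m. f w \<le> \<rho> * 16 ^ m"
        using real_arch_pow[of 16 "f w / \<rho>"] \<rho> by (auto simp: field_simps intro: less_imp_le)
      then obtain m where m: "f w \<le> \<rho> * 16 ^ m" "\<And>k. k < m \<Longrightarrow> \<not> f w \<le> \<rho> * 16 ^ k"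
        using exists_least_iff[of "\<lambda>m. f w \<le> \<rho> * 16 ^ m"] by blast
      have "m \<noteq> 0" using m(1) False by (cases m) auto
      then obtain l where l: "m = Suc l" by (cases m) auto
      have "w \<in> A l" using m(2)[of l] l w unfolding A_def by auto
      have "f w powr (1/4) \<le> (\<rho> * 16 ^ m) powr (1/4)" using m(1) f0 by (intro powr_mono2) auto
      then have "ennreal (f w powr (1/4)) \<le> ennreal (d * 2 ^ Suc l)" unfolding root l by (rule ennreal_leI)
      also have "\<dots> = (\<Sum>l'\<in>{l}. ennreal (d * 2 ^ Suc l') * indicator (A l') w)" using \<open>w \<in> A l\<close> by simp
      also have "\<dots> \<le> (\<Sum>l. ennreal (d * 2 ^ Suc l) * indicator (A l) w)" by (intro sum_le_suminf) auto
      finally show ?thesis by (rule add_increasing[rotated]) simp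
    qed
  qed
  also have "\<dots> = ennreal d + (\<Sum>l. ennreal (d * 2 ^ Suc l) * emeasure M (A l))"
    by (subst nn_integral_add) (auto simp: nn_integral_suminf nn_integral_cmult_indicator emeasure_space_1)
  also have "(\<Sum>l. ennreal (d * 2 ^ Suc l) * emeasure M (A l)) \<le> (\<Sum>l. ennreal (2 * d * K * (1/2) ^ l))"
  proof (intro suminf_le)
    fix l
    have "d * 2 ^ Suc l * prob (A l) \<le> d * 2 ^ Suc l * (K / 4 ^ l)"
      using d tail[of l] unfolding A_def by (intro mult_left_mono) auto
    also have "\<dots> = 2 * d * K * (1/2) ^ l"
    proof -
      have "(4::real) ^ l = 2 ^ l * 2 ^ l" by (simp add: power_mult_distrib[symmetric])
      then show ?thesis by (simp add: power_one_over)
    qed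
    finally show "ennreal (d * 2 ^ Suc l) * emeasure M (A l) \<le> ennreal (2 * d * K * (1/2) ^ l)"
      using d by (simp add: emeasure_eq_measure ennreal_mult[symmetric] ennreal_leI)
  qed auto
  also have "(\<Sum>l. ennreal (2 * d * K * (1/2) ^ l)) = ennreal (2 * d * K * 2)"
  proof (rule suminf_ennreal_eq)
    show "(\<lambda>l. 2 * d * K * (1/2) ^ l) sums (2 * d * K * 2)"
      using geometric_sums[of "1/2::real"] by (intro sums_mult) simp
  qed (use d K in auto)
  also have "ennreal d + ennreal (2 * d * K * 2) = ennreal (d * (1 + 4 * K))"
    using d K by (simp add: ennreal_plus[symmetric] algebra_simps del: ennreal_plus)
  finally show ?thesis unfolding d_def by (simp add: add_left_mono)
qed

text \<open>The tail estimate bounds the moment of order \<open>1/4\<close> uniformly over families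
  with p-th powers of norms summing to at most 1; homogeneity gives all other families.\<close>

lemma stable_type_if_rademacher_bound:
  fixes p R :: real
  assumes p: "1 \<le> p"
    and bound: "dyadic_bound TYPE('e::banach) (4 powr - (1/p)) R"
  shows "stable_type TYPE('e) p"
proof -
  define b where "b = (4::real) powr - (1/p)"
  \<comment> \<open>\<open>fourth_root_moment_le\<close> asks for a positive threshold, and
    enlarging \<open>R\<close> preserves the bound.\<close>
  define R' where "R' = max R 1"
  define K where "K = 9 * exp 1 * (2 / (1 - cos 1)) + (1::real)"
  have "cos (1::real) < cos 0" using pi_gt3 by (intro cos_monotone_0_pi) auto
  then have K: "0 \<le> K" unfolding K_def by simp
  have "dyadic_bound TYPE('e) b R'"
    unfolding dyadic_bound_def
  proof (intro allI impI)
    fix J and x :: "nat \<Rightarrow> nat \<Rightarrow> 'e" assume x: "\<forall>j k. norm (x j k) \<le> 1"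
    have "rsum (dyads J) (\<lambda>(j, k). b ^ j *\<^sub>R x j k) (\<lambda>u. of_bool (norm u > R'))
      \<le> rsum (dyads J) (\<lambda>(j, k). b ^ j *\<^sub>R x j k) (\<lambda>u. of_bool (norm u > R))"
      by (intro rsum_mono) (auto simp: R'_def of_bool_def)
    also have "\<dots> \<le> 1/8" using bound x by (auto simp: b_def dyadic_bound_def)
    finally show "rsum (dyads J) (\<lambda>(j, k). b ^ j *\<^sub>R x j k) (\<lambda>u. of_bool (norm u > R')) \<le> 1/8" .
  qed
  then have bound': "dyadic_bound TYPE('e) (4 powr - (1/p)) R'" unfolding b_def .
  \<comment> \<open>Hence \<open>1 / (b ^ l)\<^sup>2 \<le> 16 ^ l\<close>: the two scaling losses
    fit thresholds growing by the factor 16.\<close>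
  have "(4::real) powr - 1 \<le> b" unfolding b_def using p by (intro powr_mono) auto
  then have b4: "1/4 \<le> b" by (simp add: powr_minus_divide)
  define c where "c = (2 * R') powr (1/4) * (1 + 4 * K)"
  have c: "0 \<le> c" using K by (simp add: c_def)
  have unit: "(\<integral>\<^sup>+ \<theta>. ennreal (norm (\<Sum>i<n. \<theta> i *\<^sub>R x i) powr (1/4)) \<partial>(PiM {..<n} (\<lambda>_. \<mu>))) \<le> ennreal c"
    if \<mu>: "std_sym_stable p \<mu>" and x: "(\<Sum>i<n. norm (x i) powr p) \<le> 1" for \<mu> n and x :: "nat \<Rightarrow> 'e"
  proof -
    let ?P = "PiM {..<n} (\<lambda>_. \<mu>)"
    interpret \<mu>: real_distribution \<mu> using \<mu> by (simp add: std_sym_stable_def)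
    interpret P: product_prob_space "\<lambda>_. \<mu>" "{..<n}" by standard
    have mT: "(\<lambda>\<theta>. norm (\<Sum>i<n. \<theta> i *\<^sub>R x i)) \<in> borel_measurable ?P"
      by (intro measurable_compose[OF borel_measurable_sum_scaleR_const borel_measurable_norm]) measurable
    show ?thesis
      unfolding c_def
    proof (rule P.P.fourth_root_moment_le[OF mT])
      show "0 < 2 * R'" unfolding R'_def by simp
      fix l
      have "2 * R' / (b ^ l)\<^sup>2 \<le> 2 * R' * 16 ^ l"
      proof -
        have "(1/16 :: real) ^ l = ((1/4) ^ l)\<^sup>2" by (simp add: power2_eq_square power_mult_distrib[symmetric])
        also have "\<dots> \<le> (b ^ l)\<^sup>2" using b4 by (intro power_mono) auto
        finally have "1 \<le> 16 ^ l * (b ^ l)\<^sup>2" by (simp add: power_one_over field_simps)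
        then have "2 * R' * 1 \<le> 2 * R' * (16 ^ l * (b ^ l)\<^sup>2)" unfolding R'_def by (intro mult_left_mono) auto
        then show ?thesis using b4 by (simp add: pos_divide_le_eq mult.assoc)
      qed
      then have "measure ?P {\<theta>\<in>space ?P. 2 * R' * 16 ^ l < norm (\<Sum>i<n. \<theta> i *\<^sub>R x i)}
        \<le> measure ?P {\<theta>\<in>space ?P. 2 * R' / (b ^ l)\<^sup>2 < norm (\<Sum>i<n. \<theta> i *\<^sub>R x i)}"
        using mT by (intro P.P.finite_measure_mono) auto
      also have "\<dots> \<le> K / 4 ^ l"
        unfolding b_def K_def by (rule stable_sum_tail[OF p \<mu> bound' x])
      finally show "measure ?P {\<theta>\<in>space ?P. 2 * R' * 16 ^ l < norm (\<Sum>i<n. \<theta> i *\<^sub>R x i)} \<le> K / 4 ^ l" .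
    qed (use K in auto)
  qed
  \<comment> \<open>The constant is \<open>c ^ 4\<close> because the defining inequality raises it
    to the power \<open>1/4\<close>.\<close>
  have scaled: "(\<integral>\<^sup>+ \<theta>. ennreal (norm (\<Sum>i<n. \<theta> i *\<^sub>R x i) powr (1/4)) \<partial>(PiM {..<n} (\<lambda>_. \<mu>)))
      \<le> ennreal ((c ^ 4 * (\<Sum>i<n. norm (x i) powr p) powr (1/p)) powr (1/4))"
    if \<mu>: "std_sym_stable p \<mu>" for \<mu> n and x :: "nat \<Rightarrow> 'e"
  proof -
    let ?P = "PiM {..<n} (\<lambda>_. \<mu>)"
    define s where "s = (\<Sum>i<n. norm (x i) powr p) powr (1/p)"
    have S0: "0 \<le> (\<Sum>i<n. norm (x i) powr p)" by (intro sum_nonneg) auto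
    show ?thesis
    proof (cases "(\<Sum>i<n. norm (x i) powr p) = 0")
      case True
      then have "norm (x i) powr p = 0" if "i < n" for i
        using that by (subst (asm) sum_nonneg_eq_0_iff) auto
      then have "(\<Sum>i<n. \<theta> i *\<^sub>R x i) = 0" for \<theta> :: "nat \<Rightarrow> real" by (intro sum.neutral) auto
      then show ?thesis by simp
    next
      case False
      then have s: "0 < s" using S0 unfolding s_def by simp
      have sp: "s powr p = (\<Sum>i<n. norm (x i) powr p)" unfolding s_def using p S0 by (simp add: powr_powr)
      define y where "y i = (1 / s) *\<^sub>R x i" for i
      have "(\<Sum>i<n. norm (y i) powr p) = (\<Sum>i<n. norm (x i) powr p) / s powr p"
        unfolding y_def sum_divide_distrib using s by (intro sum.cong) (auto simp: powr_divide)
      also have "\<dots> = 1" unfolding sp using False by simp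
      finally have y: "(\<Sum>i<n. norm (y i) powr p) \<le> 1" by simp
      have "norm (\<Sum>i<n. \<theta> i *\<^sub>R x i) powr (1/4) = s powr (1/4) * norm (\<Sum>i<n. \<theta> i *\<^sub>R y i) powr (1/4)" for \<theta> :: "nat \<Rightarrow> real"
      proof -
        have "(\<Sum>i<n. \<theta> i *\<^sub>R x i) = s *\<^sub>R (\<Sum>i<n. \<theta> i *\<^sub>R y i)"
          unfolding y_def scaleR_sum_right using s by (intro sum.cong) auto
        then show ?thesis using s by (simp add: powr_mult)
      qed
      then have "(\<integral>\<^sup>+ \<theta>. ennreal (norm (\<Sum>i<n. \<theta> i *\<^sub>R x i) powr (1/4)) \<partial>?P)
        = (\<integral>\<^sup>+ \<theta>. ennreal (s powr (1/4)) * ennreal (norm (\<Sum>i<n. \<theta> i *\<^sub>R y i) powr (1/4)) \<partial>?P)"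
        by (simp add: ennreal_mult)
      also have "\<dots> = ennreal (s powr (1/4)) * (\<integral>\<^sup>+ \<theta>. ennreal (norm (\<Sum>i<n. \<theta> i *\<^sub>R y i) powr (1/4)) \<partial>?P)"
      proof (rule nn_integral_cmult)
        interpret \<mu>: real_distribution \<mu> using \<mu> by (simp add: std_sym_stable_def)
        have "(\<lambda>\<theta>. norm (\<Sum>i<n. \<theta> i *\<^sub>R y i)) \<in> borel_measurable ?P"
          by (intro measurable_compose[OF borel_measurable_sum_scaleR_const borel_measurable_norm]) measurable
        then show "(\<lambda>\<theta>. ennreal (norm (\<Sum>i<n. \<theta> i *\<^sub>R y i) powr (1/4))) \<in> borel_measurable ?P" by measurable
      qed
      also have "\<dots> \<le> ennreal (s powr (1/4)) * ennreal c"
        by (intro mult_left_mono unit[OF \<mu> y]) auto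
      also have "\<dots> = ennreal ((c ^ 4 * s) powr (1/4))"
      proof -
        have "(c ^ 4) powr (1/4) = c"
        proof (cases "c = 0")
          case False
          then have "c ^ 4 = c powr 4" using c by simp
          then have "(c ^ 4) powr (1/4) = c powr (4 * (1/4))" by (simp only: powr_powr)
          then show ?thesis using c by simp
        qed simp
        then show ?thesis using s c by (simp add: powr_mult ennreal_mult[symmetric] mult.commute)
      qed
      finally show ?thesis unfolding s_def .
    qed
  qed
  show ?thesis
    unfolding stable_type_def using p c scaled by (intro exI[of _ "1/4"] exI[of _ "c ^ 4"]) auto
qed

theorem theorem5p3:
  fixes M :: "'a measure" and W :: "real \<Rightarrow> 'a \<Rightarrow> real" and \<alpha> p :: real
  assumes "brownian_motion M W"
    and "0 < \<alpha>" and "\<alpha> \<le> 1/2" and "1 \<le> p" and "p < 2" and "\<alpha> = 1/p - 1/2"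
    and "\<forall>\<phi>::real \<Rightarrow> 'e::banach. \<phi> \<in> holder_space \<alpha> \<longrightarrow> stoch_integrable M W \<phi>"
  shows "stable_type TYPE('e) p"
proof -
  have "0 < p" using assms by simp
  then obtain R where "dyadic_bound TYPE('e) (4 powr - (1/p)) R"
    using rademacher_bound[OF assms(1-3) _ assms(6,7)] by blast
  with assms(4) show ?thesis by (rule stable_type_if_rademacher_bound)
qed

end
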